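(* (1) For the class $\mathcal{P}$ of all planar graphs, $2\le \mathit{ff}(\mathcal{P})\le 4$. (2) For the class $\mathcal{P}_4$ of triangle-free planar graphs (planar graphs of girth at least $4$), $\mathit{ff}(\mathcal{P}_4)=2$.
   Context: Firefighter process: in a finite simple graph $G$, a fire starts at time $0$ at a vertex $v$. At each subsequent time step, the firefighters first protect at most $k$ vertices that are not burning (protection is permanent), and then the fire spreads from every burning vertex to all its unprotected neighbours. A vertex is saved if it never burns. Let $sn_k(G,v)$ be the maximum number of vertices of $G$ that can be saved when the fire starts at $v$. For a graph $G$ on $n$ vertices, the $k$-surviving rate is $\rho_k(G)=\frac{1}{n^2}\sum_{v\in V(G)} sn_k(G,v)$. For a class $\mathcal{C}$ of graphs, $\rho_k(\mathcal{C})$ denotes the infimum of $\rho_k(G)$ over all $G\in\mathcal{C}$ with at least two vertices, and the firefighter number $\mathit{ff}(\mathcal{C})$ is the minimum integer $k$ such that $\rho_k(\mathcal{C})>0$ (and $+\infty$ if no such $k$ exists). The girth of a graph is the length of a shortest cycle. *)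

theory Defs
  imports "HOL-Analysis.Analysis" "HOL-Library.Extended_Nat"
begin

definition simple_graph :: "nat set \<Rightarrow> nat set set \<Rightarrow> bool" where
  "simple_graph V E \<longleftrightarrow> finite V \<and>
     (\<forall>e\<in>E. \<exists>u v. e = {u, v} \<and> u \<noteq> v \<and> u \<in> V \<and> v \<in> V)"

definition planar :: "nat set \<Rightarrow> nat set set \<Rightarrow> bool" where
  "planar V E \<longleftrightarrow> (\<exists>(f :: nat \<Rightarrow> real^2) (\<gamma> :: nat set \<Rightarrow> real \<Rightarrow> real^2).
     inj_on f V \<and>
     (\<forall>e\<in>E. arc (\<gamma> e) \<and> {pathstart (\<gamma> e), pathfinish (\<gamma> e)} = f ` e \<and>
              (\<forall>x\<in>V. f x \<in> path_image (\<gamma> e) \<longrightarrow> x \<in> e)) \<and>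
     (\<forall>e\<in>E. \<forall>e'\<in>E. e \<noteq> e' \<longrightarrow>
              path_image (\<gamma> e) \<inter> path_image (\<gamma> e') \<subseteq> f ` (e \<inter> e')))"

definition triangle_free :: "nat set \<Rightarrow> nat set set \<Rightarrow> bool" where
  "triangle_free V E \<longleftrightarrow>
     \<not> (\<exists>a\<in>V. \<exists>b\<in>V. \<exists>c\<in>V. {a, b} \<in> E \<and> {b, c} \<in> E \<and> {a, c} \<in> E)"

text \<open>Firefighter process. S (Suc t) is the set protected at time Suc t.\<close>
definition protected :: "(nat \<Rightarrow> nat set) \<Rightarrow> nat \<Rightarrow> nat set" where
  "protected S t = (\<Union>i\<in>{1..t}. S i)"

fun burning :: "nat set \<Rightarrow> nat set set \<Rightarrow> nat \<Rightarrow> (nat \<Rightarrow> nat set) \<Rightarrow> nat \<Rightarrow> nat set" where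
  "burning V E v S 0 = {v}"
| "burning V E v S (Suc t) = burning V E v S t \<union>
     {w \<in> V. w \<notin> protected S (Suc t) \<and> (\<exists>u\<in>burning V E v S t. {u, w} \<in> E)}"

definition valid_strategy :: "nat \<Rightarrow> nat set \<Rightarrow> nat set set \<Rightarrow> nat \<Rightarrow> (nat \<Rightarrow> nat set) \<Rightarrow> bool" where
  "valid_strategy k V E v S \<longleftrightarrow>
     (\<forall>t. S (Suc t) \<subseteq> V - burning V E v S t \<and> card (S (Suc t)) \<le> k)"

definition saved :: "nat set \<Rightarrow> nat set set \<Rightarrow> nat \<Rightarrow> (nat \<Rightarrow> nat set) \<Rightarrow> nat set" where
  "saved V E v S = V - (\<Union>t. burning V E v S t)"

definition sn :: "nat \<Rightarrow> nat set \<Rightarrow> nat set set \<Rightarrow> nat \<Rightarrow> nat" where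
  "sn k V E v = Max {card (saved V E v S) | S. valid_strategy k V E v S}"

definition surviving_rate :: "nat \<Rightarrow> nat set \<Rightarrow> nat set set \<Rightarrow> real" where
  "surviving_rate k V E = (\<Sum>v\<in>V. real (sn k V E v)) / (real (card V))^2"

definition class_surviving_rate :: "nat \<Rightarrow> (nat set \<times> nat set set) set \<Rightarrow> real" where
  "class_surviving_rate k C =
     Inf {surviving_rate k V E | V E. (V, E) \<in> C \<and> card V \<ge> 2}"

definition firefighter_number :: "(nat set \<times> nat set set) set \<Rightarrow> enat" where
  "firefighter_number C =
     (if \<exists>k. class_surviving_rate k C > 0
      then enat (LEAST k. class_surviving_rate k C > 0) else \<infinity>)"

definition planar_graphs :: "(nat set \<times> nat set set) set" where
  "planar_graphs = {(V, E). simple_graph V E \<and> planar V E}"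

definition triangle_free_planar_graphs :: "(nat set \<times> nat set set) set" where
  "triangle_free_planar_graphs =
     {(V, E). simple_graph V E \<and> planar V E \<and> triangle_free V E}"

end

theory Submission
  imports Defs "HOL-Complex_Analysis.Winding_Numbers" "HOL-Library.Multiset"
begin

text \<open>
  Upper bounds. A plane drawing yields a cyclic order of the edges at every vertex whose faces satisfy
  Euler's formula (ears of a nonseparable graph are added one at a time, each splitting the region of
  one Jordan curve; at a cut vertex two faces are concatenated). For a breadth first tree rooted at
  the origin of the fire, the dual of the remaining edges is a tree, so there is a face such that the
  tree paths to two of its corners separate the graph in a balanced way. The firefighters can protect
  both paths in time, and if the origin has degree at most \<open>2 k - 1\<close> they can also protect its
  neighbours on one of the two sides, which saves about a third of the vertices. By Euler's formula
  a fifth of the vertices of a planar graph have degree at most 7. A triangle-free planar graph may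
  have few vertices of degree at most 3, but then by discharging almost all of its vertices lie in
  large pieces that are images of the square grid, where two firefighters contain the fire; as the
  map from the grid maps neighbourhoods onto neighbourhoods, it need not be injective.

  Lower bound. In \<open>K\<^sub>2\<^sub>,\<^sub>N\<close> one firefighter saves at most four vertices.
\<close>

section \<open>Arcs and Jordan curves\<close>

text \<open>Topology serves only to produce the facial walks and to count them. Afterwards planarity
  survives as one inequality between the numbers of edges, vertices and facial walks, and no
  orientation is ever read off the drawing. The separator is therefore not a curve but a set of
  darts, a dart standing for a corner of a face, and what bounds it is located by counting darts
  that enter and leave subtrees.

  Two tree paths have at most two vertices at each distance from the origin, so two firefighters
  keep pace with the fire along them. Only time 1 is critical, when the neighbours of the origin on
  one side are due as well; this is where \<open>2 * k - 1\<close> comes from. For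
  \<open>k = 3\<close> it would be 5, but there are planar graphs with almost all degrees equal to 6
  and few vertices of degree at most 5; \<open>k = 4\<close> leaves a margin above the average
  degree, which is below 6. For triangle-free graphs the average is below 4, and
  \<open>k = 2\<close> only reaches degree 3, without a margin. The exceptional graphs look like the
  square grid almost everywhere, so a second strategy closes the gap.\<close>

locale theta_curve =
  fixes c1 c2 c :: "real \<Rightarrow> complex" and a b :: complex
  assumes arcs: "arc c1" "arc c2" "arc c"
    and ends: "pathstart c1 = a" "pathfinish c1 = b" "pathstart c2 = a" "pathfinish c2 = b"
      "pathstart c = a" "pathfinish c = b"
    and meets: "path_image c1 \<inter> path_image c2 = {a,b}" "path_image c1 \<inter> path_image c = {a,b}"
      "path_image c2 \<inter> path_image c = {a,b}"
begin

lemma a_neq_b: "a \<noteq> b"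
  using arcs(1) ends(1,2) arc_distinct_ends by blast

lemma loop12: "simple_path (c1 +++ reversepath c2)"
  using arcs ends meets a_neq_b
  by (intro simple_path_join_loop) (auto simp: arc_reversepath)

lemma path_image_loop12: "path_image (c1 +++ reversepath c2) = path_image c1 \<union> path_image c2"
  using ends by (simp add: path_image_join)

lemma closed_loop12: "pathfinish (c1 +++ reversepath c2) = pathstart (c1 +++ reversepath c2)"
  using ends by simp

lemmas jordan12 = Jordan_inside_outside[OF loop12 closed_loop12, unfolded path_image_loop12]

lemma mem_outside12: "x \<in> outside (path_image c1 \<union> path_image c2) \<longleftrightarrow>
    x \<notin> path_image c1 \<and> x \<notin> path_image c2 \<and> x \<notin> inside (path_image c1 \<union> path_image c2)"
  by (simp add: outside_inside)

lemma not_mem_inside12: "x \<in> path_image c1 \<Longrightarrow> x \<notin> inside (path_image c1 \<union> path_image c2)"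
   "x \<in> path_image c2 \<Longrightarrow> x \<notin> inside (path_image c1 \<union> path_image c2)"
  using inside_no_overlap[of "path_image c1 \<union> path_image c2"] by blast+

lemma permute: "theta_curve c2 c1 c a b" "theta_curve c1 c c2 a b" "theta_curve c2 c c1 a b" "theta_curve c c2 c1 a b" "theta_curve c c1 c2 a b"
  using arcs ends meets by (unfold_locales; auto)+

lemma connected_interior: "connected (path_image c - {a, b})"
  using connected_simple_path_endless[OF arc_imp_simple_path[OF arcs(3)]] ends by simp

lemma interior_nonempty: "path_image c - {a, b} \<noteq> {}"
  using nonempty_simple_path_endless[OF arc_imp_simple_path[OF arcs(3)]] ends by simp

lemma split_inside:
  assumes "path_image c \<inter> inside (path_image c1 \<union> path_image c2) \<noteq> {}"
  shows "inside (path_image c1 \<union> path_image c) \<inter> inside (path_image c2 \<union> path_image c) = {} \<and>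
     inside (path_image c1 \<union> path_image c) \<union> inside (path_image c2 \<union> path_image c) \<union>
           (path_image c - {a,b}) = inside (path_image c1 \<union> path_image c2)"
  by (rule split_inside_simple_closed_curve[of c1 a b c2 c])
     (use arcs ends meets a_neq_b assms in \<open>auto simp: arc_imp_simple_path\<close>)

lemma winding_number_loop12:
  assumes "z \<notin> path_image c1" "z \<notin> path_image c2"
  shows "winding_number (c1 +++ reversepath c2) z = winding_number c1 z - winding_number c2 z"
  using assms arcs ends
  by (simp add: winding_number_join winding_number_reversepath arc_imp_path)

text \<open>Membership in the inside is read off the winding number, which is additive in the arcs.
  This is how the three loops of the theta curve are compared.\<close>

lemma winding_number_loop12_eq_0_iff:
  assumes "z \<notin> path_image c1" "z \<notin> path_image c2"
  shows "winding_number (c1 +++ reversepath c2) z = 0 \<longleftrightarrow> z \<notin> inside (path_image c1 \<union> path_image c2)"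
proof (cases "z \<in> inside (path_image c1 \<union> path_image c2)")
  case True
  then show ?thesis
    using simple_closed_path_winding_number_inside[OF loop12] path_image_loop12
    by (metis norm_zero norm_one one_neq_zero zero_neq_neg_one)
next
  case False
  then have "z \<in> outside (path_image (c1 +++ reversepath c2))"
    unfolding path_image_loop12
    using assms by (metis ComplI UnE inside_Un_outside)
  then show ?thesis
    using False winding_number_zero_in_outside[OF simple_path_imp_path[OF loop12] closed_loop12] by auto
qed

lemma subset_inside_or_outside:
  assumes "connected S" "S \<inter> (path_image c1 \<union> path_image c2) = {}"
  shows "S \<subseteq> inside (path_image c1 \<union> path_image c2) \<or> S \<subseteq> outside (path_image c1 \<union> path_image c2)"
proof -
  let ?I = "inside (path_image c1 \<union> path_image c2)" and ?O = "outside (path_image c1 \<union> path_image c2)"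
  have "S \<subseteq> ?I \<union> ?O"
    using assms(2) mem_outside12 by blast
  moreover have "open ?I" "open ?O" using jordan12 by simp_all
  moreover have "?I \<inter> ?O \<inter> S = {}" using mem_outside12 by blast
  ultimately have "?I \<inter> S = {} \<or> ?O \<inter> S = {}"
    using connectedD[OF assms(1)] by blast
  then show ?thesis using \<open>S \<subseteq> ?I \<union> ?O\<close> by blast
qed

text \<open>An arc \<open>c\<close> outside the loop forces the inside of the loop into the inside of one of the two other loops.\<close>
lemma inside_imp_arc_inside:
  assumes out: "path_image c - {a, b} \<subseteq> outside (path_image c1 \<union> path_image c2)"
    and z: "z \<in> inside (path_image c1 \<union> path_image c2)" "z \<in> inside (path_image c1 \<union> path_image c)"
  shows "path_image c2 \<inter> inside (path_image c1 \<union> path_image c) \<noteq> {}"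
proof -
  interpret p: theta_curve c1 c c2 a b by (rule permute)
  let ?I = "inside (path_image c1 \<union> path_image c2)"
  have ab: "a \<in> path_image c1" "b \<in> path_image c1" using meets by auto
  have "x \<notin> path_image c" if "x \<in> ?I" for x
    using out that mem_outside12[of x] not_mem_inside12 ab by blast
  then have dis: "?I \<inter> (path_image c1 \<union> path_image c) = {}"
    using not_mem_inside12 by blast
  have "connected ?I" using jordan12 by simp
  then have "?I \<subseteq> inside (path_image c1 \<union> path_image c)"
    using p.subset_inside_or_outside[OF _ dis] p.mem_outside12 z by blast
  \<comment> \<open>\<open>c2\<close> lies on the frontier of \<open>?I\<close>, hence in its
    closure; its inner points are on neither \<open>c1\<close> nor \<open>c\<close>, so they must be
    inside.\<close>
  then have "closure ?I \<subseteq> closure (inside (path_image c1 \<union> path_image c))"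
    by (rule closure_mono)
  moreover have "path_image c2 \<subseteq> frontier ?I" using jordan12 by simp
  then have "path_image c2 \<subseteq> closure ?I" by (auto simp: frontier_def)
  moreover have "frontier (inside (path_image c1 \<union> path_image c)) = path_image c1 \<union> path_image c"
    using p.jordan12 by simp
  then have "closure (inside (path_image c1 \<union> path_image c)) = inside (path_image c1 \<union> path_image c) \<union> (path_image c1 \<union> path_image c)"
    by (metis closure_Un_frontier)
  ultimately have "path_image c2 \<subseteq> inside (path_image c1 \<union> path_image c) \<union> path_image c1 \<union> path_image c"
    by blast
  moreover obtain x where "x \<in> path_image c2" "x \<noteq> a" "x \<noteq> b"
    using p.interior_nonempty by blast
  moreover have "x \<notin> path_image c1 \<and> x \<notin> path_image c"
    using calculation(2-4) meets by blast
  ultimately show ?thesis by blast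
qed

text \<open>Here \<open>c2\<close> is a chord of the larger loop formed by \<open>c1\<close> and
  \<open>c\<close>, so \<open>split_inside\<close> applies with the roles of \<open>c\<close> and
  \<open>c2\<close> exchanged. Taking complements gives the statement about outsides.\<close>

lemma split_outside_aux:
  assumes out: "path_image c - {a, b} \<subseteq> outside (path_image c1 \<union> path_image c2)"
    and ne: "path_image c2 \<inter> inside (path_image c1 \<union> path_image c) \<noteq> {}"
  shows "outside (path_image c1 \<union> path_image c) \<inter> inside (path_image c2 \<union> path_image c) = {} \<and>
     outside (path_image c1 \<union> path_image c) \<union> inside (path_image c2 \<union> path_image c) \<union>
           (path_image c - {a,b}) = outside (path_image c1 \<union> path_image c2)"
proof -
  interpret p: theta_curve c1 c c2 a b by (rule permute)
  interpret q: theta_curve c2 c c1 a b by (rule permute)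
  note sp = p.split_inside[OF ne]
  \<comment> \<open>What remains is propositional: for a point \<open>x\<close> it combines
    membership in the arcs and in the three insides.\<close>
  have sp1: "x \<in> inside (path_image c1 \<union> path_image c) \<longleftrightarrow>
      x \<in> inside (path_image c1 \<union> path_image c2) \<or> x \<in> inside (path_image c2 \<union> path_image c) \<or> (x \<in> path_image c2 \<and> x \<noteq> a \<and> x \<noteq> b)" for x
    using conjunct2[OF sp, symmetric] by (auto simp add: Un_commute)
  have sp2: "\<not> (x \<in> inside (path_image c1 \<union> path_image c2) \<and> x \<in> inside (path_image c2 \<union> path_image c))" for x
    using conjunct1[OF sp] by (auto simp add: Un_commute)
  have m: "x \<in> path_image c1 \<and> x \<in> path_image c2 \<longleftrightarrow> x = a \<or> x = b"
     "x \<in> path_image c1 \<and> x \<in> path_image c \<longleftrightarrow> x = a \<or> x = b"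
     "x \<in> path_image c2 \<and> x \<in> path_image c \<longleftrightarrow> x = a \<or> x = b" for x
    using meets by blast+
  have o: "x \<in> path_image c \<Longrightarrow> x \<noteq> a \<Longrightarrow> x \<noteq> b \<Longrightarrow> x \<in> outside (path_image c1 \<union> path_image c2)" for x
    using out by blast
  have "\<not> (x \<in> outside (path_image c1 \<union> path_image c) \<and> x \<in> inside (path_image c2 \<union> path_image c))" for x
    using sp1[of x] p.mem_outside12[of x] by blast
  moreover have "x \<in> outside (path_image c1 \<union> path_image c) \<or> x \<in> inside (path_image c2 \<union> path_image c) \<or> (x \<in> path_image c \<and> x \<noteq> a \<and> x \<noteq> b)
     \<longleftrightarrow> x \<in> outside (path_image c1 \<union> path_image c2)" for x
    using sp1[of x] sp2[of x] p.mem_outside12[of x] mem_outside12[of x] m[of x] o[of x] 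
      q.not_mem_inside12[of x] p.not_mem_inside12[of x] not_mem_inside12[of x]
    by argo
  ultimately show ?thesis by blast
qed

end

text \<open>The bounded and the unbounded regions of a drawing are treated alike, since either may
  receive the next ear.\<close>

definition jordan_side :: "complex set \<Rightarrow> complex set \<Rightarrow> bool" where
  "jordan_side J R \<longleftrightarrow> R = inside J \<or> R = outside J"

text \<open>An ear drawn in the region \<open>R\<close> splits it in two. The inside case is a known
  property of simple closed curves; the outside case is reduced to it by finding out which of the
  two new loops surrounds the old one.\<close>

theorem (in theta_curve) split_jordan_side:
  assumes R: "jordan_side (path_image c1 \<union> path_image c2) R" and ne: "path_image c \<inter> R \<noteq> {}"
  obtains R1 R2 where "jordan_side (path_image c1 \<union> path_image c) R1" "jordan_side (path_image c2 \<union> path_image c) R2"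
    "R1 \<inter> R2 = {}" "R1 \<union> R2 \<union> (path_image c - {a,b}) = R"
proof (cases "R = inside (path_image c1 \<union> path_image c2)")
  case True
  then show ?thesis
    using split_inside ne that unfolding jordan_side_def by blast
next
  case False
  then have R: "R = outside (path_image c1 \<union> path_image c2)"
    using assms(1) by (simp add: jordan_side_def)
  interpret p: theta_curve c1 c c2 a b by (rule permute)
  interpret q: theta_curve c2 c c1 a b by (rule permute)
  interpret s: theta_curve c2 c1 c a b by (rule permute)
  have ab: "a \<in> path_image c1" "b \<in> path_image c1" using meets by auto
  have out: "path_image c - {a, b} \<subseteq> outside (path_image c1 \<union> path_image c2)"
  proof -
    have "path_image c - {a,b} \<subseteq> inside (path_image c1 \<union> path_image c2) \<or>
       path_image c - {a,b} \<subseteq> outside (path_image c1 \<union> path_image c2)"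
      by (rule subset_inside_or_outside[OF connected_interior]) (use meets in blast)
    moreover obtain x where "x \<in> path_image c" "x \<in> outside (path_image c1 \<union> path_image c2)"
      using ne R by blast
    moreover have "x \<noteq> a" "x \<noteq> b" "x \<notin> inside (path_image c1 \<union> path_image c2)"
      using calculation(3) mem_outside12[of x] ab by auto
    ultimately show ?thesis by blast
  qed
  obtain z where z: "z \<in> inside (path_image c1 \<union> path_image c2)"
    using jordan12 by blast
  have zn: "z \<notin> path_image c1" "z \<notin> path_image c2"
    using z not_mem_inside12 by auto
  moreover have "z \<notin> path_image c"
    using z zn(1) ab out mem_outside12[of z] by blast
  \<comment> \<open>The winding number of the loop of \<open>c1\<close> and \<open>c2\<close> around
    \<open>z\<close> is the difference of those of the other two loops. It is nonzero, so
    \<open>z\<close> is inside at least one of these.\<close>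
  ultimately have "z \<in> inside (path_image c1 \<union> path_image c) \<or> z \<in> inside (path_image c2 \<union> path_image c)"
    using z winding_number_loop12_eq_0_iff[of z] p.winding_number_loop12_eq_0_iff[of z] q.winding_number_loop12_eq_0_iff[of z]
      winding_number_loop12[of z] p.winding_number_loop12[of z] q.winding_number_loop12[of z] by auto
  then show ?thesis
  proof
    assume "z \<in> inside (path_image c1 \<union> path_image c)"
    from split_outside_aux[OF out inside_imp_arc_inside[OF out z this]] show ?thesis
      using that[of "outside (path_image c1 \<union> path_image c)" "inside (path_image c2 \<union> path_image c)"] R
      by (auto simp: jordan_side_def)
  next
    assume "z \<in> inside (path_image c2 \<union> path_image c)"
    from s.split_outside_aux[OF _ s.inside_imp_arc_inside[OF _ _ this]] show ?thesis
      using that[of "inside (path_image c1 \<union> path_image c)" "outside (path_image c2 \<union> path_image c)"] R out z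
      by (auto simp: jordan_side_def Un_commute Int_commute)
  qed
qed

section \<open>Facial walks\<close>

definition walk_darts :: "'a list \<Rightarrow> ('a \<times> 'a) list" where
  "walk_darts xs = zip xs (tl xs)"

definition steps :: "'a list \<Rightarrow> ('a \<times> 'a) set" where
  "steps xs = set (walk_darts xs)"

text \<open>The pairs of cyclically consecutive entries; for a face these are the pairs of a dart
  and its successor.\<close>

definition links :: "'a list \<Rightarrow> ('a \<times> 'a) set" where
  "links xs = steps (xs @ [hd xs])"

lemma walk_darts_simps [simp]:
  "walk_darts [] = []" "walk_darts [x] = []"
  "walk_darts (x # y # zs) = (x, y) # walk_darts (y # zs)"
  by (simp_all add: walk_darts_def)

lemma walk_darts_append:
  "xs \<noteq> [] \<Longrightarrow> ys \<noteq> [] \<Longrightarrow> walk_darts (xs @ ys) = walk_darts xs @ (last xs, hd ys) # walk_darts ys"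
proof (induction xs)
  case (Cons x xs)
  then show ?case by (cases xs; cases ys) auto
qed simp

lemma walk_darts_split:
  "walk_darts (xs @ y # zs) = walk_darts (xs @ [y]) @ walk_darts (y # zs)"
  by (cases "xs = []"; cases "zs = []") (simp_all add: walk_darts_append[of xs "y # zs"] walk_darts_append[of xs "[y]"])

lemma length_walk_darts [simp]: "length (walk_darts xs) = length xs - 1"
  by (simp add: walk_darts_def)

lemma nth_walk_darts: "Suc i < length xs \<Longrightarrow> walk_darts xs ! i = (xs ! i, xs ! Suc i)"
  by (simp add: walk_darts_def nth_tl)

lemma walk_darts_rev: "walk_darts (rev xs) = map prod.swap (rev (walk_darts xs))"
proof (induction xs)
  case (Cons x xs)
  then show ?case
  proof (cases xs)
    case (Cons y ys)
    have "walk_darts (rev (x # xs)) = walk_darts (rev xs @ [x])" by simp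
    also have "\<dots> = walk_darts (rev xs) @ [(last (rev xs), x)]"
      using Cons by (simp add: walk_darts_append del: rev.simps)
    finally show ?thesis using Cons Cons.IH by (simp add: last_rev)
  qed simp
qed simp

lemma steps_simps [simp]:
  "steps [] = {}" "steps [x] = {}" "steps (x # y # zs) = insert (x, y) (steps (y # zs))"
  by (simp_all add: steps_def)

lemma steps_append:
  "xs \<noteq> [] \<Longrightarrow> ys \<noteq> [] \<Longrightarrow> steps (xs @ ys) = insert (last xs, hd ys) (steps xs \<union> steps ys)"
  by (auto simp: steps_def walk_darts_append)

lemma steps_nth: "steps xs = {(xs ! i, xs ! Suc i) | i. Suc i < length xs}"
proof -
  have "x \<in> steps xs \<longleftrightarrow> (\<exists>i. i < length xs - 1 \<and> walk_darts xs ! i = x)" for x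
    unfolding steps_def in_set_conv_nth by simp
  also have "\<dots> x \<longleftrightarrow> (\<exists>i. Suc i < length xs \<and> x = (xs ! i, xs ! Suc i))" for x
    by (metis Suc_less_eq2 less_diff_conv nth_walk_darts Suc_eq_plus1)
  finally show ?thesis by blast
qed

lemma steps_walk_darts:
  "steps (walk_darts ps) = {((ps ! i, ps ! Suc i), (ps ! Suc i, ps ! Suc (Suc i))) | i. Suc (Suc i) < length ps}"
proof -
  have "x \<in> steps (walk_darts ps) \<longleftrightarrow>
      (\<exists>i. Suc (Suc i) < length ps \<and> x = ((ps ! i, ps ! Suc i), (ps ! Suc i, ps ! Suc (Suc i))))" for x
    unfolding steps_nth[of "walk_darts ps"] length_walk_darts mem_Collect_eq
    by (rule ex_cong1) (auto simp: nth_walk_darts less_diff_conv)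
  then show ?thesis by blast
qed

lemma steps_rev: "steps (rev xs) = prod.swap ` steps xs"
  by (simp add: steps_def walk_darts_rev)

lemma walk_darts_map: "walk_darts (map f xs) = map (map_prod f f) (walk_darts xs)"
  by (induction xs rule: induct_list012) auto

lemma steps_map: "steps (map f xs) = map_prod f f ` steps xs"
  by (simp add: steps_def walk_darts_map)

lemma links_append:
  assumes "xs \<noteq> []" "ys \<noteq> []"
  shows "links (xs @ ys) = {(last xs, hd ys), (last ys, hd xs)} \<union> steps xs \<union> steps ys"
  using assms by (auto simp: links_def steps_append)

lemma links_rotate: "links (xs @ ys) = links (ys @ xs)"
  by (cases "xs = []"; cases "ys = []") (auto simp: links_append)

lemma links_Nil [simp]: "links [] = {}"
  by (simp add: links_def)

lemma links_eq: "xs \<noteq> [] \<Longrightarrow> links xs = insert (last xs, hd xs) (steps xs)"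
  by (auto simp: links_def steps_append)

section \<open>Combinatorial maps given by their facial walks\<close>

definition darts :: "'a set set \<Rightarrow> ('a \<times> 'a) set" where
  "darts E = {(u, w). {u, w} \<in> E}"

lemma swap_darts [simp]: "prod.swap d \<in> darts E \<longleftrightarrow> d \<in> darts E"
  by (auto simp: darts_def insert_commute prod.swap_def)

text \<open>If the face runs along the dart \<open>prod.swap p\<close> and then along \<open>q\<close>, then \<open>q\<close> follows \<open>p\<close> in the rotation
  around their common source.\<close>
definition star_steps :: "('a \<times> 'a) list multiset \<Rightarrow> (('a \<times> 'a) \<times> ('a \<times> 'a)) set" where
  "star_steps Fs = {(p, q). \<exists>D\<in>#Fs. (prod.swap p, q) \<in> links D}"

lemma mem_star_steps:
  "(p, q) \<notin> star_steps {#}"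
  "(p, q) \<in> star_steps (add_mset D Fs) \<longleftrightarrow> (prod.swap p, q) \<in> links D \<or> (p, q) \<in> star_steps Fs"
  "(p, q) \<in> star_steps (Fs + Gs) \<longleftrightarrow> (p, q) \<in> star_steps Fs \<or> (p, q) \<in> star_steps Gs"
  by (auto simp: star_steps_def)

lemma star_steps_union: "star_steps (Fs + Gs) = star_steps Fs \<union> star_steps Gs"
  by (auto simp: star_steps_def)

lemma star_steps_rotate: "star_steps (add_mset (xs @ ys) Fs) = star_steps (add_mset (ys @ xs) Fs)"
  by (auto simp: star_steps_def links_rotate[of xs ys])

text \<open>Faces are cyclic lists of darts, every dart lying on exactly one face. The last condition says that the
  rotation around each vertex is a single cycle.\<close>
definition facial :: "'a set set \<Rightarrow> ('a \<times> 'a) list multiset \<Rightarrow> bool" where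
  "facial E Fs \<longleftrightarrow>
     (\<Sum>D\<in>#Fs. mset D) = mset_set (darts E) \<and> finite (darts E) \<and>
     (\<forall>D\<in>#Fs. D \<noteq> [] \<and> (\<forall>(a, b)\<in>links D. snd a = fst b)) \<and>
     (\<forall>d\<in>darts E. \<forall>d'\<in>darts E. fst d = fst d' \<longrightarrow> (d, d') \<in> (star_steps Fs)\<^sup>*)"

lemma facial_rotate:
  "facial E (add_mset (xs @ ys) Fs) \<Longrightarrow> facial E (add_mset (ys @ xs) Fs)"
  unfolding facial_def star_steps_rotate[of xs ys] by (auto simp add: links_rotate[of xs ys] add_ac)

lemma facial_darts: "facial E Fs \<Longrightarrow> darts E = {d. \<exists>D\<in>#Fs. d \<in> set D}"
proof -
  assume "facial E Fs"
  then have "set_mset (\<Sum>D\<in>#Fs. mset D) = darts E" by (simp add: facial_def)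
  then show ?thesis by auto
qed

lemma links_subset: "links xs \<subseteq> set xs \<times> set xs"
proof (cases "xs = []")
  case False
  then show ?thesis by (auto simp: links_eq steps_nth intro: nth_mem)
qed simp

lemma facial_link:
  assumes "facial E Fs" "D \<in># Fs" "(a, b) \<in> links D"
  shows "snd a = fst b" "a \<in> darts E" "b \<in> darts E"
proof -
  show "snd a = fst b" using assms by (fastforce simp: facial_def)
  have "a \<in> set D" "b \<in> set D" using assms(3) links_subset by blast+
  then show "a \<in> darts E" "b \<in> darts E" using assms(2) facial_darts[OF assms(1)] by blast+
qed

lemma star_steps_fst:
  assumes "facial E Fs" "(d, d') \<in> star_steps Fs"
  shows "fst d = fst d'" "d \<in> darts E" "d' \<in> darts E"
proof -
  obtain D where *: "D \<in># Fs" "(prod.swap d, d') \<in> links D"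
    using assms(2) by (auto simp: star_steps_def)
  from facial_link[OF assms(1) this] show "fst d = fst d'" "d \<in> darts E" "d' \<in> darts E" by simp_all
qed

lemma facial_empty: "facial {} {#}"
  by (auto simp: facial_def darts_def)

lemma facial_edge: "a \<noteq> b \<Longrightarrow> facial {{a, b}} {#[(a, b), (b, a)]#}"
proof -
  assume ab: "a \<noteq> b"
  have d: "darts {{a, b}} = {(a, b), (b, a)}" by (auto simp: darts_def doubleton_eq_iff)
  show ?thesis using ab unfolding facial_def d by (auto simp: links_def)
qed

text \<open>Disjoint maps keep all their faces. A region that a drawing shares between two
  components is thus counted once per component, which is why Euler's formula later becomes an
  inequality.\<close>

lemma facial_Un:
  assumes "facial E1 F1" "facial E2 F2" "fst ` darts E1 \<inter> fst ` darts E2 = {}"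
  shows "facial (E1 \<union> E2) (F1 + F2)"
proof -
  have d: "darts (E1 \<union> E2) = darts E1 \<union> darts E2" "darts E1 \<inter> darts E2 = {}"
    using assms(3) by (auto simp: darts_def)
  have "(d, d') \<in> (star_steps (F1 + F2))\<^sup>*"
    if "d \<in> darts E1 \<union> darts E2" "d' \<in> darts E1 \<union> darts E2" "fst d = fst d'" for d d'
  proof -
    have "(d, d') \<in> (star_steps F1)\<^sup>* \<or> (d, d') \<in> (star_steps F2)\<^sup>*"
      using that assms unfolding facial_def by (metis UnE disjoint_iff image_eqI)
    then show ?thesis by (metis rtrancl_mono star_steps_union subsetD sup_ge1 sup_ge2)
  qed
  then show ?thesis
    using assms d unfolding facial_def by (auto simp: mset_set_Union)
qed

text \<open>A path to \<open>q\<close> may stop at its first visit to \<open>q\<close>, so it never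
  has to leave \<open>q\<close>.\<close>

lemma rtrancl_avoid_from: "(p, q) \<in> R\<^sup>* \<Longrightarrow> (p, q) \<in> (R - {(q, r)})\<^sup>*"
proof (induction rule: converse_rtrancl_induct)
  case (step y z)
  then show ?case
    by (cases "y = q") (auto intro: converse_rtrancl_into_rtrancl)
qed simp

lemma rtrancl_avoid_to: "(r, p) \<in> R\<^sup>* \<Longrightarrow> (r, p) \<in> (R - {(q, r)})\<^sup>*"
proof (induction rule: rtrancl_induct)
  case (step y z)
  then show ?case
    by (cases "z = r") (auto intro: rtrancl_into_rtrancl)
qed simp

text \<open>Two maps that share only the vertex \<open>x\<close> lose one face when they are joined.\<close>
lemma facial_glue:
  assumes f1: "facial E1 (add_mset D1 F1)" and f2: "facial E2 (add_mset D2 F2)"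
    and ne: "fst (hd D1) = x" "fst (hd D2) = x"
    and dis: "fst ` darts E1 \<inter> fst ` darts E2 \<subseteq> {x}" "darts E1 \<inter> darts E2 = {}"
  shows "facial (E1 \<union> E2) (add_mset (D1 @ D2) (F1 + F2))"
proof -
  have ne': "D1 \<noteq> []" "D2 \<noteq> []" using f1 f2 by (auto simp: facial_def)
  define S1 where "S1 = star_steps (add_mset D1 F1)"
  define S2 where "S2 = star_steps (add_mset D2 F2)"
  define S where "S = star_steps (add_mset (D1 @ D2) (F1 + F2))"
  let ?a1 = "prod.swap (last D1)" and ?a2 = "prod.swap (last D2)"
  have "(p, q) \<in> S" if "(p, q) \<in> S1" "(p, q) \<noteq> (?a1, hd D1)" for p q
    using that unfolding S1_def S_def mem_star_steps links_append[OF ne'] links_eq[OF ne'(1)]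
    by (simp only: insert_iff Un_iff prod.inject) (metis swap_swap)
  then have sub1: "S1 - {(?a1, hd D1)} \<subseteq> S" by auto
  have "(p, q) \<in> S" if "(p, q) \<in> S2" "(p, q) \<noteq> (?a2, hd D2)" for p q
    using that unfolding S2_def S_def mem_star_steps links_append[OF ne'] links_eq[OF ne'(2)]
    by (simp only: insert_iff Un_iff prod.inject) (metis swap_swap)
  then have sub2: "S2 - {(?a2, hd D2)} \<subseteq> S" by auto
  \<comment> \<open>The cycles around \<open>x\<close> in the two maps are cut at the corners where
    \<open>D1\<close> and \<open>D2\<close> close up, and spliced into one cycle.\<close>
  have new: "(?a1, hd D2) \<in> S" "(?a2, hd D1) \<in> S"
    unfolding S_def mem_star_steps links_append[OF ne'] by simp_all
  have d: "darts (E1 \<union> E2) = darts E1 \<union> darts E2" by (auto simp: darts_def)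
  have last: "(last D1, hd D1) \<in> links D1" "(last D2, hd D2) \<in> links D2"
    using ne' by (auto simp: links_eq)
  have in1: "hd D1 \<in> darts E1" "?a1 \<in> darts E1" "fst ?a1 = x" 
    using facial_link[OF f1 _ last(1)] ne by simp_all
  have in2: "hd D2 \<in> darts E2" "?a2 \<in> darts E2" "fst ?a2 = x" 
    using facial_link[OF f2 _ last(2)] ne by simp_all
  have star1: "(p, q) \<in> S1\<^sup>*" if "p \<in> darts E1" "q \<in> darts E1" "fst p = fst q" for p q
    using f1 that by (simp add: facial_def S1_def)
  have star2: "(p, q) \<in> S2\<^sup>*" if "p \<in> darts E2" "q \<in> darts E2" "fst p = fst q" for p q
    using f2 that by (simp add: facial_def S2_def)
  \<comment> \<open>A path to \<open>?a1\<close> need not leave \<open>?a1\<close>, and a path from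
    \<open>hd D1\<close> need not return to it, so both survive the loss of the step between
    them.\<close>
  have to1: "(p, ?a1) \<in> S\<^sup>*" "(hd D1, p) \<in> S\<^sup>*" if "p \<in> darts E1" "fst p = x" for p
  proof -
    have "(p, ?a1) \<in> S1\<^sup>*" "(hd D1, p) \<in> S1\<^sup>*"
      by (rule star1; use that in1 ne in simp)+
    then show "(p, ?a1) \<in> S\<^sup>*" "(hd D1, p) \<in> S\<^sup>*"
      by (auto intro: subsetD[OF rtrancl_mono[OF sub1] rtrancl_avoid_from] subsetD[OF rtrancl_mono[OF sub1] rtrancl_avoid_to])
  qed
  have to2: "(p, ?a2) \<in> S\<^sup>*" "(hd D2, p) \<in> S\<^sup>*" if "p \<in> darts E2" "fst p = x" for p
  proof -
    have "(p, ?a2) \<in> S2\<^sup>*" "(hd D2, p) \<in> S2\<^sup>*"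
      by (rule star2; use that in2 ne in simp)+
    then show "(p, ?a2) \<in> S\<^sup>*" "(hd D2, p) \<in> S\<^sup>*"
      by (auto intro: subsetD[OF rtrancl_mono[OF sub2] rtrancl_avoid_from] subsetD[OF rtrancl_mono[OF sub2] rtrancl_avoid_to])
  qed
  have to12: "(p, q) \<in> S\<^sup>*" if "p \<in> darts E1" "fst p = x" "q \<in> darts E2" "fst q = x" for p q
    using to1(1)[OF that(1,2)] new(1) to2(2)[OF that(3,4)] by (meson rtrancl.rtrancl_into_rtrancl rtrancl_trans)
  have to21: "(p, q) \<in> S\<^sup>*" if "p \<in> darts E2" "fst p = x" "q \<in> darts E1" "fst q = x" for p q
    using to2(1)[OF that(1,2)] new(2) to1(2)[OF that(3,4)] by (meson rtrancl.rtrancl_into_rtrancl rtrancl_trans)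
  \<comment> \<open>Both removed steps lead to a dart from \<open>x\<close>, so the rotation at
    every other vertex is untouched.\<close>
  have fixed: "(p, q) \<in> S\<^sup>*" if pq: "(p, q) \<in> T\<^sup>*" "fst p \<noteq> x" and T: "T = S1 \<and> D = D1 \<or> T = S2 \<and> D = D2" for p q T D
  proof -
    have fst: "fst y = fst z" if "(y, z) \<in> T" for y z
      using that T star_steps_fst(1)[OF f1] star_steps_fst(1)[OF f2] unfolding S1_def S2_def by blast
    from pq(1) have "(p, q) \<in> S\<^sup>* \<and> fst q = fst p"
    proof (induction rule: rtrancl_induct)
      case (step y z)
      then have "fst y = fst p" "fst z = fst p" using fst by auto
      then have "z \<noteq> hd D1" "z \<noteq> hd D2" using pq(2) ne by auto
      then have "(y, z) \<in> S"
        using step(2) T subsetD[OF sub1, of "(y, z)"] subsetD[OF sub2, of "(y, z)"] by blast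
      then show ?case using step \<open>fst z = fst p\<close> by auto
    qed simp
    then show ?thesis by blast
  qed
  have "(p, q) \<in> S\<^sup>*" if pq: "p \<in> darts E1 \<union> darts E2" "q \<in> darts E1 \<union> darts E2" "fst p = fst q" for p q
  proof (cases "fst p = x")
    case True
    then have x: "fst p = x" "fst q = x" using pq by auto
    consider "p \<in> darts E1" "q \<in> darts E1" | "p \<in> darts E2" "q \<in> darts E2" 
      | "p \<in> darts E1" "q \<in> darts E2" | "p \<in> darts E2" "q \<in> darts E1" using pq by blast
    then show ?thesis
    proof cases
      case 1
      then show ?thesis using to12[of p ?a2] to21[of ?a2 q] x in2 by (meson rtrancl_trans)
    next
      case 2
      then show ?thesis using to21[of p ?a1] to12[of ?a1 q] x in1 by (meson rtrancl_trans)
    qed (use to12 to21 x in auto)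
  next
    case False
    then have "p \<in> darts E1 \<and> q \<in> darts E1 \<or> p \<in> darts E2 \<and> q \<in> darts E2"
    proof -
      have "\<not> (fst p \<in> fst ` darts E1 \<and> fst p \<in> fst ` darts E2)" using dis(1) False by blast
      then show ?thesis using pq by (metis UnE image_eqI)
    qed
    moreover have "(p, q) \<in> S\<^sup>*" if "p \<in> darts E1" "q \<in> darts E1"
      using fixed[OF star1[OF that pq(3)] False, of D1] by simp
    moreover have "(p, q) \<in> S\<^sup>*" if "p \<in> darts E2" "q \<in> darts E2"
      using fixed[OF star2[OF that pq(3)] False, of D2] by simp
    ultimately show ?thesis by blast
  qed
  moreover have "snd a = fst b" if "(a, b) \<in> links (D1 @ D2)" for a b
  proof -
    have "(a, b) \<in> links D1 \<union> links D2 \<union> {(last D1, hd D2), (last D2, hd D1)}"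
      using that unfolding links_append[OF ne'] links_eq[OF ne'(1)] links_eq[OF ne'(2)] by blast
    then consider "(a, b) \<in> links D1" | "(a, b) \<in> links D2" | "a = last D1" "b = hd D2" | "a = last D2" "b = hd D1"
      by blast
    then show ?thesis
    proof cases
      case 1
      then show ?thesis using facial_link(1)[OF f1 _ 1] by simp
    next
      case 2
      then show ?thesis using facial_link(1)[OF f2 _ 2] by simp
    qed (use ne in1(3) in2(3) in simp_all)
  qed
  moreover have "mset_set (darts (E1 \<union> E2)) = mset_set (darts E1) + mset_set (darts E2)"
    unfolding d using f1 f2 dis(2) by (intro mset_set_Union) (auto simp: facial_def)
  ultimately show ?thesis
    using f1 f2 ne' unfolding facial_def S_def[symmetric] d
    by (simp add: add_ac split_beta) blast
qed

text \<open>The ear \<open>ps\<close> splits the face \<open>D1 @ D2\<close>; its two ends are the sources of \<open>D1\<close> and \<open>D2\<close>.\<close>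
lemma facial_ear:
  assumes f: "facial E (add_mset (D1 @ D2) Fs)"
    and ne: "D1 \<noteq> []" "D2 \<noteq> []" "fst (hd D1) = u" "fst (hd D2) = w"
    and ps: "distinct ps" "2 \<le> length ps" "hd ps = u" "last ps = w"
    and fresh: "set (butlast (tl ps)) \<inter> fst ` darts E = {}" 
    and ends: "{u, w} \<subseteq> fst ` darts E"
    and E': "darts E' = darts E \<union> steps ps \<union> prod.swap ` steps ps"
       "darts E \<inter> steps ps = {}" 
  shows "facial E' (add_mset (D1 @ walk_darts (rev ps)) (add_mset (walk_darts ps @ D2) Fs))"
proof -
  define S where "S = star_steps (add_mset (D1 @ D2) Fs)"
  define S' where "S' = star_steps (add_mset (D1 @ walk_darts (rev ps)) (add_mset (walk_darts ps @ D2) Fs))"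
  let ?P = "walk_darts ps" and ?Q = "walk_darts (rev ps)"
  have neP: "?P \<noteq> []" "?Q \<noteq> []"
    using ps(2) by (metis One_nat_def Suc_1 length_0_conv length_walk_darts not_less_eq_eq zero_diff le_zero_eq diff_is_0_eq length_rev)+
  define n where "n = length ps - 2"
  have lps: "length ps = n + 2" using ps(2) by (simp add: n_def)
  have hdP: "hd ?P = (ps ! 0, ps ! 1)" "last ?P = (ps ! n, ps ! Suc n)"
     "hd ?Q = (ps ! Suc n, ps ! n)" "last ?Q = (ps ! 1, ps ! 0)"
    using neP lps by (simp_all add: hd_conv_nth last_conv_nth nth_walk_darts rev_nth)
  have uw: "ps ! 0 = u" "ps ! Suc n = w"
    using ps lps hd_conv_nth[of ps] last_conv_nth[of ps] by force+
  have linksN: "links (D1 @ ?Q) = {(last D1, hd ?Q), (last ?Q, hd D1)} \<union> steps D1 \<union> steps ?Q"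
    "links (?P @ D2) = {(last ?P, hd D2), (last D2, hd ?P)} \<union> steps ?P \<union> steps D2"
    "links (D1 @ D2) = {(last D1, hd D2), (last D2, hd D1)} \<union> steps D1 \<union> steps D2"
    using neP ne by (simp_all add: links_append)
  have sw: "prod.swap (hd ?P) = last ?Q" "prod.swap (hd ?Q) = last ?P"
    by (simp_all add: hdP)
  have S'I: "(p, q) \<in> S'" if "(prod.swap p, q) \<in> links (D1 @ ?Q) \<union> links (?P @ D2)" for p q
    using that unfolding S'_def mem_star_steps by blast
  \<comment> \<open>At each of its two ends the ear divides a corner of the old face: the rotation
    step across that corner is replaced by two steps, by way of \<open>hd ?P\<close> or
    \<open>hd ?Q\<close>.\<close>
  have new: "(prod.swap (last D1), hd ?Q) \<in> S'" "(hd ?Q, hd D2) \<in> S'"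
     "(prod.swap (last D2), hd ?P) \<in> S'" "(hd ?P, hd D1) \<in> S'"
    by (rule S'I, simp add: linksN sw)+
  have "(p, q) \<in> S'\<^sup>*" if "(p, q) \<in> S" for p q
  proof -
    have "(p, q) \<in> star_steps Fs \<or> (prod.swap p, q) \<in> steps D1 \<union> steps D2 \<or>
       p = prod.swap (last D1) \<and> q = hd D2 \<or> p = prod.swap (last D2) \<and> q = hd D1"
      using that unfolding S_def mem_star_steps linksN 
      by (simp only: insert_iff Un_iff prod.inject empty_iff) (metis swap_swap)
    moreover have "(p, q) \<in> S'" if "(p, q) \<in> star_steps Fs"
      using that unfolding S'_def mem_star_steps by blast
    moreover have "(p, q) \<in> S'" if "(prod.swap p, q) \<in> steps D1 \<union> steps D2"
      by (rule S'I) (use that in \<open>auto simp: linksN\<close>)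
    ultimately show ?thesis
      using new by (meson rtrancl.rtrancl_into_rtrancl r_into_rtrancl)
  qed
  then have "S \<subseteq> S'\<^sup>*" by auto
  then have old: "(p, q) \<in> S'\<^sup>*" if "p \<in> darts E" "q \<in> darts E" "fst p = fst q" for p q
    using f that rtrancl_subset_rtrancl[of S "S'"] unfolding facial_def S_def by blast
  have lastE: "(last D1, hd D2) \<in> links (D1 @ D2)" "(last D2, hd D1) \<in> links (D1 @ D2)"
    by (simp_all add: linksN)
  note fl = facial_link[OF f _ lastE(1)] facial_link[OF f _ lastE(2)]
  have inD: "last D1 \<in> darts E" "last D2 \<in> darts E" "hd D1 \<in> darts E" "hd D2 \<in> darts E"
    using fl by simp_all
  have inE: "prod.swap (last D2) \<in> darts E" "prod.swap (last D1) \<in> darts E" 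
     "fst (prod.swap (last D2)) = u" "fst (prod.swap (last D1)) = w"
    using fl ne by simp_all
  have fr: "ps ! k \<notin> fst ` darts E" if "1 \<le> k" "k \<le> n" for k
  proof -
    have "ps ! k = butlast (tl ps) ! (k - 1)" "k - 1 < length (butlast (tl ps))"
      using that lps by (simp_all add: nth_butlast nth_tl)
    then show ?thesis using fresh nth_mem[of "k - 1" "butlast (tl ps)"] by (metis disjoint_iff)
  qed
  have inj: "ps ! i = ps ! j \<longleftrightarrow> i = j" if "i \<le> Suc n" "j \<le> Suc n" for i j
    using ps(1) that lps by (simp add: nth_eq_iff_index_eq)
  have newd: "\<exists>k\<le>Suc n. fst d = ps ! k \<and> (k \<le> n \<and> d = (ps ! k, ps ! Suc k) \<or> 0 < k \<and> d = (ps ! k, ps ! (k - 1)))"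
    if "d \<in> darts E'" "d \<notin> darts E" for d
  proof -
    have "d \<in> steps ps \<or> prod.swap d \<in> steps ps" using that E'(1) by auto
    then obtain i where i: "Suc i < length ps" "d = (ps ! i, ps ! Suc i) \<or> prod.swap d = (ps ! i, ps ! Suc i)"
      unfolding steps_nth by blast
    then have "d = (ps ! i, ps ! Suc i) \<or> d = (ps ! Suc i, ps ! i)" by (metis swap_simp swap_swap)
    then show ?thesis using i(1) lps
      by (elim disjE) (rule exI[of _ i], simp, rule exI[of _ "Suc i"], simp)
  qed
  have newE: "d = hd ?P \<and> fst d = u \<or> d = hd ?Q \<and> fst d = w"
    if d: "d \<in> darts E'" "d \<notin> darts E" "fst d \<in> fst ` darts E" for d
  proof -
    obtain k where k: "k \<le> Suc n" "fst d = ps ! k" "k \<le> n \<and> d = (ps ! k, ps ! Suc k) \<or> 0 < k \<and> d = (ps ! k, ps ! (k - 1))"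
      using newd d by blast
    then have "k = 0 \<or> k = Suc n" using fr[of k] d(3) by (metis One_nat_def Suc_leI le_Suc_eq neq0_conv)
    then show ?thesis using k hdP uw by auto
  qed
  \<comment> \<open>An inner vertex of the ear has exactly two darts, and each follows the
    other.\<close>
  have newS: "((ps ! Suc i, ps ! i), (ps ! Suc i, ps ! Suc (Suc i))) \<in> S'"
     "((ps ! Suc i, ps ! Suc (Suc i)), (ps ! Suc i, ps ! i)) \<in> S'" if "i < n" for i
  proof -
    let ?p = "((ps ! i, ps ! Suc i), (ps ! Suc i, ps ! Suc (Suc i)))"
    have p: "?p \<in> steps ?P" using that lps by (auto simp: steps_walk_darts)
    then show "((ps ! Suc i, ps ! i), (ps ! Suc i, ps ! Suc (Suc i))) \<in> S'"
      by (intro S'I) (simp add: linksN)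
    have "map_prod prod.swap prod.swap (prod.swap ?p) \<in> steps ?Q"
      unfolding walk_darts_rev steps_map steps_rev using p by blast
    then show "((ps ! Suc i, ps ! Suc (Suc i)), (ps ! Suc i, ps ! i)) \<in> S'"
      by (intro S'I) (simp add: linksN)
  qed
  have star: "(p, q) \<in> S'\<^sup>*" if pq: "p \<in> darts E'" "q \<in> darts E'" "fst p = fst q" for p q
  proof (cases "fst p \<in> fst ` darts E")
    case True
    have to: "(p, q) \<in> S'\<^sup>*" if "p \<in> darts E" "q \<in> darts E'" "q \<notin> darts E" "fst p = fst q" for p q
    proof -
      have "q = hd ?P \<and> fst q = u \<or> q = hd ?Q \<and> fst q = w"
        using newE[of q] that by (metis image_eqI)
      then show ?thesis
        using old[OF that(1) inE(1)] old[OF that(1) inE(2)] inE(3,4) new(1,3) that(4)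
        by (metis rtrancl.rtrancl_into_rtrancl)
    qed
    have fromE: "(p, q) \<in> S'\<^sup>*" if "p \<in> darts E'" "p \<notin> darts E" "q \<in> darts E" "fst p = fst q" for p q
    proof -
      have "p = hd ?P \<and> fst p = u \<or> p = hd ?Q \<and> fst p = w"
        using newE[of p] that by (metis image_eqI)
      then show ?thesis
        using old[OF inD(3) that(3)] old[OF inD(4) that(3)] ne(3,4) new(2,4) that(4)
        by (metis converse_rtrancl_into_rtrancl)
    qed
    show ?thesis
    proof (cases "p \<in> darts E \<or> q \<in> darts E")
      case False
      then have "p \<notin> darts E" "q \<notin> darts E" by auto
      have "u \<noteq> w" using inj[of 0 "Suc n"] uw by simp
      then have "p = q" using newE[of p] newE[of q] pq True \<open>p \<notin> darts E\<close> \<open>q \<notin> darts E\<close> by auto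
      then show ?thesis by simp
    qed (use to[of p q] fromE[of p q] old[of p q] pq in blast)
  next
    case False
    then have "p \<notin> darts E" "q \<notin> darts E" using pq(3) by (metis image_eqI)+
    note n = newd[OF pq(1) this(1)] newd[OF pq(2) this(2)]
    obtain k where k: "k \<le> Suc n" "fst p = ps ! k" "k \<le> n \<and> p = (ps ! k, ps ! Suc k) \<or> 0 < k \<and> p = (ps ! k, ps ! (k - 1))"
      using n(1) by blast
    obtain l where l: "l \<le> Suc n" "fst q = ps ! l" "l \<le> n \<and> q = (ps ! l, ps ! Suc l) \<or> 0 < l \<and> q = (ps ! l, ps ! (l - 1))"
      using n(2) by blast
    have "ps ! k = ps ! l" using pq(3) k(2) l(2) by simp
    then have "l = k" using inj[OF k(1) l(1)] by simp
    have "k \<noteq> 0" "k \<noteq> Suc n" using False ends k(2) uw by (metis insert_subset)+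
    then obtain i where "k = Suc i" "i < n" using k(1) by (cases k) auto
    then show ?thesis using k(3) l(3) \<open>l = k\<close> newS[of i] by auto
  qed
  have closed: "snd a = fst b" if "(a, b) \<in> links (D1 @ ?Q) \<union> links (?P @ D2)" for a b
  proof -
    have "(a, b) \<in> links (D1 @ D2) \<or> (a, b) \<in> steps ?P \<or> (a, b) \<in> steps ?Q \<or> 
       (a, b) \<in> {(last D1, hd ?Q), (last ?Q, hd D1), (last ?P, hd D2), (last D2, hd ?P)}"
      using that unfolding linksN by blast
    moreover have "snd a = fst b" if "(a, b) \<in> links (D1 @ D2)"
      using facial_link(1)[OF f _ that] by simp
    moreover have "snd a = fst b" if "(a, b) \<in> steps ?P"
      using that by (auto simp: steps_walk_darts)
    moreover have "snd a = fst b" if "(a, b) \<in> steps ?Q"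
      using that by (auto simp: steps_walk_darts)
    moreover have "snd a = fst b" if "(a, b) \<in> {(last D1, hd ?Q), (last ?Q, hd D1), (last ?P, hd D2), (last D2, hd ?P)}"
      using that hdP uw ne inE by auto
    ultimately show ?thesis by blast
  qed
  have dP: "distinct ?P" "distinct ?Q" 
    using ps(1) by (auto simp: walk_darts_def intro!: distinct_zipI1)
  have disPQ: "set ?P \<inter> set ?Q = {}"
  proof -
    have False if x: "x \<in> steps ps" "x \<in> prod.swap ` steps ps" for x
    proof -
      obtain i where i: "Suc i < length ps" "x = (ps ! i, ps ! Suc i)" using x(1) unfolding steps_nth by blast
      have "prod.swap x \<in> steps ps" using x(2) by auto
      then obtain j where j: "Suc j < length ps" "prod.swap x = (ps ! j, ps ! Suc j)" unfolding steps_nth by blast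
      have "i = Suc j" "Suc i = j" using i j lps inj[of i "Suc j"] inj[of "Suc i" j] by auto
      then show False by simp
    qed
    then show ?thesis unfolding steps_def[symmetric] steps_rev by blast
  qed
  have "mset_set (darts E') = mset_set (darts E) + mset_set (set ?P \<union> set ?Q)"
  proof -
    have "darts E' = darts E \<union> (set ?P \<union> set ?Q)"
      using E'(1) steps_rev[of ps] by (simp add: steps_def Un_assoc)
    moreover have "darts E \<inter> (set ?P \<union> set ?Q) = {}"
    proof -
      have "x \<notin> darts E" if "x \<in> steps ps \<union> prod.swap ` steps ps" for x
        using that E'(2) swap_darts by blast
      then show ?thesis unfolding steps_def[symmetric] steps_rev by blast
    qed
    ultimately show ?thesis using f by (simp add: facial_def mset_set_Union)
  qed
  also have "\<dots> = mset_set (darts E) + (mset ?P + mset ?Q)"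
    using dP disPQ by (simp add: mset_set_Union mset_set_set)
  finally have m: "mset_set (darts E') = mset_set (darts E) + (mset ?P + mset ?Q)" .
  have fin: "finite (darts E')" using E'(1) f by (simp add: facial_def steps_def)
  show ?thesis
    unfolding facial_def S'_def[symmetric] m
  proof (intro conjI ballI impI)
    show "\<Sum>\<^sub># (image_mset mset (add_mset (D1 @ ?Q) (add_mset (?P @ D2) Fs))) = mset_set (darts E) + (mset ?P + mset ?Q)"
      using f by (simp add: facial_def add_ac)
    show "D \<noteq> []" if "D \<in># add_mset (D1 @ ?Q) (add_mset (?P @ D2) Fs)" for D
      using that ne f by (auto simp: facial_def)
    show "case x of (a, b) \<Rightarrow> snd a = fst b" if "D \<in># add_mset (D1 @ ?Q) (add_mset (?P @ D2) Fs)" "x \<in> links D" for D x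
    proof (cases "D \<in># Fs")
      case True
      then show ?thesis using that facial_link(1)[OF f, of D] by auto
    next
      case False
      then show ?thesis using that closed by auto
    qed
  qed (use fin star in auto)
qed

lemma card_darts:
  assumes "\<And>e. e \<in> E \<Longrightarrow> \<exists>u v. e = {u, v} \<and> u \<noteq> v" "finite E"
  shows "card (darts E) = 2 * card E" "finite (darts E)"
proof -
  have "darts E = (\<Union>e\<in>E. {(u, w). {u, w} = e})" by (auto simp: darts_def)
  have e: "finite {(u, w). {u, w} = e} \<and> card {(u, w). {u, w} = e} = 2" if e: "e \<in> E" for e
  proof -
    obtain u v where uv: "e = {u, v}" "u \<noteq> v" using assms(1)[OF e] by blast
    then have "{(u, w). {u, w} = e} = {(u, v), (v, u)}" by (auto simp: doubleton_eq_iff)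
    then show ?thesis using uv by simp
  qed
  have "card (\<Union>e\<in>E. {(u, w). {u, w} = e}) = (\<Sum>e\<in>E. card {(u, w). {u, w} = e})"
    using e assms(2) by (intro card_UN_disjoint) auto
  then show "card (darts E) = 2 * card E" using \<open>darts E = _\<close> e by simp
  show "finite (darts E)" unfolding \<open>darts E = _\<close> using assms(2) e by blast
qed

section \<open>Ears in a plane drawing\<close>

definition edges_of :: "'a list \<Rightarrow> 'a set set" where
  "edges_of ps = (\<lambda>(a, b). {a, b}) ` steps ps"

definition closed_walk :: "'a list \<Rightarrow> ('a \<times> 'a) list" where
  "closed_walk c = walk_darts (c @ [hd c])"

lemma edges_of_simps [simp]: "edges_of [x] = {}" "edges_of (x # y # zs) = insert {x, y} (edges_of (y # zs))"
  by (auto simp: edges_of_def)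

lemma edges_of_rev [simp]: "edges_of (rev ps) = edges_of ps"
  unfolding edges_of_def steps_rev image_image by (rule image_cong) (auto simp: insert_commute)

lemma steps_subset: "(a, b) \<in> steps ps \<Longrightarrow> a \<in> set ps \<and> b \<in> set ps"
  by (auto simp: steps_nth)

lemma Union_edges_of_subset: "\<Union>(edges_of ps) \<subseteq> set ps"
  using steps_subset by (fastforce simp: edges_of_def)

lemma Union_edges_of: "2 \<le> length ps \<Longrightarrow> \<Union>(edges_of ps) = set ps"
proof (induction ps rule: induct_list012)
  case (3 x y zs)
  then show ?case by (cases zs) auto
qed auto

lemma mem_swap_image: "(a, b) \<in> prod.swap ` S \<longleftrightarrow> (b, a) \<in> S"
  by (auto intro: rev_image_eqI)

lemma darts_edges_of: "darts (edges_of ps) = steps ps \<union> prod.swap ` steps ps"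
proof -
  have "(a, b) \<in> darts (edges_of ps) \<longleftrightarrow> (a, b) \<in> steps ps \<or> (b, a) \<in> steps ps" for a b
    unfolding darts_def edges_of_def by (auto simp: doubleton_eq_iff)
  then show ?thesis by (simp add: set_eq_iff mem_swap_image)
qed

lemma closed_walk_append:
  assumes "xs \<noteq> []" "ys \<noteq> []"
  shows "closed_walk (xs @ ys) = walk_darts (xs @ [hd ys]) @ walk_darts (ys @ [hd xs])"
proof -
  obtain y zs where "ys = y # zs" using assms(2) by (cases ys) auto
  then show ?thesis using assms walk_darts_split[of xs y "zs @ [hd xs]"] by (simp add: closed_walk_def)
qed

text \<open>Guarantees that the closing edge of a cycle of length at least 3 is not already on the
  path that it closes.\<close>

lemma edge_joining_ends:
  assumes "distinct xs" "{hd xs, last xs} \<in> edges_of xs"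
  shows "length xs = 2"
proof -
  obtain i where i: "Suc i < length xs" "{hd xs, last xs} = {xs ! i, xs ! Suc i}"
    using assms(2) by (auto simp: edges_of_def steps_nth)
  have "xs \<noteq> []" using i by auto
  then have "{xs ! 0, xs ! (length xs - 1)} = {xs ! i, xs ! Suc i}"
    using i(2) by (simp add: hd_conv_nth last_conv_nth)
  then have "(xs ! 0 = xs ! i \<and> xs ! (length xs - 1) = xs ! Suc i) \<or>
      (xs ! 0 = xs ! Suc i \<and> xs ! (length xs - 1) = xs ! i)"
    by (simp only: doubleton_eq_iff)
  moreover have "xs ! j = xs ! k \<longleftrightarrow> j = k" if "j < length xs" "k < length xs" for j k
    using nth_eq_iff_index_eq[OF assms(1) that] .
  ultimately have "(0 = i \<and> length xs - 1 = Suc i) \<or> (0 = Suc i \<and> length xs - 1 = i)"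
    using i(1) by (metis Suc_lessD diff_less length_greater_0_conv \<open>xs \<noteq> []\<close> zero_less_one)
  then show ?thesis by auto
qed

lemma card_edges_of: "distinct ps \<Longrightarrow> ps \<noteq> [] \<Longrightarrow> card (edges_of ps) = length ps - 1"
proof (induction ps rule: induct_list012)
  case (3 x y zs)
  have "{x, y} \<notin> edges_of (y # zs)"
    using 3(3) Union_edges_of_subset[of "y # zs"] by auto
  moreover have "finite (edges_of (y # zs))" by (simp add: edges_of_def steps_def)
  ultimately show ?case using 3 by simp
qed simp_all

lemma jordan_side_two_arcs:
  assumes arcs: "arc g" "arc h" and ends: "pathstart g = a" "pathfinish g = b" "pathstart h = a" "pathfinish h = b"
    and meets: "path_image g \<inter> path_image h = {a, b}" and J: "J = path_image g \<union> path_image h"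
  shows "jordan_side J R \<Longrightarrow> open R" "jordan_side J R \<Longrightarrow> R \<noteq> {}" "jordan_side J R \<Longrightarrow> frontier R = J"
    "inside J \<inter> outside J = {}" "inside J \<union> outside J = - J"
proof -
  have "simple_path (g +++ reversepath h)"
    using arcs ends meets by (intro simple_path_join_loop) (auto simp: arc_reversepath)
  moreover have "pathfinish (g +++ reversepath h) = pathstart (g +++ reversepath h)"
    using ends by simp
  moreover have "path_image (g +++ reversepath h) = J" using ends J by (simp add: path_image_join)
  ultimately have *: "inside J \<noteq> {} \<and> open (inside J) \<and> outside J \<noteq> {} \<and> open (outside J) \<and> inside J \<inter> outside J = {} \<and>
     inside J \<union> outside J = - J \<and> frontier (inside J) = J \<and> frontier (outside J) = J"
    using Jordan_inside_outside[of "g +++ reversepath h"] by simp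
  then show "jordan_side J R \<Longrightarrow> open R" "jordan_side J R \<Longrightarrow> R \<noteq> {}" "jordan_side J R \<Longrightarrow> frontier R = J"
    "inside J \<inter> outside J = {}" "inside J \<union> outside J = - J" unfolding jordan_side_def by metis+
qed

text \<open>The conditions in \<open>planar\<close>, moved to the complex plane, where winding
  numbers are at hand.\<close>

locale plane_drawing =
  fixes V :: "'a set" and E :: "'a set set" and f :: "'a \<Rightarrow> complex" and \<gamma> :: "'a set \<Rightarrow> real \<Rightarrow> complex"
  assumes fin: "finite V" and edge: "e \<in> E \<Longrightarrow> \<exists>u v. e = {u, v} \<and> u \<noteq> v \<and> u \<in> V \<and> v \<in> V"
    and inj: "inj_on f V"
    and arc_edge: "e \<in> E \<Longrightarrow> arc (\<gamma> e)"
    and ends_edge: "e \<in> E \<Longrightarrow> {pathstart (\<gamma> e), pathfinish (\<gamma> e)} = f ` e"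
    and vertex_on_edge: "e \<in> E \<Longrightarrow> x \<in> V \<Longrightarrow> f x \<in> path_image (\<gamma> e) \<Longrightarrow> x \<in> e"
    and edges_meet: "e \<in> E \<Longrightarrow> e' \<in> E \<Longrightarrow> e \<noteq> e' \<Longrightarrow> path_image (\<gamma> e) \<inter> path_image (\<gamma> e') \<subseteq> f ` (e \<inter> e')"
begin

definition drawn :: "'a set set \<Rightarrow> complex set" where
  "drawn X = (\<Union>e\<in>X. path_image (\<gamma> e))"

lemma drawn_Un: "drawn (X \<union> Y) = drawn X \<union> drawn Y"
  by (auto simp: drawn_def)

lemma finite_E: "finite E"
proof -
  have "E \<subseteq> Pow V" using edge by blast
  then show ?thesis using fin finite_subset by blast
qed

lemma edge_subset: "e \<in> E \<Longrightarrow> e \<subseteq> V"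
  using edge by blast

lemma drawn_meet:
  assumes "X \<subseteq> E" "Y \<subseteq> E" "X \<inter> Y = {}"
  shows "drawn X \<inter> drawn Y \<subseteq> f ` (\<Union>X \<inter> \<Union>Y)"
proof
  fix z assume "z \<in> drawn X \<inter> drawn Y"
  then obtain e e' where "e \<in> X" "e' \<in> Y" "z \<in> path_image (\<gamma> e) \<inter> path_image (\<gamma> e')"
    by (auto simp: drawn_def)
  then have "z \<in> f ` (e \<inter> e')" using edges_meet[of e e'] assms by blast
  then show "z \<in> f ` (\<Union>X \<inter> \<Union>Y)" using \<open>e \<in> X\<close> \<open>e' \<in> Y\<close> by blast
qed

lemma vertex_drawn: "X \<subseteq> E \<Longrightarrow> x \<in> \<Union>X \<Longrightarrow> f x \<in> drawn X"
proof -
  assume "X \<subseteq> E" "x \<in> \<Union>X"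
  then obtain e where e: "e \<in> X" "e \<in> E" "x \<in> e" by blast
  then have "f x \<in> {pathstart (\<gamma> e), pathfinish (\<gamma> e)}" using ends_edge by blast
  then have "f x \<in> path_image (\<gamma> e)" by auto
  then show "f x \<in> drawn X" using e by (auto simp: drawn_def)
qed

lemma drawn_vertex: "X \<subseteq> E \<Longrightarrow> x \<in> V \<Longrightarrow> f x \<in> drawn X \<Longrightarrow> x \<in> \<Union>X"
proof -
  assume *: "X \<subseteq> E" "x \<in> V" "f x \<in> drawn X"
  then obtain e where "e \<in> X" "f x \<in> path_image (\<gamma> e)" by (auto simp: drawn_def)
  then show "x \<in> \<Union>X" using vertex_on_edge[of e x] * by blast
qed

lemma edge_arc:
  assumes "{a, b} \<in> E"
  obtains g where "arc g" "pathstart g = f a" "pathfinish g = f b" "path_image g = path_image (\<gamma> {a, b})"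
proof -
  have "{pathstart (\<gamma> {a, b}), pathfinish (\<gamma> {a, b})} = {f a, f b}"
    using ends_edge[OF assms] by simp
  then consider "pathstart (\<gamma> {a, b}) = f a" "pathfinish (\<gamma> {a, b}) = f b"
    | "pathstart (\<gamma> {a, b}) = f b" "pathfinish (\<gamma> {a, b}) = f a"
    unfolding doubleton_eq_iff by blast
  then show ?thesis
  proof cases
    case 1
    then show ?thesis using that arc_edge[OF assms] by blast
  next
    case 2
    then show ?thesis using that[of "reversepath (\<gamma> {a, b})"] arc_edge[OF assms] by (simp add: arc_reversepath)
  qed
qed

lemma walk_arc:
  assumes "distinct ps" "2 \<le> length ps" "edges_of ps \<subseteq> E"
  shows "\<exists>g. arc g \<and> pathstart g = f (hd ps) \<and> pathfinish g = f (last ps) \<and> path_image g = drawn (edges_of ps)"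
  using assms
proof (induction ps rule: induct_list012)
  case (3 x y zs)
  obtain g where g: "arc g" "pathstart g = f x" "pathfinish g = f y" "path_image g = path_image (\<gamma> {x, y})"
    using edge_arc[of x y] 3(5) by auto
  show ?case
  proof (cases zs)
    case Nil
    then show ?thesis using g by (auto simp: drawn_def)
  next
    case (Cons z zs')
    obtain h where h: "arc h" "pathstart h = f y" "pathfinish h = f (last (y # zs))" "path_image h = drawn (edges_of (y # zs))"
      using 3 Cons by auto
    have "{x, y} \<notin> edges_of (y # zs)" using 3(3) Union_edges_of_subset[of "y # zs"] by auto
    then have "drawn {{x, y}} \<inter> drawn (edges_of (y # zs)) \<subseteq> f ` (\<Union>{{x, y}} \<inter> \<Union>(edges_of (y # zs)))"
      using 3(5) by (intro drawn_meet) auto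
    also have "\<dots> \<subseteq> {f y}" using Union_edges_of_subset[of "y # zs"] 3(3) by auto
    finally have "path_image g \<inter> path_image h \<subseteq> {f y}" using g h by (simp add: drawn_def)
    then have "arc (g +++ h)" using g h by (intro arc_join) auto
    moreover have "path_image (g +++ h) = drawn (edges_of (x # y # zs))"
      using g h by (simp add: path_image_join drawn_def)
    ultimately show ?thesis using g h by (intro exI[of _ "g +++ h"]) simp
  qed
qed auto

lemma walks_meet:
  assumes "distinct ps" "distinct qs" "2 \<le> length ps" "2 \<le> length qs" "edges_of ps \<subseteq> E" "edges_of qs \<subseteq> E"
    "edges_of ps \<inter> edges_of qs = {}" "set ps \<inter> set qs = {u, w}"
  shows "drawn (edges_of ps) \<inter> drawn (edges_of qs) = {f u, f w}"
proof
  show "drawn (edges_of ps) \<inter> drawn (edges_of qs) \<subseteq> {f u, f w}"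
    using drawn_meet[OF assms(5-7)] unfolding Union_edges_of[OF assms(3)] Union_edges_of[OF assms(4)] assms(8) by simp
  have "u \<in> set ps" "u \<in> set qs" "w \<in> set ps" "w \<in> set qs" using assms(8) by blast+
  then show "{f u, f w} \<subseteq> drawn (edges_of ps) \<inter> drawn (edges_of qs)"
    using vertex_drawn[OF assms(5)] vertex_drawn[OF assms(6)]
    unfolding Union_edges_of[OF assms(3)] Union_edges_of[OF assms(4)] by simp
qed

text \<open>\<open>\<R>\<close> is the set of regions of the drawing of \<open>H\<close>, and \<open>c R\<close> the cycle bounding \<open>R\<close>.\<close>
definition plane_faces :: "'a set set \<Rightarrow> complex set set \<Rightarrow> (complex set \<Rightarrow> 'a list) \<Rightarrow> bool" where
  "plane_faces H \<R> c \<longleftrightarrow> H \<subseteq> E \<and> finite \<R> \<and> disjoint \<R> \<and> \<Union>\<R> = - drawn H \<and>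
     facial H (image_mset (\<lambda>R. closed_walk (c R)) (mset_set \<R>)) \<and>
     card (\<Union>H) + card \<R> = card H + 2 \<and>
     (\<forall>R\<in>\<R>. distinct (c R) \<and> 3 \<le> length (c R) \<and> jordan_side (drawn (edges_of (c R @ [hd (c R)]))) R)"

text \<open>Places the ends of an ear on the boundary of the region that contains the rest of the
  ear.\<close>

lemma endpoints_in_closure:
  assumes "arc (g :: real \<Rightarrow> complex)"
  shows "pathstart g \<in> closure (path_image g - {pathstart g, pathfinish g})"
    "pathfinish g \<in> closure (path_image g - {pathstart g, pathfinish g})"
proof -
  have e: "path_image g - {pathstart g, pathfinish g} = g ` {0<..<1}"
    using simple_path_endless[OF arc_imp_simple_path[OF assms]] .
  have "continuous_on (closure {0<..<1}) g"
    using assms by (simp add: arc_def path_def)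
  then have "g ` closure {0<..<1} \<subseteq> closure (g ` {0<..<1})"
    by (intro image_closure_subset) (auto simp: closure_subset)
  then have "g ` {0..1} \<subseteq> closure (g ` {0<..<1})" by simp
  then show "pathstart g \<in> closure (path_image g - {pathstart g, pathfinish g})"
    "pathfinish g \<in> closure (path_image g - {pathstart g, pathfinish g})"
    unfolding e by (auto simp: pathstart_def pathfinish_def)
qed

lemma rotate_to_start:
  assumes "u \<in> set c" "w \<in> set c" "u \<noteq> w"
  obtains A B X Y where "c = X @ Y" "Y @ X = u # A @ w # B"
proof -
  obtain X Y where c: "c = X @ u # Y" using assms(1) by (meson split_list)
  have "w \<in> set (Y @ X)" using assms c by auto
  then obtain A B where "Y @ X = A @ w # B" by (meson split_list)
  then show ?thesis using that[of X "u # Y" A B] c by simp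
qed

lemma closed_walk_rotate:
  obtains P Q where "closed_walk (X @ Y) = P @ Q" "closed_walk (Y @ X) = Q @ P"
proof (cases "X = [] \<or> Y = []")
  case True
  then show ?thesis using that[of "closed_walk (X @ Y)" "[]"] by auto
next
  case False
  then show ?thesis using closed_walk_append[of X Y] closed_walk_append[of Y X] that by blast
qed

lemma edges_of_closed: "edges_of (c @ [hd c]) = (\<lambda>(a, b). {a, b}) ` set (closed_walk c)"
  by (simp add: edges_of_def closed_walk_def steps_def)

lemma edges_of_append2: "edges_of (xs @ y # zs) = edges_of (xs @ [y]) \<union> edges_of (y # zs)"
  unfolding edges_of_def steps_def walk_darts_split[of xs y zs] by auto

lemma fst_hd_walk_darts: "2 \<le> length xs \<Longrightarrow> walk_darts xs \<noteq> [] \<and> fst (hd (walk_darts xs)) = hd xs"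
  by (cases xs; cases "tl xs") auto

lemma fst_darts: "H \<subseteq> E \<Longrightarrow> fst ` darts H = \<Union>H"
proof (intro equalityI subsetI)
  fix x assume "H \<subseteq> E" "x \<in> \<Union>H"
  then obtain e where e: "e \<in> H" "e \<in> E" "x \<in> e" by blast
  obtain a b where "e = {a, b}" using edge[OF e(2)] by blast
  then have "(x, if x = a then b else a) \<in> darts H" using e by (auto simp: darts_def insert_commute)
  then show "x \<in> fst ` darts H" by force
qed (auto simp: darts_def)

text \<open>Cuts the bounding cycle at two of its vertices. Both arcs are directed from
  \<open>x\<close> to \<open>y\<close>, as a theta curve requires, although the list
  \<open>y # B @ [x]\<close> runs the other way.\<close>

lemma face_arcs:
  assumes pf: "plane_faces H \<R> c" and R: "R \<in> \<R>" and xy: "x \<in> set (c R)" "y \<in> set (c R)" "x \<noteq> y"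
  obtains A B X Y h k where "c R = X @ Y" "Y @ X = x # A @ y # B" "arc h" "arc k"
      "pathstart h = f x" "pathfinish h = f y" "pathstart k = f x" "pathfinish k = f y"
      "path_image h = drawn (edges_of (x # A @ [y]))" "path_image k = drawn (edges_of (y # B @ [x]))"
      "path_image h \<inter> path_image k = {f x, f y}"
      "drawn (edges_of (c R @ [hd (c R)])) = path_image h \<union> path_image k"
      "distinct (x # A @ y # B)" "edges_of (x # A @ [y]) \<subseteq> H" "edges_of (y # B @ [x]) \<subseteq> H"
proof -
  have H: "H \<subseteq> E" "finite \<R>" "disjoint \<R>" "\<Union>\<R> = - drawn H"
    and fac: "facial H (image_mset (\<lambda>R. closed_walk (c R)) (mset_set \<R>))"
    and face: "\<And>R. R \<in> \<R> \<Longrightarrow> distinct (c R) \<and> 3 \<le> length (c R) \<and> jordan_side (drawn (edges_of (c R @ [hd (c R)]))) R"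
    using pf unfolding plane_faces_def by auto
    obtain A B X Y where c: "c R = X @ Y" "Y @ X = x # A @ y # B"
      using xy by (rule rotate_to_start)
    let ?p = "x # A @ [y]" and ?q = "y # B @ [x]"
    have fR: "distinct (c R)" "3 \<le> length (c R)" using face[OF R] by auto
    have dist: "distinct (x # A @ y # B)" using fR(1) unfolding c(2)[symmetric] c(1) by auto
    have len: "length (c R) = 2 + length A + length B" using arg_cong[OF c(2), of length] c(1) by simp
    obtain P Q where PQ: "closed_walk (X @ Y) = P @ Q" "closed_walk (Y @ X) = Q @ P"
      by (rule closed_walk_rotate)
    have "edges_of (c R @ [hd (c R)]) = edges_of ((Y @ X) @ [hd (Y @ X)])"
      unfolding edges_of_closed c(1) PQ by (simp add: Un_commute)
    also have "\<dots> = edges_of ((x # A) @ y # (B @ [x]))" unfolding c(2) by simp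
    also have "\<dots> = edges_of ?p \<union> edges_of ?q" using edges_of_append2[of "x # A" y "B @ [x]"] by simp
    finally have ed: "edges_of (c R @ [hd (c R)]) = edges_of ?p \<union> edges_of ?q" .
    have "closed_walk (c R) \<in># image_mset (\<lambda>R. closed_walk (c R)) (mset_set \<R>)"
      using R H(2) by simp
    then have "set (closed_walk (c R)) \<subseteq> darts H" using facial_darts[OF fac] by blast
    then have "edges_of (c R @ [hd (c R)]) \<subseteq> H" unfolding edges_of_closed by (auto simp: darts_def)
    then have sub: "edges_of ?p \<subseteq> H" "edges_of ?q \<subseteq> H" unfolding ed by blast+
    \<comment> \<open>A common edge would be \<open>{x, y}\<close>, so both arcs would consist of
      this edge alone and the cycle would have only two vertices.\<close>
    have disj: "edges_of ?p \<inter> edges_of ?q = {}"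
    proof (rule ccontr)
      assume "edges_of ?p \<inter> edges_of ?q \<noteq> {}"
      then obtain e where e: "e \<in> edges_of ?p" "e \<in> edges_of ?q" by blast
      have "e \<subseteq> set ?p" "e \<subseteq> set ?q"
        using e Union_edges_of_subset[of ?p] Union_edges_of_subset[of ?q] by blast+
      moreover have "set ?p \<inter> set ?q = {x, y}" using dist by auto
      ultimately have exy: "e \<subseteq> {x, y}" by blast
      have "e \<in> E" using e(1) sub(1) H(1) by blast
      then obtain a b where "e = {a, b}" "a \<noteq> b" using edge by blast
      then have "e = {x, y}" using exy xy(3) by (simp add: doubleton_eq_iff) blast
      then have "{hd ?p, last ?p} \<in> edges_of ?p" "{hd ?q, last ?q} \<in> edges_of ?q"
        using e by (simp_all add: insert_commute)
      moreover have "distinct ?p" "distinct ?q" using dist by auto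
      ultimately have "length ?p = 2" "length ?q = 2"
        using edge_joining_ends by blast+
      then show False using len fR(2) by simp
    qed
    have E: "edges_of ?p \<subseteq> E" "edges_of ?q \<subseteq> E" using sub H(1) by auto
    obtain h where h: "arc h" "pathstart h = f x" "pathfinish h = f y" "path_image h = drawn (edges_of ?p)"
      using walk_arc[of ?p] E(1) dist by (simp; blast)
    obtain k where k: "arc k" "pathstart k = f x" "pathfinish k = f y" "path_image k = drawn (edges_of ?q)"
      using walk_arc[of "rev ?q"] E(2) dist unfolding edges_of_rev by (simp; blast)
    have "path_image h \<inter> path_image k = {f x, f y}"
      unfolding h(4) k(4)
    proof (rule walks_meet)
      show "distinct ?p" "distinct ?q" "set ?p \<inter> set ?q = {x, y}" using dist by auto
    qed (use E disj in simp_all)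
    moreover have "drawn (edges_of (c R @ [hd (c R)])) = path_image h \<union> path_image k"
      unfolding h(4) k(4) ed drawn_Un ..
    ultimately show ?thesis
      by (rule that[OF c h(1) k(1) h(2,3) k(2,3) h(4) k(4) _ _ dist sub])
qed

text \<open>The inner part \<open>I\<close> of the ear is connected and misses the drawing of
  \<open>H\<close>, so it lies in one region \<open>R\<close>, and the two ends lie on the cycle
  bounding \<open>R\<close>. The theta curve formed by the ear and the two arcs of this cycle splits
  \<open>R\<close>.\<close>

lemma plane_faces_ear:
  assumes pf: "plane_faces H \<R> c"
    and ps: "distinct ps" "2 \<le> length ps" "edges_of ps \<subseteq> E" "edges_of ps \<inter> H = {}"
    and meet: "set ps \<inter> \<Union>H = {hd ps, last ps}"
  shows "\<exists>\<R>' c'. plane_faces (H \<union> edges_of ps) \<R>' c'"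
proof -
  define u w where "u = hd ps" and "w = last ps"
  define I where "I = drawn (edges_of ps) - {f u, f w}"
  have H: "H \<subseteq> E" "finite \<R>" "disjoint \<R>" "\<Union>\<R> = - drawn H"
    and fac: "facial H (image_mset (\<lambda>R. closed_walk (c R)) (mset_set \<R>))"
    and euler: "card (\<Union>H) + card \<R> = card H + 2"
    and face: "\<And>R. R \<in> \<R> \<Longrightarrow> distinct (c R) \<and> 3 \<le> length (c R) \<and> jordan_side (drawn (edges_of (c R @ [hd (c R)]))) R"
    using pf unfolding plane_faces_def by auto
  obtain g where g: "arc g" "pathstart g = f u" "pathfinish g = f w" "path_image g = drawn (edges_of ps)"
    using walk_arc[OF ps(1-3)] unfolding u_def w_def by blast
  obtain P where P: "ps = u # P @ [w]"
  proof -
    obtain y ys where "ps = u # y # ys" using ps(2) by (cases ps; cases "tl ps") (auto simp: u_def)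
    then show ?thesis using that[of "butlast (y # ys)"] by (simp add: w_def)
  qed
  have uw: "u \<noteq> w" using ps(1) P by auto
  have uwH: "u \<in> \<Union>H" "w \<in> \<Union>H" using meet unfolding u_def w_def by blast+
  have UH: "\<Union>H \<subseteq> V" using H(1) edge_subset by blast
  have dr: "drawn (edges_of ps) \<inter> drawn H \<subseteq> {f u, f w}"
    using drawn_meet[OF ps(3) H(1) ps(4)] unfolding Union_edges_of[OF ps(2)] meet u_def w_def by simp
  have fH: "f u \<in> drawn H" "f w \<in> drawn H" using vertex_drawn[OF H(1)] uwH by auto
  have I: "connected I" "I \<noteq> {}" "I \<inter> drawn H = {}" "f u \<in> closure I" "f w \<in> closure I"
  proof -
    show "connected I" "I \<noteq> {}"
      using connected_simple_path_endless[OF arc_imp_simple_path[OF g(1)]]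
      nonempty_simple_path_endless[OF arc_imp_simple_path[OF g(1)]] unfolding I_def g by simp_all
    show "I \<inter> drawn H = {}" using dr unfolding I_def by blast
    show "f u \<in> closure I" "f w \<in> closure I"
      using endpoints_in_closure[OF g(1)] unfolding I_def g by simp_all
  qed
  have side: "open R" "R \<noteq> {}" "frontier R = drawn (edges_of (c R @ [hd (c R)]))" if R: "R \<in> \<R>" for R
    proof -
    have fR: "distinct (c R)" "3 \<le> length (c R)" "jordan_side (drawn (edges_of (c R @ [hd (c R)]))) R"
      using face[OF R] by auto
    have "0 < length (c R)" "1 < length (c R)" using fR(2) by linarith+
    then have "c R ! 0 \<in> set (c R)" "c R ! 1 \<in> set (c R)" "c R ! 0 \<noteq> c R ! 1"
      using nth_mem[of 0 "c R"] nth_mem[of 1 "c R"] nth_eq_iff_index_eq[OF fR(1), of 0 1] by simp_all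
    note xy = this
    obtain h k where hk: "arc h" "arc k" "pathstart h = f (c R ! 0)" "pathfinish h = f (c R ! 1)"
        "pathstart k = f (c R ! 0)" "pathfinish k = f (c R ! 1)" "path_image h \<inter> path_image k = {f (c R ! 0), f (c R ! 1)}"
        "drawn (edges_of (c R @ [hd (c R)])) = path_image h \<union> path_image k"
      by (rule face_arcs[OF pf R xy])
    show "open R" "R \<noteq> {}" "frontier R = drawn (edges_of (c R @ [hd (c R)]))"
      by (rule jordan_side_two_arcs(1-3)[OF hk(1-6,7,8) fR(3)])+
  qed
  obtain R where R: "R \<in> \<R>" "I \<subseteq> R"
  proof -
    have "I \<subseteq> \<Union>\<R>" using I(3) H(4) by blast
    then obtain x R where x: "x \<in> I" "x \<in> R" "R \<in> \<R>" using I(2) by blast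
    have "open R" "open (\<Union>(\<R> - {R}))" using side(1) x(3) by auto
    moreover have "R \<inter> \<Union>(\<R> - {R}) = {}" using H(3) x(3) by (auto simp: disjoint_def)
    moreover have "I \<subseteq> R \<union> \<Union>(\<R> - {R})" using \<open>I \<subseteq> \<Union>\<R>\<close> by blast
    ultimately have "R \<inter> I = {} \<or> \<Union>(\<R> - {R}) \<inter> I = {}"
      by (intro connectedD[OF I(1)]) blast+
    then have "I \<subseteq> R" using x \<open>I \<subseteq> R \<union> \<Union>(\<R> - {R})\<close> by blast
    then show ?thesis using that x(3) by blast
  qed
  \<comment> \<open>An end of the ear is a limit of points of \<open>I\<close>, but as a vertex of
    \<open>H\<close> it is not in \<open>R\<close>; so it is on the frontier of
    \<open>R\<close>.\<close>
  have onface: "x \<in> set (c R)" if x: "x \<in> \<Union>H" "f x \<in> closure I" for x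
    proof -
    have "f x \<in> closure R" using x(2) closure_mono[OF R(2)] by blast
    moreover have "f x \<notin> R" using vertex_drawn[OF H(1) x(1)] H(4) R(1) by blast
    ultimately have "f x \<in> frontier R" using side(1)[OF R(1)] by (simp add: frontier_def interior_open)
    then have 1: "f x \<in> drawn (edges_of (c R @ [hd (c R)]))" using side(3)[OF R(1)] by simp
    have "closed_walk (c R) \<in># image_mset (\<lambda>R. closed_walk (c R)) (mset_set \<R>)"
      using R(1) H(2) by simp
    then have "set (closed_walk (c R)) \<subseteq> darts H" using facial_darts[OF fac] by blast
    then have "edges_of (c R @ [hd (c R)]) \<subseteq> H" unfolding edges_of_closed by (auto simp: darts_def)
    then have "edges_of (c R @ [hd (c R)]) \<subseteq> E" using H(1) by (rule subset_trans)
    moreover have "x \<in> V" using x(1) UH by blast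
    ultimately have "x \<in> \<Union>(edges_of (c R @ [hd (c R)]))" using 1 by (rule drawn_vertex)
    then have "x \<in> set (c R @ [hd (c R)])" by (rule subsetD[OF Union_edges_of_subset])
    moreover have "c R \<noteq> []" using face[OF R(1)] by auto
    ultimately show ?thesis by auto
  qed
  obtain A B X Y h k where c: "c R = X @ Y" "Y @ X = u # A @ w # B" and hk: "arc h" "arc k"
    "pathstart h = f u" "pathfinish h = f w" "pathstart k = f u" "pathfinish k = f w"
    "path_image h = drawn (edges_of (u # A @ [w]))" "path_image k = drawn (edges_of (w # B @ [u]))"
    "path_image h \<inter> path_image k = {f u, f w}"
    and J: "drawn (edges_of (c R @ [hd (c R)])) = path_image h \<union> path_image k"
    and dist: "distinct (u # A @ w # B)" and sub: "edges_of (u # A @ [w]) \<subseteq> H" "edges_of (w # B @ [u]) \<subseteq> H"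
    by (rule face_arcs[OF pf R(1) onface[OF uwH(1) I(4)] onface[OF uwH(2) I(5)] uw])
  have hg: "path_image h \<inter> path_image g = {f u, f w}" "path_image k \<inter> path_image g = {f u, f w}"
    proof -
    have "set (u # A @ [w]) \<subseteq> \<Union>H"
      using Union_mono[OF sub(1)] Union_edges_of[of "u # A @ [w]"] by simp
    moreover have "set (w # B @ [u]) \<subseteq> \<Union>H"
      using Union_mono[OF sub(2)] Union_edges_of[of "w # B @ [u]"] by simp
    moreover have "set ps \<inter> \<Union>H = {u, w}" using meet unfolding u_def w_def .
    moreover have "{u, w} \<subseteq> set ps" using P by simp
    ultimately have m: "set (u # A @ [w]) \<inter> set ps = {u, w}" "set (w # B @ [u]) \<inter> set ps = {u, w}"
      by (simp_all only: set_simps set_append) blast+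
    have d: "distinct (u # A @ [w])" "distinct (w # B @ [u])" using dist by auto
    have E: "edges_of (u # A @ [w]) \<subseteq> E" "edges_of (w # B @ [u]) \<subseteq> E" using sub H(1) by blast+
    have j: "edges_of (u # A @ [w]) \<inter> edges_of ps = {}" "edges_of (w # B @ [u]) \<inter> edges_of ps = {}"
      using sub ps(4) by blast+
    show "path_image h \<inter> path_image g = {f u, f w}"
      unfolding hk(7) g(4) by (rule walks_meet[OF d(1) ps(1) _ ps(2) E(1) ps(3) j(1) m(1)]) simp
    show "path_image k \<inter> path_image g = {f u, f w}"
      unfolding hk(8) g(4) by (rule walks_meet[OF d(2) ps(1) _ ps(2) E(2) ps(3) j(2) m(2)]) simp
  qed
  have theta: "theta_curve h k g (f u) (f w)"
    by unfold_locales (rule hk(1-6) g(1-3) hk(9) hg)+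
  obtain R1 R2 where R12: "jordan_side (path_image h \<union> path_image g) R1" "jordan_side (path_image k \<union> path_image g) R2"
    "R1 \<inter> R2 = {}" "R1 \<union> R2 \<union> I = R"
    proof -
    have a1: "path_image g \<inter> R \<noteq> {}" using R(2) I(2) unfolding I_def g by blast
    have a2: "jordan_side (path_image h \<union> path_image k) R" using face[OF R(1)] J by simp
    obtain R1 R2 where "jordan_side (path_image h \<union> path_image g) R1" "jordan_side (path_image k \<union> path_image g) R2"
      "R1 \<inter> R2 = {}" "R1 \<union> R2 \<union> (path_image g - {f u, f w}) = R"
      by (rule theta_curve.split_jordan_side[OF theta a2 a1])
    then show ?thesis using that unfolding I_def g(4)[symmetric] by blast
  qed
  \<comment> \<open>Both new cycles inherit the direction of \<open>c R\<close>: one goes back along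
    the ear and the other forwards, so every new dart is used once.\<close>
  define c' where "c' = c(R1 := u # A @ w # rev P, R2 := u # P @ w # B)"
  define \<R>' where "\<R>' = insert R1 (insert R2 (\<R> - {R}))"
  have R12ne: "R1 \<noteq> {}" "R2 \<noteq> {}" using jordan_side_two_arcs(2)[OF hk(1) g(1) hk(3,4) g(2,3) hg(1) refl R12(1)]
      jordan_side_two_arcs(2)[OF hk(2) g(1) hk(5,6) g(2,3) hg(2) refl R12(2)] by auto
  have R12new: "R1 \<noteq> R2" "R1 \<notin> \<R> - {R}" "R2 \<notin> \<R> - {R}"
  proof -
    show "R1 \<noteq> R2" using R12 R12ne by blast
    have "S \<inter> R = {}" if "S \<in> \<R> - {R}" for S using that H(3) R(1) by (auto simp: disjoint_def)
    then show "R1 \<notin> \<R> - {R}" "R2 \<notin> \<R> - {R}" using R12(4) R12ne by blast+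
  qed
  have UA: "set (u # A @ [w]) \<subseteq> \<Union>H"
    using Union_mono[OF sub(1)] Union_edges_of[of "u # A @ [w]"] by simp
  have UB: "set (w # B @ [u]) \<subseteq> \<Union>H"
    using Union_mono[OF sub(2)] Union_edges_of[of "w # B @ [u]"] by simp
  have PH: "set P \<inter> \<Union>H = {}"
  proof -
    have "u \<notin> set P" "w \<notin> set P" "set P \<subseteq> set ps" using ps(1) P by auto
    moreover have "set ps \<inter> \<Union>H = {u, w}" using meet unfolding u_def w_def .
    ultimately have "x \<notin> \<Union>H" if "x \<in> set P" for x
      using that by (metis IntI insertE singletonD subsetD)
    then show ?thesis by blast
  qed
  \<comment> \<open>Otherwise the ear and an arc would both be the edge \<open>{u, w}\<close>, but
    the ear has no edge in \<open>H\<close>. Hence both new cycles have length at least 3.\<close>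
  have notboth: "A \<noteq> [] \<or> P \<noteq> []" "B \<noteq> [] \<or> P \<noteq> []"
  proof -
    have "{u, w} \<in> edges_of (u # A @ [w])" if "A = []" unfolding that by simp
    moreover have "{u, w} \<in> edges_of (w # B @ [u])" if "B = []" unfolding that by (simp add: insert_commute)
    moreover have "{u, w} \<in> edges_of ps" if "P = []" unfolding P that by simp
    ultimately show "A \<noteq> [] \<or> P \<noteq> []" "B \<noteq> [] \<or> P \<noteq> []"
      using sub ps(4) by blast+
  qed
  have faces: "distinct (u # A @ w # rev P)" "distinct (u # P @ w # B)"
    "3 \<le> length (u # A @ w # rev P)" "3 \<le> length (u # P @ w # B)"
  proof -
    have "distinct P" "u \<notin> set P" "w \<notin> set P" using ps(1) P by auto
    moreover have "set A \<inter> set P = {}" "set B \<inter> set P = {}"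
    proof -
      have "set A \<subseteq> \<Union>H" "set B \<subseteq> \<Union>H" using UA UB by (simp_all only: set_simps set_append) blast+
      then show "set A \<inter> set P = {}" "set B \<inter> set P = {}" using PH by blast+
    qed
    ultimately show "distinct (u # A @ w # rev P)" "distinct (u # P @ w # B)" using dist by auto
    show "3 \<le> length (u # A @ w # rev P)" "3 \<le> length (u # P @ w # B)" 
      using notboth length_greater_0_conv[of A] length_greater_0_conv[of B] length_greater_0_conv[of P]
      by (simp_all del: length_greater_0_conv) linarith+
  qed
  have c'12: "c' R1 = u # A @ w # rev P" "c' R2 = u # P @ w # B" "\<And>S. S \<in> \<R> - {R} \<Longrightarrow> c' S = c S"
    using R12new unfolding c'_def fun_upd_def by (simp_all, metis)
  have e1: "edges_of (c' R1 @ [hd (c' R1)]) = edges_of (u # A @ [w]) \<union> edges_of ps"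
    using edges_of_append2[of "u # A" w "rev P @ [u]"] edges_of_rev[of ps] P unfolding c'12 by simp
  have e2: "edges_of (c' R2 @ [hd (c' R2)]) = edges_of (w # B @ [u]) \<union> edges_of ps"
    using edges_of_append2[of "u # P" w "B @ [u]"] P unfolding c'12 by auto
  have other: "S \<inter> R = {}" if "S \<in> \<R> - {R}" for S using that H(3) R(1) by (auto simp: disjoint_def)
  have "S \<inter> J = {}" if "jordan_side J S" for S J
    using that unfolding jordan_side_def by (elim disjE) simp_all
  from this[OF R12(1)] this[OF R12(2)]
  have "R1 \<inter> (path_image h \<union> path_image g) = {}" "R2 \<inter> (path_image k \<union> path_image g) = {}" .
  then have R12I: "R1 \<inter> I = {}" "R2 \<inter> I = {}" unfolding I_def g(4) by blast+
  have "plane_faces (H \<union> edges_of ps) \<R>' c'"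
    unfolding plane_faces_def
  proof (intro conjI ballI)
    show "H \<union> edges_of ps \<subseteq> E" using H ps by blast
    show "finite \<R>'" using H by (simp add: \<R>'_def)
    show "disjoint \<R>'"
    proof -
      have "S \<inter> R1 = {}" "S \<inter> R2 = {}" if "S \<in> \<R> - {R}" for S using other[OF that] R12(4) by blast+
      then show ?thesis using H(3) R12(3) unfolding \<R>'_def disjoint_def by (simp add: Int_commute)
    qed
    show "\<Union>\<R>' = - drawn (H \<union> edges_of ps)"
    proof -
      define U where "U = \<Union>(\<R> - {R})"
      have "drawn (H \<union> edges_of ps) = drawn H \<union> I" unfolding drawn_Un I_def using fH by blast
      moreover have "\<Union>\<R> = R \<union> U" unfolding U_def using R(1) by blast
      then have "- drawn H = R \<union> U" unfolding H(4) .
      moreover have "I \<inter> U = {}" unfolding U_def using other R(2) by blast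
      moreover have "\<Union>\<R>' = R1 \<union> R2 \<union> U" unfolding \<R>'_def U_def by auto
      moreover have "R1 \<union> R2 = R - I" using R12(4) R12I by blast
      ultimately show ?thesis by blast
    qed
    show "facial (H \<union> edges_of ps) (image_mset (\<lambda>R. closed_walk (c' R)) (mset_set \<R>'))"
    proof -
      define Fs where "Fs = image_mset (\<lambda>R. closed_walk (c R)) (mset_set (\<R> - {R}))"
      have "mset_set \<R> = add_mset R (mset_set (\<R> - {R}))"
        using R(1) H(2) by (metis finite_Diff insert_Diff mset_set.insert insert_absorb Diff_iff singletonI)
      then have 1: "facial H (add_mset (closed_walk (X @ Y)) Fs)" using fac unfolding Fs_def by (simp add: c(1))
      obtain S Q where SQ: "closed_walk (X @ Y) = S @ Q" "closed_walk (Y @ X) = Q @ S" by (rule closed_walk_rotate)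
      have "facial H (add_mset (closed_walk (Y @ X)) Fs)" using facial_rotate 1 unfolding SQ .
      then have q1: "facial H (add_mset (walk_darts (u # A @ [w]) @ walk_darts (w # B @ [u])) Fs)"
        using closed_walk_append[of "u # A" "w # B"] unfolding c(2) by simp
      have q2: "walk_darts (u # A @ [w]) \<noteq> []" "walk_darts (w # B @ [u]) \<noteq> []"
        "fst (hd (walk_darts (u # A @ [w]))) = u" "fst (hd (walk_darts (w # B @ [u]))) = w"
        using fst_hd_walk_darts[of "u # A @ [w]"] fst_hd_walk_darts[of "w # B @ [u]"] by simp_all
      have q3: "set (butlast (tl ps)) \<inter> fst ` darts H = {}" using PH P unfolding fst_darts[OF H(1)] by simp
      have q4: "{u, w} \<subseteq> fst ` darts H" using uwH unfolding fst_darts[OF H(1)] by simp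
      have q5: "darts (H \<union> edges_of ps) = darts H \<union> steps ps \<union> prod.swap ` steps ps"
        using darts_edges_of[of ps] by (auto simp: darts_def)
      have q6: "darts H \<inter> steps ps = {}" using ps(4) by (auto simp: darts_def edges_of_def)
      have "facial (H \<union> edges_of ps) (add_mset (walk_darts (u # A @ [w]) @ walk_darts (rev ps))
          (add_mset (walk_darts ps @ walk_darts (w # B @ [u])) Fs))"
        by (rule facial_ear[OF q1 q2 ps(1,2) u_def[symmetric] w_def[symmetric] q3 q4 q5 q6])
      moreover have "closed_walk (c' R1) = walk_darts (u # A @ [w]) @ walk_darts (rev ps)"
        using closed_walk_append[of "u # A" "w # rev P"] P unfolding c'12 by simp
      moreover have "closed_walk (c' R2) = walk_darts ps @ walk_darts (w # B @ [u])"
        using closed_walk_append[of "u # P" "w # B"] P unfolding c'12 by simp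
      moreover have "mset_set \<R>' = add_mset R1 (add_mset R2 (mset_set (\<R> - {R})))"
        unfolding \<R>'_def using R12new H(2) by simp
      moreover have "image_mset (\<lambda>R. closed_walk (c' R)) (mset_set (\<R> - {R})) = Fs"
        unfolding Fs_def by (rule image_mset_cong) (use c'12(3) H(2) in simp)
      ultimately show ?thesis by simp
    qed
    \<comment> \<open>The ear brings one edge more than it brings vertices, and one more
      region.\<close>
    show "card (\<Union>(H \<union> edges_of ps)) + card \<R>' = card (H \<union> edges_of ps) + 2"
    proof -
      have "\<Union>(H \<union> edges_of ps) = \<Union>H \<union> set P"
        using Union_edges_of[OF ps(2)] uwH P by auto
      moreover have "finite (\<Union>H)" by (rule finite_subset[OF UH fin])
      moreover have "card (set P) = length P" using ps(1) P by (simp add: distinct_card)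
      ultimately have 1: "card (\<Union>(H \<union> edges_of ps)) = card (\<Union>H) + length P"
        using PH by (simp add: card_Un_disjoint Int_commute)
      have "finite H" by (rule finite_subset[OF H(1) finite_E])
      moreover have "finite (edges_of ps)" by (simp add: edges_of_def steps_def)
      moreover have "card (edges_of ps) = length P + 1" using card_edges_of[OF ps(1)] P by simp
      ultimately have 2: "card (H \<union> edges_of ps) = card H + length P + 1"
        using ps(4) by (simp add: card_Un_disjoint Int_commute)
      have 3: "card \<R>' = card \<R> + 1"
        unfolding \<R>'_def using R12new H(2) card_Suc_Diff1[OF H(2) R(1)] by (simp del: card_Diff_insert)
      show ?thesis using euler 1 2 3 by simp
    qed
    fix S assume "S \<in> \<R>'"
    consider "S = R1" | "S = R2" | "S \<in> \<R> - {R}" using \<open>S \<in> \<R>'\<close> unfolding \<R>'_def by blast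
    then have "distinct (c' S) \<and> 3 \<le> length (c' S) \<and> jordan_side (drawn (edges_of (c' S @ [hd (c' S)]))) S"
    proof cases
      case 1
      then show ?thesis using R12(1) faces(1,3) unfolding hk g by (simp add: e1 drawn_Un) (simp add: c'12)
    next
      case 2
      then show ?thesis using R12(2) faces(2,4) unfolding hk g by (simp add: e2 drawn_Un) (simp add: c'12)
    next
      case 3
      then show ?thesis using face[of S] c'12(3)[of S] by simp
    qed
    then show "distinct (c' S)" "3 \<le> length (c' S)" "jordan_side (drawn (edges_of (c' S @ [hd (c' S)]))) S"
      by simp_all
  qed
  then show ?thesis by blast
qed

text \<open>Combinatorially, a cycle is a single edge, whose only face traverses it in both
  directions, extended by the ear \<open>ps\<close>.\<close>

lemma plane_faces_cycle:
  assumes ps: "distinct ps" "3 \<le> length ps" "edges_of ps \<subseteq> E" and e: "{hd ps, last ps} \<in> E"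
  shows "\<exists>\<R> c. plane_faces (insert {hd ps, last ps} (edges_of ps)) \<R> c"
proof -
  define a b where "a = hd ps" and "b = last ps"
  have ne: "ps \<noteq> []" "2 \<le> length ps" using ps(2) by auto
  have ab: "a \<noteq> b"
    using ps ne unfolding a_def b_def hd_conv_nth[OF ne(1)] last_conv_nth[OF ne(1)]
    by (subst nth_eq_iff_index_eq) auto
  let ?H = "insert {a, b} (edges_of ps)"
  have eab: "{a, b} \<in> E" using e unfolding a_def b_def .
  obtain g where g: "arc g" "pathstart g = f a" "pathfinish g = f b" "path_image g = drawn (edges_of ps)"
    using walk_arc[OF ps(1) ne(2) ps(3)] unfolding a_def b_def by blast
  obtain h where h: "arc h" "pathstart h = f a" "pathfinish h = f b" "path_image h = path_image (\<gamma> {a, b})"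
    using edge_arc[OF eab] by blast
  have nin: "{a, b} \<notin> edges_of ps"
    using edge_joining_ends[OF ps(1)] ps(2) unfolding a_def b_def by auto
  have ab_in: "a \<in> set ps" "b \<in> set ps" unfolding a_def b_def using ne by auto
  have "drawn (edges_of ps) \<inter> drawn (edges_of [a, b]) = {f a, f b}"
    by (rule walks_meet[OF ps(1) _ ne(2)]) (use ab nin ps(3) eab ab_in in auto)
  then have gh: "path_image g \<inter> path_image h = {f a, f b}" using g h by (simp add: drawn_def)
  define J where "J = path_image g \<union> path_image h"
  note js = jordan_side_two_arcs[OF g(1) h(1) g(2,3) h(2,3) gh J_def]
  have J: "J = drawn ?H" unfolding J_def g h by (simp add: drawn_def Un_commute)
  define R1 R2 where "R1 = inside J" and "R2 = outside J"
  have R: "jordan_side J R1" "jordan_side J R2" unfolding jordan_side_def R1_def R2_def by simp_all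
  have R12: "R1 \<noteq> {}" "R2 \<noteq> {}" "R1 \<inter> R2 = {}" "R1 \<union> R2 = - J"
    using js(2)[OF R(1)] js(2)[OF R(2)] js(4,5) unfolding R1_def R2_def by auto
  then have neq: "R1 \<noteq> R2" by blast
  \<comment> \<open>Which region gets which direction of the cycle is arbitrary: the two boundary
    walks only have to use opposite darts.\<close>
  define c where "c = (\<lambda>R. if R = R1 then ps else rev ps)"
  have c: "c R1 = ps" "c R2 = rev ps" using neq by (simp_all add: c_def)
  have ed: "edges_of (ps @ [a]) = ?H" "edges_of (rev ps @ [b]) = ?H"
    using ne by (auto simp: edges_of_def steps_append steps_rev image_image a_def b_def last_rev insert_commute split_beta)
  have "facial {{a, b}} {#[(a, b)] @ [(b, a)]#}" using facial_edge[OF ab] by simp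
  then have "facial ({{a, b}} \<union> edges_of ps) (add_mset ([(a, b)] @ walk_darts (rev ps)) (add_mset (walk_darts ps @ [(b, a)]) {#}))"
  proof (rule facial_ear)
    have d: "darts {{a, b}} = {(a, b), (b, a)}" by (auto simp: darts_def doubleton_eq_iff)
    show "{a, b} \<subseteq> fst ` darts {{a, b}}" unfolding d by simp
    have "tl ps \<noteq> []" using ps(2) by (cases ps) auto
    then have "ps = a # butlast (tl ps) @ [b]" unfolding a_def b_def using ne
      by (metis append_butlast_last_id last_tl list.collapse)
    then obtain P where P: "ps = a # P @ [b]" by blast
    show "set (butlast (tl ps)) \<inter> fst ` darts {{a, b}} = {}" using ps(1) unfolding d P by simp
    show "darts ({{a, b}} \<union> edges_of ps) = darts {{a, b}} \<union> steps ps \<union> prod.swap ` steps ps"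
      using darts_edges_of[of ps] by (auto simp: darts_def)
    show "darts {{a, b}} \<inter> steps ps = {}"
      using nin unfolding d edges_of_def by (auto simp: insert_commute)
  qed (use ps(1) ne a_def b_def in auto)
  moreover have "closed_walk (c R1) = walk_darts ps @ [(b, a)]" "closed_walk (c R2) = walk_darts (rev ps) @ [(a, b)]"
    unfolding c closed_walk_def using ne by (simp_all add: walk_darts_append a_def b_def last_rev hd_rev)
  ultimately have fac: "facial ?H (add_mset (closed_walk (c R2)) (add_mset (closed_walk (c R1)) {#}))"
    using facial_rotate by (metis insert_is_Un)
  have "plane_faces ?H {R1, R2} c"
    unfolding plane_faces_def
  proof (intro conjI ballI)
    show "?H \<subseteq> E" using eab ps(3) by simp
    show "finite {R1, R2}" by simp
    show "disjoint {R1, R2}" using R12(3) unfolding disjoint_def by auto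
    show "\<Union>{R1, R2} = - drawn ?H" using R12(4) unfolding J by simp
    show "facial ?H (image_mset (\<lambda>R. closed_walk (c R)) (mset_set {R1, R2}))"
      using fac neq by (simp add: add_mset_commute)
    have "\<Union>?H = set ps" using Union_edges_of[OF ne(2)] ab_in by auto
    then have 1: "card (\<Union>?H) = length ps" using ps(1) by (simp add: distinct_card)
    have "finite (edges_of ps)" by (simp add: edges_of_def steps_def)
    then have 2: "card ?H = length ps"
      using nin card_edges_of[OF ps(1) ne(1)] ps(2) by simp
    show "card (\<Union>?H) + card {R1, R2} = card ?H + 2" unfolding 1 2 using neq by simp
    fix S assume "S \<in> {R1, R2}"
    then show "distinct (c S)" "3 \<le> length (c S)" using c ps by auto
    have "drawn (edges_of (c R1 @ [hd (c R1)])) = J" using ed(1) unfolding c J a_def by simp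
    moreover have "drawn (edges_of (c R2 @ [hd (c R2)])) = J" using ed(2) ne unfolding c J b_def by (simp add: hd_rev)
    ultimately have "drawn (edges_of (c S @ [hd (c S)])) = J" using \<open>S \<in> {R1, R2}\<close> by blast
    then show "jordan_side (drawn (edges_of (c S @ [hd (c S)]))) S"
      using R \<open>S \<in> {R1, R2}\<close> by auto
  qed
  then show ?thesis unfolding a_def b_def by blast
qed

end

section \<open>Facial walks of planar graphs\<close>

lemma rtrancl_distinct_walk:
  assumes "(a, b) \<in> r\<^sup>*"
  shows "\<exists>xs. distinct xs \<and> xs \<noteq> [] \<and> hd xs = a \<and> last xs = b \<and> steps xs \<subseteq> r"
  using assms
proof (induction rule: rtrancl_induct)
  case base
  then show ?case by (intro exI[of _ "[a]"]) simp
next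
  case (step y z)
  then obtain xs where xs: "distinct xs" "xs \<noteq> []" "hd xs = a" "last xs = y" "steps xs \<subseteq> r" by blast
  show ?case
  proof (cases "z \<in> set xs")
    case False
    then show ?thesis using xs step(2) by (intro exI[of _ "xs @ [z]"]) (simp add: steps_append)
  next
    case True
    then obtain ys zs where ys: "xs = ys @ z # zs" by (meson split_list)
    have "steps (ys @ [z]) \<subseteq> steps xs"
      unfolding ys steps_def walk_darts_split[of ys z zs] by auto
    moreover have "hd (ys @ [z]) = a" using xs(3) ys by (cases ys) auto
    ultimately show ?thesis using xs ys by (intro exI[of _ "ys @ [z]"]) auto
  qed
qed

text \<open>An empty intersection covers disconnected graphs, a single common vertex covers cut
  vertices.\<close>

definition separation :: "'a set \<Rightarrow> 'a set set \<Rightarrow> 'a set \<Rightarrow> 'a set \<Rightarrow> bool" where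
  "separation V E A B \<longleftrightarrow> A \<union> B = V \<and> A - B \<noteq> {} \<and> B - A \<noteq> {} \<and> card (A \<inter> B) \<le> 1 \<and> (\<forall>e\<in>E. e \<subseteq> A \<or> e \<subseteq> B)"

lemma simple_graphD:
  assumes "simple_graph V E"
  shows "finite V" "\<And>e. e \<in> E \<Longrightarrow> \<exists>u v. e = {u, v} \<and> u \<noteq> v \<and> u \<in> V \<and> v \<in> V" "finite E" "\<And>e. e \<in> E \<Longrightarrow> e \<subseteq> V"
proof -
  show *: "finite V" "\<And>e. e \<in> E \<Longrightarrow> \<exists>u v. e = {u, v} \<and> u \<noteq> v \<and> u \<in> V \<and> v \<in> V"
    using assms unfolding simple_graph_def by blast+
  then show sub: "\<And>e. e \<in> E \<Longrightarrow> e \<subseteq> V" by blast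
  then have "E \<subseteq> Pow V" by blast
  then show "finite E" using *(1) finite_subset finite_Pow_iff by metis
qed

text \<open>An edge between vertices of \<open>H\<close> is an ear by itself. Otherwise take a
  component \<open>K\<close> of the graph outside the vertices of \<open>H\<close>. If it has two
  neighbours in \<open>H\<close>, a path through \<open>K\<close> joins them; if not,
  \<open>K\<close> together with its at most one neighbour can be separated from the rest.\<close>

lemma ear_exists:
  assumes g: "simple_graph V E" and sep: "\<And>A B. \<not> separation V E A B" and H: "H \<subseteq> E" "H \<noteq> {}" "H \<noteq> E"
  obtains ps where "distinct ps" "2 \<le> length ps" "edges_of ps \<subseteq> E" "edges_of ps \<inter> H = {}" "set ps \<inter> \<Union>H = {hd ps, last ps}"
proof (cases "\<exists>e\<in>E - H. e \<subseteq> \<Union>H")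
  case True
  then obtain e where e: "e \<in> E" "e \<notin> H" "e \<subseteq> \<Union>H" by blast
  obtain a b where ab: "e = {a, b}" "a \<noteq> b" using simple_graphD(2)[OF g e(1)] by blast
  have "set [a, b] \<inter> \<Union>H = {a, b}" using e(3) ab(1) by auto
  then show ?thesis using that[of "[a, b]"] e ab by simp
next
  case False
  define U where "U = \<Union>H"
  have U: "U \<subseteq> V" unfolding U_def using simple_graphD(4)[OF g] H(1) by blast
  obtain e0 where "e0 \<in> E - H" using H(1,3) by blast
  then have e0: "e0 \<in> E" "\<not> e0 \<subseteq> U" using False unfolding U_def by (blast, metis)
  then obtain y0 where y0: "y0 \<in> e0" "y0 \<notin> U" by blast
  define r where "r = {(p, q). {p, q} \<in> E \<and> p \<notin> U \<and> q \<notin> U}"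
  define K where "K = r\<^sup>* `` {y0}"
  define N where "N = {x \<in> U. \<exists>y\<in>K. {x, y} \<in> E}"
  have "sym r" unfolding r_def sym_def by (simp add: insert_commute)
  then have symr: "sym (r\<^sup>*)" by (rule sym_rtrancl)
  have y0V: "y0 \<in> V" using y0 e0 simple_graphD(4)[OF g] by blast
  have KV: "y \<in> V \<and> y \<notin> U" if "y \<in> K" for y
  proof -
    have "(y0, y) \<in> r\<^sup>*" using that unfolding K_def by simp
    then show ?thesis
    proof (induction rule: rtrancl_induct)
      case (step p q)
      then have "{p, q} \<in> E" "q \<notin> U" unfolding r_def by auto
      then show ?case using simple_graphD(4)[OF g, of "{p, q}"] by simp
    qed (use y0 y0V in simp)
  qed
  show ?thesis
  proof (cases "\<exists>u\<in>N. \<exists>w\<in>N. u \<noteq> w")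
    case True
    then obtain u w y z where uw: "u \<in> U" "w \<in> U" "u \<noteq> w" "y \<in> K" "z \<in> K" "{u, y} \<in> E" "{w, z} \<in> E"
      unfolding N_def by blast
    have "(y, y0) \<in> r\<^sup>*" "(y0, z) \<in> r\<^sup>*" using uw(4,5) symr unfolding K_def by (auto dest: symD)
    then have "(y, z) \<in> r\<^sup>*" by (rule rtrancl_trans)
    from rtrancl_distinct_walk[OF this]
    obtain xs where xs: "distinct xs" "xs \<noteq> []" "hd xs = y" "last xs = z" "steps xs \<subseteq> r"
      by (elim exE conjE)
    have xU: "x \<notin> U" if "x \<in> set xs" for x
    proof -
      have "x = y \<or> (\<exists>p. (p, x) \<in> steps xs)"
      proof -
        from that obtain i where i: "i < length xs" "xs ! i = x" unfolding in_set_conv_nth by blast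
        show ?thesis
        proof (cases i)
          case 0
          then show ?thesis using i xs(2,3) by (simp add: hd_conv_nth)
        next
          case (Suc j)
          then have "(xs ! j, x) \<in> steps xs" using i unfolding steps_nth by blast
          then show ?thesis by blast
        qed
      qed
      then show ?thesis using KV[OF uw(4)] xs(5) unfolding r_def by blast
    qed
    let ?ps = "u # xs @ [w]"
    have st: "steps ?ps = insert (u, y) (insert (z, w) (steps xs))"
      using xs(2-4) steps_append[of "[u]" "xs @ [w]"] steps_append[of xs "[w]"] by auto
    have ed: "e \<in> E \<and> \<not> e \<subseteq> U" if "e \<in> edges_of ?ps" for e
    proof -
      have "(\<exists>p q. e = {p, q} \<and> (p, q) \<in> r) \<or> e = {u, y} \<or> e = {z, w}"
        using that xs(5) unfolding edges_of_def st by auto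
      then show ?thesis
        using uw(6,7) KV[OF uw(4)] KV[OF uw(5)] unfolding r_def by (auto simp: insert_commute)
    qed
    show ?thesis
    proof (rule that[of ?ps])
      show "distinct ?ps" using xs(1) xU uw(1-3) by auto
      show "edges_of ?ps \<subseteq> E" using ed by blast
      have "e \<subseteq> U" if "e \<in> H" for e unfolding U_def using that by blast
      then show "edges_of ?ps \<inter> H = {}" using ed by blast
      show "set ?ps \<inter> \<Union>H = {hd ?ps, last ?ps}"
        unfolding U_def[symmetric] using xU uw(1,2) by auto
    qed simp
  next
    case False
    have fN: "finite N" using U simple_graphD(1)[OF g] finite_subset unfolding N_def by (metis (no_types, lifting) mem_Collect_eq subsetI)
    have c: "card N \<le> 1" using False fN by (simp add: card_le_Suc0_iff_eq)
    have "separation V E (K \<union> N) (V - K)"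
      unfolding separation_def
    proof (intro conjI ballI)
      show "K \<union> N \<union> (V - K) = V" using KV U unfolding N_def by blast
      have "y0 \<in> K" unfolding K_def by simp
      then show "K \<union> N - (V - K) \<noteq> {}" by blast
      have "(K \<union> N) \<inter> (V - K) = N" using KV U unfolding N_def by blast
      then show "card ((K \<union> N) \<inter> (V - K)) \<le> 1" using c by simp
      \<comment> \<open>An edge of \<open>H\<close> has two ends, and at most one of them is in
        \<open>N\<close>; the other one lies on the far side only.\<close>
      obtain e where e: "e \<in> H" using H(2) by blast
      then have "e \<in> E" using H(1) by blast
      then obtain a b where ab: "e = {a, b}" "a \<noteq> b" using simple_graphD(2)[OF g] by blast
      then have "a \<in> U" "b \<in> U" unfolding U_def using e by auto
      moreover have "a \<notin> N \<or> b \<notin> N" using False ab by blast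
      ultimately show "V - K - (K \<union> N) \<noteq> {}" using KV U by blast
      fix e assume e: "e \<in> E"
      then obtain p q where pq: "e = {p, q}" "p \<in> V" "q \<in> V" using simple_graphD(2)[OF g] by blast
      have step: "q \<in> K \<union> N" if "p \<in> K" "{p, q} \<in> E" for p q
      proof (cases "q \<in> U")
        case True
        then show ?thesis using that unfolding N_def by (auto simp: insert_commute)
      next
        case False
        then have "(p, q) \<in> r" using that KV unfolding r_def by blast
        then show ?thesis using that(1) unfolding K_def by (auto intro: rtrancl_into_rtrancl)
      qed
      show "e \<subseteq> K \<union> N \<or> e \<subseteq> V - K"
        using step[of p q] step[of q p] e pq by (auto simp: insert_commute)
    qed
    then show ?thesis using sep by blast
  qed
qed

lemma (in plane_drawing) plane_faces_extend:
  assumes g: "finite V" "\<And>H. H \<subseteq> E \<Longrightarrow> H \<noteq> {} \<Longrightarrow> H \<noteq> E \<Longrightarrow>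
      \<exists>ps. distinct ps \<and> 2 \<le> length ps \<and> edges_of ps \<subseteq> E \<and> edges_of ps \<inter> H = {} \<and> set ps \<inter> \<Union>H = {hd ps, last ps}"
    and pf: "plane_faces H \<R> c" "H \<noteq> {}"
  shows "\<exists>\<R> c. plane_faces E \<R> c"
  using pf
proof (induction "card (E - H)" arbitrary: H \<R> c rule: less_induct)
  case less
  have H: "H \<subseteq> E" using less(2) unfolding plane_faces_def by blast
  show ?case
  proof (cases "H = E")
    case True
    then show ?thesis using less(2) by blast
  next
    case False
    from g(2)[OF H less(3) False] obtain ps where ps: "distinct ps" "2 \<le> length ps" "edges_of ps \<subseteq> E"
      "edges_of ps \<inter> H = {}" "set ps \<inter> \<Union>H = {hd ps, last ps}" by (elim exE conjE)
    from plane_faces_ear[OF less(2) ps] obtain \<R>' c' where pf': "plane_faces (H \<union> edges_of ps) \<R>' c'" by (elim exE)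
    have "edges_of ps \<noteq> {}" using card_edges_of[OF ps(1)] ps(2) by force
    then have "E - (H \<union> edges_of ps) \<subset> E - H" using ps(3,4) by blast
    then have "card (E - (H \<union> edges_of ps)) < card (E - H)" by (intro psubset_card_mono) (simp_all add: finite_E)
    from less(1)[OF this pf'] show ?thesis using less(3) by simp
  qed
qed

lemma nonseparable_facial:
  assumes g: "simple_graph V E" and sep: "\<And>A B. \<not> separation V E A B" and V: "3 \<le> card V"
    and drawing: "plane_drawing V E f \<gamma>"
  shows "\<exists>Fs. facial E Fs \<and> card V + size Fs = card E + 2"
proof -
  interpret plane_drawing V E f \<gamma> by (rule drawing)
  have "x \<in> \<Union>E" if x: "x \<in> V" for x
  proof (rule ccontr)
    assume nx: "x \<notin> \<Union>E"
    have "separation V E {x} (V - {x})"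
      unfolding separation_def
    proof (intro conjI ballI)
      show "{x} \<union> (V - {x}) = V" using x by blast
      have "card (V - {x}) \<ge> 2" using V x fin by simp
      then have "V - {x} \<noteq> {}" by (metis card.empty not_numeral_le_zero)
      then show "V - {x} - {x} \<noteq> {}" unfolding Diff_idemp .
      show "e \<subseteq> {x} \<or> e \<subseteq> V - {x}" if "e \<in> E" for e
        using that nx edge_subset[OF that] by blast
    qed auto
    then show False using sep by blast
  qed
  then have UE: "\<Union>E = V" using edge_subset by blast
  have "V \<noteq> {}" using V by auto
  then obtain e where e: "e \<in> E" using UE by blast
  obtain a b where ab: "e = {a, b}" "a \<noteq> b" "a \<in> V" "b \<in> V" using edge[OF e] by blast
  have "{e} \<noteq> E"
  proof
    assume "{e} = E"
    then have "V = {a, b}" using UE ab by auto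
    then show False using V ab by simp
  qed
  \<comment> \<open>An ear of the graph with the single edge \<open>e\<close> joins the ends of
    \<open>e\<close>, so the two together form the initial cycle.\<close>
  then obtain ps where ps: "distinct ps" "2 \<le> length ps" "edges_of ps \<subseteq> E" "edges_of ps \<inter> {e} = {}" "set ps \<inter> \<Union>{e} = {hd ps, last ps}"
    using ear_exists[OF g sep, of "{e}"] e by blast
  have "ps \<noteq> []" using ps(2) by auto
  have "hd ps \<noteq> last ps"
    using ps(1,2) unfolding hd_conv_nth[OF \<open>ps \<noteq> []\<close>] last_conv_nth[OF \<open>ps \<noteq> []\<close>]
    by (subst nth_eq_iff_index_eq) auto
  moreover have "{hd ps, last ps} \<subseteq> {a, b}" using ps(5) ab(1) by auto
  ultimately have hl: "{hd ps, last ps} = e" unfolding ab(1) by auto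
  have "length ps \<noteq> 2"
  proof
    assume "length ps = 2"
    then obtain x y where "ps = [x, y]" by (auto simp: numeral_2_eq_2 length_Suc_conv)
    then show False using hl ps(4) by simp
  qed
  then have "3 \<le> length ps" using ps(2) by simp
  from plane_faces_cycle[OF ps(1) this ps(3)] hl e
  obtain \<R> c where "plane_faces (insert {hd ps, last ps} (edges_of ps)) \<R> c" by auto
  then have "\<exists>\<R> c. plane_faces E \<R> c"
    by (rule plane_faces_extend[OF fin, rotated]) (auto intro: ear_exists[OF g sep])
  then obtain \<R> c where pf: "plane_faces E \<R> c" by blast
  then have "facial E (image_mset (\<lambda>R. closed_walk (c R)) (mset_set \<R>))" "card V + card \<R> = card E + 2"
    unfolding plane_faces_def UE by blast+
  then show ?thesis by (intro exI[of _ "image_mset (\<lambda>R. closed_walk (c R)) (mset_set \<R>)"]) simp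
qed

lemma planar_subgraph:
  assumes "planar V E" "A \<subseteq> V" "X \<subseteq> E"
  shows "planar A X"
proof -
  obtain f :: "nat \<Rightarrow> real^2" and \<gamma> :: "nat set \<Rightarrow> real \<Rightarrow> real^2" where d: "inj_on f V"
    "\<forall>e\<in>E. arc (\<gamma> e) \<and> {pathstart (\<gamma> e), pathfinish (\<gamma> e)} = f ` e \<and> (\<forall>x\<in>V. f x \<in> path_image (\<gamma> e) \<longrightarrow> x \<in> e)"
    "\<forall>e\<in>E. \<forall>e'\<in>E. e \<noteq> e' \<longrightarrow> path_image (\<gamma> e) \<inter> path_image (\<gamma> e') \<subseteq> f ` (e \<inter> e')"
    using assms(1) unfolding planar_def by (elim exE conjE)
  have "inj_on f A" using d(1) assms(2) by (rule inj_on_subset)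
  moreover have "\<forall>e\<in>X. arc (\<gamma> e) \<and> {pathstart (\<gamma> e), pathfinish (\<gamma> e)} = f ` e \<and> (\<forall>x\<in>A. f x \<in> path_image (\<gamma> e) \<longrightarrow> x \<in> e)"
    using d(2) assms(2,3) by (meson subsetD)
  moreover have "\<forall>e\<in>X. \<forall>e'\<in>X. e \<noteq> e' \<longrightarrow> path_image (\<gamma> e) \<inter> path_image (\<gamma> e') \<subseteq> f ` (e \<inter> e')"
    using d(3) assms(3) by (meson subsetD)
  ultimately show ?thesis unfolding planar_def by (intro exI conjI)
qed

lemma planar_plane_drawing:
  assumes "simple_graph V E" "planar V E"
  shows "\<exists>f \<gamma>. plane_drawing V E f \<gamma>"
proof -
  obtain f :: "nat \<Rightarrow> real^2" and \<gamma> :: "nat set \<Rightarrow> real \<Rightarrow> real^2" where d: "inj_on f V"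
    "\<forall>e\<in>E. arc (\<gamma> e) \<and> {pathstart (\<gamma> e), pathfinish (\<gamma> e)} = f ` e \<and> (\<forall>x\<in>V. f x \<in> path_image (\<gamma> e) \<longrightarrow> x \<in> e)"
    "\<forall>e\<in>E. \<forall>e'\<in>E. e \<noteq> e' \<longrightarrow> path_image (\<gamma> e) \<inter> path_image (\<gamma> e') \<subseteq> f ` (e \<inter> e')"
    using assms(2) unfolding planar_def by (elim exE conjE)
  define h :: "real^2 \<Rightarrow> complex" where "h = (\<lambda>x. Complex (x $ 1) (x $ 2))"
  have lin: "linear h" unfolding h_def by (rule linearI) (simp_all add: complex_eq_iff)
  have injh: "inj h" unfolding h_def by (rule injI) (simp add: vec_eq_iff forall_2)
  note simple = simple_graphD[OF assms(1)]
  have "plane_drawing V E (\<lambda>x. h (f x)) (\<lambda>e. h \<circ> \<gamma> e)"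
  proof
    show "inj_on (\<lambda>x. h (f x)) V" using d(1) injh by (auto simp: inj_on_def)
    fix e assume e: "e \<in> E"
    note de = d(2)[rule_format, OF e]
    show "arc (h \<circ> \<gamma> e)" using de arc_linear_image_eq[OF lin injh] by simp
    have "h ` {pathstart (\<gamma> e), pathfinish (\<gamma> e)} = h ` (f ` e)" using de by simp
    then show "{pathstart (h \<circ> \<gamma> e), pathfinish (h \<circ> \<gamma> e)} = (\<lambda>x. h (f x)) ` e"
      by (simp add: pathstart_compose pathfinish_compose image_image)
    fix x assume "x \<in> V" "h (f x) \<in> path_image (h \<circ> \<gamma> e)"
    then show "x \<in> e" using de injh by (auto simp: path_image_compose inj_image_mem_iff)
  next
    fix e e' assume e: "e \<in> E" "e' \<in> E" "e \<noteq> e'"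
    then have "path_image (\<gamma> e) \<inter> path_image (\<gamma> e') \<subseteq> f ` (e \<inter> e')" using d(3) by blast
    then have "h ` (path_image (\<gamma> e) \<inter> path_image (\<gamma> e')) \<subseteq> h ` (f ` (e \<inter> e'))" by (rule image_mono)
    then show "path_image (h \<circ> \<gamma> e) \<inter> path_image (h \<circ> \<gamma> e') \<subseteq> (\<lambda>x. h (f x)) ` (e \<inter> e')"
      unfolding path_image_compose image_Int[OF injh] image_image .
  qed (use simple in auto)
  then show ?thesis by blast
qed

lemma fst_darts_eq: "simple_graph V E \<Longrightarrow> fst ` darts E = \<Union>E"
proof (intro equalityI subsetI)
  fix x assume g: "simple_graph V E" and "x \<in> \<Union>E"
  then obtain e where e: "e \<in> E" "x \<in> e" by blast
  obtain a b where "e = {a, b}" using simple_graphD(2)[OF g e(1)] by blast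
  then have "(x, if x = a then b else a) \<in> darts E" using e by (auto simp: darts_def insert_commute)
  then show "x \<in> fst ` darts E" by force
qed (auto simp: darts_def)

lemma facial_rotate_to:
  assumes "facial E Fs" "x \<in> fst ` darts E"
  obtains D Gs where "facial E (add_mset D Gs)" "fst (hd D) = x" "size Fs = Suc (size Gs)"
proof -
  obtain d where d: "d \<in> darts E" "fst d = x" using assms(2) by blast
  then obtain D where D: "D \<in># Fs" "d \<in> set D" using facial_darts[OF assms(1)] by blast
  obtain P Q where PQ: "D = P @ d # Q" using D(2) by (meson split_list)
  obtain Gs where Gs: "Fs = add_mset D Gs" using D(1) by (metis mset_add)
  have "facial E (add_mset ((d # Q) @ P) Gs)" using facial_rotate[of E P "d # Q" Gs] assms(1) unfolding Gs PQ .
  then show ?thesis using that[of "(d # Q) @ P" Gs] d Gs by simp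
qed

text \<open>Every component contributes its own count, 2 if it has edges and 1 if it is an isolated
  vertex; hence inequalities with two constants. Joining at a cut vertex loses one face and one
  vertex, which only the stronger bound for graphs with edges can pay for.\<close>

theorem planar_facial:
  assumes "simple_graph V E" "planar V E" "V \<noteq> {}"
  shows "\<exists>Fs. facial E Fs \<and> card E + 1 \<le> card V + size Fs \<and> (E \<noteq> {} \<longrightarrow> card E + 2 \<le> card V + size Fs)"
  using assms
proof (induction "card V" arbitrary: V E rule: less_induct)
  case less
  note simple = simple_graphD[OF less(2)]
  have split: ?case
    if AB: "A \<union> B = V" "A \<noteq> {}" "B \<noteq> {}" "A \<inter> B = {}" and e: "\<And>e. e \<in> E \<Longrightarrow> e \<subseteq> A \<or> e \<subseteq> B" for A B
  proof -
    define EA EB where "EA = {e \<in> E. e \<subseteq> A}" and "EB = {e \<in> E. e \<subseteq> B}"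
    have fin: "finite A" "finite B" using AB(1) simple(1) by (auto intro: finite_subset)
    have E: "E = EA \<union> EB" using e unfolding EA_def EB_def by blast
    have "A \<subset> V" "B \<subset> V" using AB by blast+
    then have card: "card A < card V" "card B < card V" using simple(1) by (auto intro: psubset_card_mono)
    have sg: "simple_graph A EA" "simple_graph B EB" using less(2) fin unfolding simple_graph_def EA_def EB_def by fastforce+
    have "planar A EA" "planar B EB" 
      by (rule planar_subgraph[OF less(3)]; use AB(1) EA_def EB_def in auto)+
    then obtain FA FB where F: "facial EA FA" "card EA + 1 \<le> card A + size FA" "EA \<noteq> {} \<longrightarrow> card EA + 2 \<le> card A + size FA"
      "facial EB FB" "card EB + 1 \<le> card B + size FB" "EB \<noteq> {} \<longrightarrow> card EB + 2 \<le> card B + size FB"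
      using less(1)[OF card(1) sg(1) _ AB(2)] less(1)[OF card(2) sg(2) _ AB(3)] by auto
    have "fst ` darts EA \<subseteq> A" "fst ` darts EB \<subseteq> B" unfolding EA_def EB_def darts_def by auto
    then have "facial E (FA + FB)" unfolding E using AB(4) by (intro facial_Un F) blast
    moreover have "card V = card A + card B" using AB fin card_Un_disjoint by metis
    moreover have "card E \<le> card EA + card EB" unfolding E by (rule card_Un_le)
    ultimately show ?thesis using F(2,5) by (intro exI[of _ "FA + FB"]) auto
  qed
  show ?case
  proof (cases "\<exists>A B. separation V E A B")
    case True
    then obtain A B where AB: "A \<union> B = V" "A - B \<noteq> {}" "B - A \<noteq> {}" "card (A \<inter> B) \<le> 1" "\<And>e. e \<in> E \<Longrightarrow> e \<subseteq> A \<or> e \<subseteq> B"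
      unfolding separation_def by blast
    have fin: "finite A" "finite B" using AB(1) simple(1) by (auto intro: finite_subset)
    show ?thesis
    proof (cases "A \<inter> B = {}")
      case True
      then show ?thesis using split[of A B] AB by blast
    next
      case False
      then have "card (A \<inter> B) = 1" using AB(4) fin by (metis One_nat_def card_0_eq finite_Int le_Suc_eq le_zero_eq)
      then obtain x where x: "A \<inter> B = {x}" by (auto simp: card_1_singleton_iff)
      define EA EB where "EA = {e \<in> E. e \<subseteq> A}" and "EB = {e \<in> E. e \<subseteq> B}"
      have E: "E = EA \<union> EB" using AB(5) unfolding EA_def EB_def by blast
      show ?thesis
      proof (cases "x \<in> \<Union>EA \<and> x \<in> \<Union>EB")
        case False
        then consider "x \<notin> \<Union>EA" | "x \<notin> \<Union>EB" by blast
        then show ?thesis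
        proof cases
          case 1
          have "e \<subseteq> A - {x} \<or> e \<subseteq> B" if "e \<in> E" for e using AB(5)[OF that] that 1 unfolding EA_def by blast
          then show ?thesis using split[of "A - {x}" B] AB(1-3) x by blast
        next
          case 2
          have "e \<subseteq> A \<or> e \<subseteq> B - {x}" if "e \<in> E" for e using AB(5)[OF that] that 2 unfolding EB_def by blast
          then show ?thesis using split[of A "B - {x}"] AB(1-3) x by blast
        qed
      next
        case True
        then have ne: "EA \<noteq> {}" "EB \<noteq> {}" by auto
        have "A \<subset> V" "B \<subset> V" using AB by blast+
        then have card: "card A < card V" "card B < card V" using simple(1) by (auto intro: psubset_card_mono)
        have ABne: "A \<noteq> {}" "B \<noteq> {}" using AB(2,3) by auto
        have sg: "simple_graph A EA" "simple_graph B EB" using less(2) fin unfolding simple_graph_def EA_def EB_def by fastforce+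
        have "planar A EA" "planar B EB" 
          by (rule planar_subgraph[OF less(3)]; use AB(1) EA_def EB_def in auto)+
        then obtain FA FB where F: "facial EA FA" "card EA + 2 \<le> card A + size FA"
          "facial EB FB" "card EB + 2 \<le> card B + size FB"
          using less(1)[OF card(1) sg(1) _ ABne(1)] less(1)[OF card(2) sg(2) _ ABne(2)] ne by auto
        obtain DA GA where GA: "facial EA (add_mset DA GA)" "fst (hd DA) = x" "size FA = Suc (size GA)"
          using facial_rotate_to[OF F(1)] fst_darts_eq[OF sg(1)] True by metis
        obtain DB GB where GB: "facial EB (add_mset DB GB)" "fst (hd DB) = x" "size FB = Suc (size GB)"
          using facial_rotate_to[OF F(3)] fst_darts_eq[OF sg(2)] True by metis
        have "fst ` darts EA \<subseteq> A" "fst ` darts EB \<subseteq> B" unfolding EA_def EB_def darts_def by auto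
        then have d1: "fst ` darts EA \<inter> fst ` darts EB \<subseteq> {x}" using x by blast
        have d2: "darts EA \<inter> darts EB = {}"
        proof -
          have False if "{a, b} \<in> EA" "{a, b} \<in> EB" for a b
          proof -
            have "{a, b} \<subseteq> A \<inter> B" "{a, b} \<in> E" using that unfolding EA_def EB_def by auto
            moreover have "a \<noteq> b" using simple(2)[OF \<open>{a, b} \<in> E\<close>] by (auto simp: doubleton_eq_iff)
            ultimately show False unfolding x by auto
          qed
          then show ?thesis unfolding darts_def by auto
        qed
        have "facial E (add_mset (DA @ DB) (GA + GB))"
          unfolding E by (rule facial_glue[OF GA(1) GB(1) GA(2) GB(2) d1 d2])
        moreover have "card V + 1 = card A + card B"
          using card_Un_Int[OF fin] unfolding AB(1) x by simp
        moreover have "card E \<le> card EA + card EB" unfolding E by (rule card_Un_le)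
        ultimately show ?thesis using F(2,4) GA(3) GB(3) by (intro exI[of _ "add_mset (DA @ DB) (GA + GB)"]) auto
      qed
    qed
  next
    case False
    have V: "card V \<noteq> 0" using less(4) simple(1) by simp
    show ?thesis
    proof (cases "E = {}")
      case True
      then show ?thesis using V facial_empty by (intro exI[of _ "{#}"]) auto
    next
      case nonempty: False
      show ?thesis
      proof (cases "3 \<le> card V")
        case True
        obtain f \<gamma> where "plane_drawing V E f \<gamma>" using planar_plane_drawing[OF less(2,3)] by blast
        from nonseparable_facial[OF less(2) _ True this] False
        obtain Fs where "facial E Fs" "card V + size Fs = card E + 2" by blast
        then show ?thesis by (intro exI[of _ Fs]) auto
      next
        case small: False
        obtain e where e: "e \<in> E" using nonempty by blast
        obtain a b where ab: "e = {a, b}" "a \<noteq> b" "a \<in> V" "b \<in> V" using simple(2)[OF e] by blast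
        have "card {a, b} \<le> card V" using ab(3,4) simple(1) by (intro card_mono) auto
        then have "{a, b} = V" using ab small simple(1) by (intro card_subset_eq) auto
        have "E = {{a, b}}"
        proof -
          have "e' = {a, b}" if "e' \<in> E" for e'
            using simple(2)[OF that] \<open>{a, b} = V\<close> by auto
          then show ?thesis using e ab(1) by blast
        qed
        then show ?thesis using facial_edge[OF ab(2)] ab(2) \<open>{a, b} = V\<close>[symmetric]
          by (intro exI[of _ "{#[(a, b), (b, a)]#}"]) simp
      qed
    qed
  qed
qed

section \<open>The face permutation\<close>

lemma links_nth:
  assumes "D \<noteq> []"
  shows "links D = {(D ! i, D ! (Suc i mod length D)) | i. i < length D}"
proof (intro equalityI subsetI)
  fix x assume "x \<in> links D"
  then consider "x = (last D, hd D)" | i where "Suc i < length D" "x = (D ! i, D ! Suc i)"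
    unfolding links_eq[OF assms] steps_nth by blast
  then show "x \<in> {(D ! i, D ! (Suc i mod length D)) | i. i < length D}"
  proof cases
    case 1
    then have "x = (D ! (length D - 1), D ! (Suc (length D - 1) mod length D))" "length D - 1 < length D"
      using assms by (simp_all add: last_conv_nth hd_conv_nth)
    then show ?thesis by blast
  next
    case 2
    then have "x = (D ! i, D ! (Suc i mod length D))" "i < length D" by simp_all
    then show ?thesis by blast
  qed
next
  fix x assume "x \<in> {(D ! i, D ! (Suc i mod length D)) | i. i < length D}"
  then obtain i where i: "i < length D" "x = (D ! i, D ! (Suc i mod length D))" by blast
  show "x \<in> links D"
  proof (cases "Suc i < length D")
    case True
    then show ?thesis using i unfolding links_eq[OF assms] steps_nth by auto
  next
    case False
    then have "Suc i = length D" using i by simp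
    then have "x = (last D, hd D)" using i assms by (metis diff_Suc_1 hd_conv_nth last_conv_nth mod_self)
    then show ?thesis unfolding links_eq[OF assms] by simp
  qed
qed

lemma facial_unique_face:
  assumes f: "facial E Fs" and D: "D \<in># Fs" "d \<in> set D"
  shows "count (mset D) d = 1" "D' \<in># Fs - {#D#} \<Longrightarrow> d \<notin> set D'"
proof -
  have d: "d \<in> darts E" using facial_darts[OF f] D by blast
  obtain G where G: "Fs = add_mset D G" using D(1) by (metis mset_add)
  have "count (\<Sum>D\<in>#Fs. mset D) d = 1" using f d unfolding facial_def by simp
  then have s: "count (mset D) d + count (\<Sum>D\<in>#G. mset D) d = 1" unfolding G by simp
  have "count (mset D) d \<noteq> 0" using D(2) by simp
  then show "count (mset D) d = 1" using s by linarith
  then have "d \<notin> set_mset (\<Sum>D\<in>#G. mset D)" using s by (metis add_cancel_left_right not_in_iff)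
  then show "D' \<in># Fs - {#D#} \<Longrightarrow> d \<notin> set D'" unfolding G by auto
qed

text \<open>\<open>\<phi> d\<close> is the dart after \<open>d\<close> on its face \<open>F d\<close>.\<close>
locale sphere_map =
  fixes E :: "'a set set" and \<phi> :: "'a \<times> 'a \<Rightarrow> 'a \<times> 'a" and F :: "'a \<times> 'a \<Rightarrow> ('a \<times> 'a) list"
  assumes fin: "finite (darts E)"
    and bij: "bij_betw \<phi> (darts E) (darts E)"
    and fst_phi: "d \<in> darts E \<Longrightarrow> fst (\<phi> d) = snd d"
    and star: "d \<in> darts E \<Longrightarrow> d' \<in> darts E \<Longrightarrow> fst d = fst d' \<Longrightarrow> \<exists>k. d' = ((\<lambda>p. \<phi> (prod.swap p)) ^^ k) d"
    and F_phi: "d \<in> darts E \<Longrightarrow> F (\<phi> d) = F d"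
    and F_length: "d \<in> darts E \<Longrightarrow> (\<phi> ^^ length (F d)) d = d"
    and F_set: "d \<in> darts E \<Longrightarrow> {d' \<in> darts E. F d' = F d} = set (F d)" "d \<in> darts E \<Longrightarrow> distinct (F d)"

text \<open>Every dart occurs exactly once in the facial walks, so its face and its successor are
  functions. \<open>\<phi>\<close> is injective because running round the rest of the face undoes
  it.\<close>

lemma facial_sphere_map:
  assumes f: "facial E Fs"
  shows "\<exists>\<phi> F. sphere_map E \<phi> F \<and> card (F ` darts E) = size Fs"
proof -
  define F where "F d = (THE D. D \<in># Fs \<and> d \<in> set D)" for d
  have uniq: "D = D'" if "D \<in># Fs" "d \<in> set D" "D' \<in># Fs" "d \<in> set D'" for D D' d
  proof (rule ccontr)
    assume "D \<noteq> D'"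
    then have "D' \<in># Fs - {#D#}" using that(3) by (simp add: in_diff_count not_in_iff[symmetric])
    then show False using facial_unique_face(2)[OF f that(1,2)] that(4) by blast
  qed
  have F: "F d = D" if "D \<in># Fs" "d \<in> set D" for D d
    unfolding F_def using that uniq by (intro the_equality conjI) blast+
  have Fd: "F d \<in># Fs" "d \<in> set (F d)" if d: "d \<in> darts E" for d
  proof -
    obtain D where "D \<in># Fs" "d \<in> set D" using d facial_darts[OF f] by blast
    then show "F d \<in># Fs" "d \<in> set (F d)" using F by auto
  qed
  have dd: "d \<in> darts E" if "D \<in># Fs" "d \<in> set D" for D d using that facial_darts[OF f] by blast
  have nonempty: "D \<noteq> []" if "D \<in># Fs" for D using f that unfolding facial_def by blast
  have dist: "distinct D" if D: "D \<in># Fs" for D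
    unfolding distinct_count_atmost_1
  proof
    fix d
    show "count (mset D) d = (if d \<in> set D then 1 else 0)"
      using facial_unique_face(1)[OF f D] by (simp add: count_mset_0_iff)
  qed
  define \<phi> where "\<phi> d = (THE b. (d, b) \<in> links (F d))" for d
  have key: "F (D ! i) = D" "\<phi> (D ! i) = D ! (Suc i mod length D)" if D: "D \<in># Fs" and i: "i < length D" for D i
  proof -
    show FD: "F (D ! i) = D" using F[OF D nth_mem[OF i]] .
    show "\<phi> (D ! i) = D ! (Suc i mod length D)"
      unfolding \<phi>_def FD links_nth[OF nonempty[OF D]]
    proof (rule the_equality)
      show "(D ! i, D ! (Suc i mod length D)) \<in> {(D ! i, D ! (Suc i mod length D)) | i. i < length D}" using i by blast
      fix b assume "(D ! i, b) \<in> {(D ! i, D ! (Suc i mod length D)) | i. i < length D}"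
      then obtain j where "j < length D" "D ! i = D ! j" "b = D ! (Suc j mod length D)" by blast
      then show "b = D ! (Suc i mod length D)" using nth_eq_iff_index_eq[OF dist[OF D] i] by simp
    qed
  qed
  have pow: "(\<phi> ^^ j) (D ! i) = D ! ((i + j) mod length D)" if D: "D \<in># Fs" and i: "i < length D" for D i j
  proof (induction j)
    case (Suc j)
    have "(i + j) mod length D < length D" using i by (intro mod_less_divisor) linarith
    then show ?case using Suc key(2)[OF D] by (simp add: mod_Suc_eq)
  qed (use i in simp)
  have idx: "\<exists>D i. D \<in># Fs \<and> i < length D \<and> d = D ! i \<and> F d = D" if d: "d \<in> darts E" for d
  proof -
    obtain i where "i < length (F d)" "F d ! i = d" using Fd(2)[OF d] unfolding in_set_conv_nth by blast
    then show ?thesis using Fd(1)[OF d] by (intro exI[of _ "F d"] exI[of _ i]) simp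
  qed
  have phi_in: "\<phi> d \<in> darts E" "F (\<phi> d) = F d" "(d, \<phi> d) \<in> links (F d)" "(\<phi> ^^ length (F d)) d = d" if d: "d \<in> darts E" for d
  proof -
    obtain D i where Di: "D \<in># Fs" "i < length D" "d = D ! i" "F d = D" using idx[OF d] by blast
    have s: "Suc i mod length D < length D" using Di(2) by (intro mod_less_divisor) linarith
    then show "\<phi> d \<in> darts E" "F (\<phi> d) = F d"
      using key[OF Di(1,2)] key(1)[OF Di(1) s] dd[OF Di(1) nth_mem[OF s]] Di(3,4) by simp_all
    show "(d, \<phi> d) \<in> links (F d)"
      unfolding Di(4) links_nth[OF nonempty[OF Di(1)]] using key(2)[OF Di(1,2)] Di(2,3) by blast
    show "(\<phi> ^^ length (F d)) d = d" using pow[OF Di(1,2), of "length D"] Di(2-4) by simp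
  qed
  have finD: "finite (darts E)" using f unfolding facial_def by blast
  have "inj_on \<phi> (darts E)"
  proof (rule inj_onI)
    fix d d' assume d: "d \<in> darts E" "d' \<in> darts E" "\<phi> d = \<phi> d'"
    then have Feq: "F d = F d'" using phi_in(2) by metis
    have "length (F d) \<noteq> 0" using nonempty[OF Fd(1)[OF d(1)]] by simp
    then obtain n where n: "length (F d) = Suc n" by (cases "length (F d)") auto
    have "d = (\<phi> ^^ n) (\<phi> d)" using phi_in(4)[OF d(1)] unfolding n by (simp add: funpow_swap1)
    moreover have "d' = (\<phi> ^^ n) (\<phi> d')" using phi_in(4)[OF d(2)] unfolding Feq[symmetric] n by (simp add: funpow_swap1)
    ultimately show "d = d'" using d(3) by simp
  qed
  then have bij: "bij_betw \<phi> (darts E) (darts E)"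
    unfolding bij_betw_def using endo_inj_surj[OF finD] phi_in(1) by blast
  have star: "\<exists>k. d' = ((\<lambda>p. \<phi> (prod.swap p)) ^^ k) d" if "d \<in> darts E" "d' \<in> darts E" "fst d = fst d'" for d d'
  proof -
    have "(d, d') \<in> (star_steps Fs)\<^sup>*" using f that unfolding facial_def by blast
    then show ?thesis
    proof (induction rule: rtrancl_induct)
      case base
      show ?case by (intro exI[of _ 0]) simp
    next
      case (step p q)
      then obtain k where k: "p = ((\<lambda>p. \<phi> (prod.swap p)) ^^ k) d" by blast
      obtain D where D: "D \<in># Fs" "(prod.swap p, q) \<in> links D" using step(2) unfolding star_steps_def by blast
      then obtain i where i: "i < length D" "prod.swap p = D ! i" "q = D ! (Suc i mod length D)"
        unfolding links_nth[OF nonempty[OF D(1)]] by blast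
      then have "q = \<phi> (prod.swap p)" using key(2)[OF D(1) i(1)] by simp
      then show ?case using k by (intro exI[of _ "Suc k"]) simp
    qed
  qed
  have Fset: "{d' \<in> darts E. F d' = F d} = set (F d)" if d: "d \<in> darts E" for d
  proof (intro equalityI subsetI)
    fix x assume "x \<in> {d' \<in> darts E. F d' = F d}"
    then show "x \<in> set (F d)" using Fd(2)[of x] by auto
  next
    fix x assume "x \<in> set (F d)"
    then show "x \<in> {d' \<in> darts E. F d' = F d}" using F[OF Fd(1)[OF d]] dd[OF Fd(1)[OF d]] by blast
  qed
  have "sphere_map E \<phi> F"
  proof
    show "fst (\<phi> d) = snd d" if d: "d \<in> darts E" for d
      using facial_link(1)[OF f Fd(1)[OF d] phi_in(3)[OF d]] by simp
  qed (use finD bij star phi_in Fset dist Fd in auto)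
  moreover have "card (F ` darts E) = size Fs"
  proof -
    have "F ` darts E = set_mset Fs"
    proof (intro equalityI subsetI)
      fix D assume D: "D \<in># Fs"
      then have "hd D \<in> set D" using nonempty by simp
      then show "D \<in> F ` darts E" using F[OF D] dd[OF D] by (metis image_eqI)
    qed (use Fd in auto)
    moreover have "count Fs D \<le> 1" for D
    proof (rule ccontr)
      assume "\<not> count Fs D \<le> 1"
      then have D: "D \<in># Fs" "D \<in># Fs - {#D#}" by (simp_all add: count_greater_zero_iff[symmetric] del: count_greater_zero_iff)
      then show False using facial_unique_face(2)[OF f D(1) hd_in_set[OF nonempty[OF D(1)]] D(2)] nonempty[OF D(1)] by simp
    qed
    then have "count Fs D = count (mset_set (set_mset Fs)) D" for D
      by (metis count_mset_set(1,3) finite_set_mset le_antisym not_in_iff One_nat_def Suc_leI count_greater_zero_iff)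
    then have "Fs = mset_set (set_mset Fs)" by (rule multiset_eqI)
    then have "size Fs = card (set_mset Fs)" by (metis size_mset_set)
    ultimately show ?thesis by simp
  qed
  ultimately show ?thesis by blast
qed

section \<open>Separators along a spanning tree\<close>

text \<open>A graph on \<open>S\<close> with at most \<open>card S - 2\<close> edges is
  disconnected, and \<open>U\<close> is a union of components. The induction contracts one edge
  \<open>(a, b)\<close> by renaming \<open>b\<close> to \<open>a\<close>. The edges form a list
  because contraction may create repetitions and loops.\<close>

lemma nontrivial_closed_class:
  assumes "finite S" "length ps + 1 < card S" "set ps \<subseteq> S \<times> S"
  shows "\<exists>U\<subseteq>S. U \<noteq> {} \<and> U \<noteq> S \<and> (\<forall>(a, b)\<in>set ps. a \<in> U \<longleftrightarrow> b \<in> U)"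
  using assms
proof (induction "length ps" arbitrary: ps S)
  case 0
  then have "S \<noteq> {}" by auto
  then obtain a where "a \<in> S" by blast
  moreover have "{a} \<noteq> S" using 0 by auto
  ultimately show ?case using 0 by (intro exI[of _ "{a}"]) auto
next
  case (Suc k)
  obtain a b qs where ps: "ps = (a, b) # qs" using Suc(2) by (cases ps) auto
  have ab: "a \<in> S" "b \<in> S" "set qs \<subseteq> S \<times> S" using Suc(5) ps by auto
  show ?case
  proof (cases "a = b")
    case True
    have "\<exists>U\<subseteq>S. U \<noteq> {} \<and> U \<noteq> S \<and> (\<forall>(a, b)\<in>set qs. a \<in> U \<longleftrightarrow> b \<in> U)"
      using Suc(2,4) ps ab by (intro Suc(1)) (use Suc(3) in auto)
    then show ?thesis unfolding ps using True by auto
  next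
    case False
    define rep where "rep p = (if p = b then a else p)" for p
    define qs' where "qs' = map (map_prod rep rep) qs"
    have "\<exists>U\<subseteq>S - {b}. U \<noteq> {} \<and> U \<noteq> S - {b} \<and> (\<forall>(a, b)\<in>set qs'. a \<in> U \<longleftrightarrow> b \<in> U)"
    proof (rule Suc(1))
      show "k = length qs'" using Suc(2) ps by (simp add: qs'_def)
      show "length qs' + 1 < card (S - {b})" using Suc(3,4) ps ab by (simp add: qs'_def)
      show "set qs' \<subseteq> (S - {b}) \<times> (S - {b})" using ab False unfolding qs'_def rep_def by (auto split: if_splits)
    qed (use Suc(3) in simp)
    then obtain U where U: "U \<subseteq> S - {b}" "U \<noteq> {}" "U \<noteq> S - {b}" "\<And>a b. (a, b) \<in> set qs' \<Longrightarrow> a \<in> U \<longleftrightarrow> b \<in> U" by blast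
    define W where "W = (if a \<in> U then insert b U else U)"
    have W: "p \<in> W \<longleftrightarrow> rep p \<in> U" for p
      using U(1) unfolding W_def rep_def by auto
    have "p \<in> W \<longleftrightarrow> q \<in> W" if "(p, q) \<in> set ps" for p q
    proof (cases "(p, q) = (a, b)")
      case True
      then show ?thesis using False unfolding W rep_def by simp
    next
      case False
      then have "(rep p, rep q) \<in> set qs'" using that unfolding ps qs'_def by force
      then show ?thesis using U(4) unfolding W by blast
    qed
    moreover have "W \<subseteq> S" "W \<noteq> {}" using U(1,2) ab unfolding W_def by auto
    moreover have "W \<noteq> S"
    proof
      assume "W = S"
      then have "S - {b} \<subseteq> U" using U(1) unfolding W_def by (auto split: if_splits)
      then show False using U(1,3) by blast
    qed
    ultimately show ?thesis by blast
  qed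
qed

text \<open>A connected map with a rooted spanning tree, given by parents and depths. Planarity
  enters only through \<open>euler\<close>; that the tree is a breadth first tree is added in
  \<open>wall\<close>.\<close>

locale rooted_map = sphere_map E \<phi> F for E :: "'a set set" and \<phi> F +
  fixes V :: "'a set" and v :: 'a and par :: "'a \<Rightarrow> 'a" and dep :: "'a \<Rightarrow> nat"
  assumes finV: "finite V"
    and edgeV: "e \<in> E \<Longrightarrow> \<exists>a b. e = {a, b} \<and> a \<noteq> b \<and> a \<in> V \<and> b \<in> V"
    and root: "v \<in> V" "par v = v" "dep v = 0"
    and par: "w \<in> V \<Longrightarrow> w \<noteq> v \<Longrightarrow> par w \<in> V \<and> {w, par w} \<in> E \<and> dep w = Suc (dep (par w))"
    and euler: "card E + 2 \<le> card V + card (F ` darts E)"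
    and nonempty: "E \<noteq> {}"
begin

definition tree_edges :: "'a set set" where
  "tree_edges = (\<lambda>w. {w, par w}) ` (V - {v})"

definition tree_dart :: "'a \<times> 'a \<Rightarrow> bool" where
  "tree_dart d \<longleftrightarrow> {fst d, snd d} \<in> tree_edges"

definition anc :: "'a \<Rightarrow> 'a set" where
  "anc x = {u. \<exists>k. (par ^^ k) x = u}"

text \<open>Faces may be glued across edges outside the tree without leaving \<open>X\<close>. So
  \<open>X\<close> is bounded by tree edges and by the corners where a face passes from
  \<open>X\<close> to its complement or back.\<close>

definition cotree_closed :: "('a \<times> 'a) set \<Rightarrow> bool" where
  "cotree_closed X \<longleftrightarrow> X \<subseteq> darts E \<and> (\<forall>d\<in>darts E. \<not> tree_dart d \<longrightarrow> (d \<in> X \<longleftrightarrow> prod.swap d \<in> X))"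

definition exits :: "('a \<times> 'a) set \<Rightarrow> ('a \<times> 'a) set" where
  "exits X = {d \<in> X. \<phi> d \<notin> X}"

definition entries :: "('a \<times> 'a) set \<Rightarrow> ('a \<times> 'a) set" where
  "entries X = {d \<in> darts E - X. \<phi> d \<in> X}"

lemma anc_refl [simp]: "x \<in> anc x"
  unfolding anc_def by (auto intro: exI[of _ 0])

lemma anc_par: "z \<in> anc x \<Longrightarrow> par z \<in> anc x"
proof -
  assume "z \<in> anc x"
  then obtain k where "(par ^^ k) x = z" unfolding anc_def by blast
  then have "(par ^^ Suc k) x = par z" by simp
  then show ?thesis unfolding anc_def by blast
qed

lemma anc_step: "w \<in> anc (par x) \<Longrightarrow> w \<in> anc x"
proof -
  assume "w \<in> anc (par x)"
  then obtain k where "(par ^^ k) (par x) = w" unfolding anc_def by blast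
  then have "(par ^^ Suc k) x = w" by (simp add: funpow_swap1)
  then show ?thesis unfolding anc_def by blast
qed

lemma anc_cases: "w \<in> anc x \<Longrightarrow> w = x \<or> w \<in> anc (par x)"
proof -
  assume "w \<in> anc x"
  then obtain k where k: "(par ^^ k) x = w" unfolding anc_def by blast
  show ?thesis
  proof (cases k)
    case (Suc j)
    then have "(par ^^ j) (par x) = w" using k by (simp add: funpow_swap1)
    then show ?thesis unfolding anc_def by blast
  qed (use k in simp)
qed

lemma anc_dep:
  assumes "x \<in> V" "u \<in> anc x"
  shows "u \<in> V" "dep u \<le> dep x"
proof -
  obtain k where k: "(par ^^ k) x = u" using assms(2) unfolding anc_def by blast
  have "(par ^^ k) x \<in> V \<and> dep ((par ^^ k) x) \<le> dep x"
  proof (induction k)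
    case (Suc k)
    then show ?case using par[of "(par ^^ k) x"] root by (cases "(par ^^ k) x = v") auto
  qed (use assms(1) in simp)
  then show "u \<in> V" "dep u \<le> dep x" using k by simp_all
qed

lemma phi_in: "d \<in> darts E \<Longrightarrow> \<phi> d \<in> darts E"
  using bij unfolding bij_betw_def by blast

lemma phi_inj: "d \<in> darts E \<Longrightarrow> d' \<in> darts E \<Longrightarrow> \<phi> d = \<phi> d' \<Longrightarrow> d = d'"
  using bij unfolding bij_betw_def inj_on_def by blast

lemma darts_ends: "d \<in> darts E \<Longrightarrow> fst d \<in> V \<and> snd d \<in> V \<and> fst d \<noteq> snd d"
proof -
  assume "d \<in> darts E"
  then have "{fst d, snd d} \<in> E" unfolding darts_def by auto
  then show ?thesis using edgeV[of "{fst d, snd d}"] by (auto simp: doubleton_eq_iff)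
qed

lemma finite_sub: "X \<subseteq> darts E \<Longrightarrow> finite X"
  using fin finite_subset by blast

text \<open>\<open>\<phi>\<close> permutes a finite set, so its orbits leave \<open>X\<close> as
  often as they enter it.\<close>

lemma card_entries:
  assumes "X \<subseteq> darts E"
  shows "card (entries X) = card (exits X)"
proof -
  have fX: "finite X" using finite_sub[OF assms] .
  let ?I = "{d \<in> X. \<phi> d \<in> X}"
  have "card X = card (?I \<union> exits X)" unfolding exits_def by (rule arg_cong[where f = card]) blast
  also have "\<dots> = card ?I + card (exits X)"
    using fX unfolding exits_def by (intro card_Un_disjoint) auto
  finally have 1: "card X = card ?I + card (exits X)" .
  have "\<phi> ` (?I \<union> entries X) = X"
  proof (intro equalityI subsetI)
    fix x assume x: "x \<in> X"
    then obtain d where "d \<in> darts E" "x = \<phi> d" using bij assms unfolding bij_betw_def by blast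
    then show "x \<in> \<phi> ` (?I \<union> entries X)" using x unfolding entries_def by blast
  qed (auto simp: entries_def)
  moreover have "inj_on \<phi> (?I \<union> entries X)"
    using phi_inj assms unfolding inj_on_def entries_def by blast
  ultimately have "card X = card (?I \<union> entries X)" using card_image by metis
  also have "\<dots> = card ?I + card (entries X)"
    using fX fin unfolding entries_def by (intro card_Un_disjoint) auto
  finally show ?thesis using 1 by simp
qed

text \<open>Let \<open>S\<close> be the subtree below \<open>w\<close>. If no exit or entry points into \<open>S\<close>, then \<open>\<phi>\<close> maps the darts of \<open>X\<close>
  that end in \<open>S\<close> bijectively to those that start in \<open>S\<close>; but only the edge from \<open>w\<close> to its parent
  can contribute to the difference of their numbers.\<close>
lemma exit_or_entry_below:
  assumes X: "cotree_closed X" and w: "w \<in> V" "w \<noteq> v" and ne: "(w, par w) \<in> X \<longleftrightarrow> (par w, w) \<notin> X"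
  shows "\<exists>d\<in>exits X \<union> entries X. w \<in> anc (snd d)"
proof (rule ccontr)
  assume "\<not> (\<exists>d\<in>exits X \<union> entries X. w \<in> anc (snd d))"
  then have no: "\<And>d. d \<in> exits X \<Longrightarrow> w \<notin> anc (snd d)" "\<And>d. d \<in> entries X \<Longrightarrow> w \<notin> anc (snd d)" by blast+
  define S where "S = {u. w \<in> anc u}"
  have XD: "X \<subseteq> darts E" using X unfolding cotree_closed_def by blast
  have fX: "finite X" using finite_sub[OF XD] .
  define O1 where "O1 = {d \<in> X. fst d \<in> S}"
  define I1 where "I1 = {d \<in> X. snd d \<in> S}"
  have "\<phi> ` I1 = O1"
  proof (intro equalityI subsetI)
    fix x assume "x \<in> \<phi> ` I1"
    then obtain d where d: "d \<in> X" "snd d \<in> S" "x = \<phi> d" unfolding I1_def by blast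
    have "\<phi> d \<in> X" using no(1)[of d] d unfolding exits_def S_def by blast
    then show "x \<in> O1" using d fst_phi[of d] XD unfolding O1_def by auto
  next
    fix x assume x: "x \<in> O1"
    then have "x \<in> X" "x \<in> darts E" using XD unfolding O1_def by auto
    then obtain d where d: "d \<in> darts E" "x = \<phi> d" using bij unfolding bij_betw_def by blast
    have "snd d \<in> S" using x d fst_phi[of d] unfolding O1_def by simp
    then have "d \<in> X" using no(2)[of d] d \<open>x \<in> X\<close> unfolding entries_def S_def by blast
    then show "x \<in> \<phi> ` I1" using d \<open>snd d \<in> S\<close> unfolding I1_def by blast
  qed
  moreover have "inj_on \<phi> I1" using phi_inj XD unfolding inj_on_def I1_def by blast
  ultimately have c1: "card O1 = card I1" using card_image by metis
  define B where "B = {d \<in> X. fst d \<in> S \<and> snd d \<in> S}"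
  define O2 where "O2 = {d \<in> X. fst d \<in> S \<and> snd d \<notin> S}"
  define I2 where "I2 = {d \<in> X. fst d \<notin> S \<and> snd d \<in> S}"
  have "O1 = B \<union> O2" "I1 = B \<union> I2" unfolding O1_def B_def O2_def I1_def I2_def by blast+
  moreover have "finite B" "finite O2" "finite I2" using fX unfolding B_def O2_def I2_def by auto
  moreover have "B \<inter> O2 = {}" "B \<inter> I2 = {}" unfolding B_def O2_def I2_def by blast+
  ultimately have c2: "card O2 = card I2" using c1 by (simp add: card_Un_disjoint)
  have wS: "w \<in> S" unfolding S_def by simp
  have pS: "par w \<notin> S"
    using anc_dep(2)[of "par w" w] par[OF w] unfolding S_def by auto
  \<comment> \<open>The only tree edge leaving a subtree joins its top vertex \<open>w\<close> to
    the parent of \<open>w\<close>.\<close>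
  have cross: "d = (w, par w)" if td: "tree_dart d" "fst d \<in> S" "snd d \<notin> S" for d
  proof -
    obtain z where z: "z \<in> V" "z \<noteq> v" "{fst d, snd d} = {z, par z}" using td(1) unfolding tree_dart_def tree_edges_def by blast
    have "fst d = z \<and> snd d = par z"
    proof (rule ccontr)
      assume "\<not> (fst d = z \<and> snd d = par z)"
      then have "fst d = par z" "snd d = z" using z(3) by (auto simp: doubleton_eq_iff)
      then show False using that(2,3) anc_step unfolding S_def by auto
    qed
    moreover have "w = z" using that(2,3) calculation anc_cases[of w z] unfolding S_def by auto
    ultimately show ?thesis by (metis prod.collapse)
  qed
  have cross': "d = (par w, w)" if "tree_dart d" "fst d \<notin> S" "snd d \<in> S" for d
    using cross[of "prod.swap d"] that by (cases d) (auto simp: tree_dart_def insert_commute)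
  define t where "t = (w, par w)"
  \<comment> \<open>The other darts of \<open>X\<close> that leave or enter \<open>S\<close> belong
    to edges outside the tree, so reversal matches them. The two numbers can then agree only if
    \<open>X\<close> contains both or none of the darts of the exceptional edge.\<close>
  have "prod.swap ` (O2 - {t}) = I2 - {prod.swap t}"
  proof -
    have sw: "prod.swap d \<in> X" if "d \<in> X" "\<not> tree_dart d" for d
      using X that XD unfolding cotree_closed_def by blast
    have a: "prod.swap d \<in> I2 - {prod.swap t}" if d: "d \<in> O2 - {t}" for d
    proof -
      have *: "d \<in> X" "fst d \<in> S" "snd d \<notin> S" "d \<noteq> t" using d unfolding O2_def by auto
      then have "\<not> tree_dart d" using cross[of d] unfolding t_def by blast
      then have "prod.swap d \<in> X" using sw *(1) by blast
      moreover have "prod.swap d \<noteq> prod.swap t" using *(4) by (metis swap_swap)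
      ultimately show ?thesis using * unfolding I2_def by simp
    qed
    have b: "prod.swap d \<in> O2 - {t}" if d: "d \<in> I2 - {prod.swap t}" for d
    proof -
      have *: "d \<in> X" "fst d \<notin> S" "snd d \<in> S" "d \<noteq> prod.swap t" using d unfolding I2_def by auto
      then have "\<not> tree_dart d" using cross'[of d] unfolding t_def by auto
      then have "prod.swap d \<in> X" using sw *(1) by blast
      moreover have "prod.swap d \<noteq> t" using *(4) by (metis swap_swap)
      ultimately show ?thesis using * unfolding O2_def by simp
    qed
    show ?thesis
    proof (intro equalityI subsetI)
      fix d assume "d \<in> I2 - {prod.swap t}"
      then show "d \<in> prod.swap ` (O2 - {t})" using b by (metis image_eqI swap_swap)
    next
      fix d assume "d \<in> prod.swap ` (O2 - {t})"
      then obtain p where p: "p \<in> O2 - {t}" "d = prod.swap p" by (rule imageE)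
      show "d \<in> I2 - {prod.swap t}" unfolding p(2) by (rule a[OF p(1)])
    qed
  qed
  then have c3: "card (O2 - {t}) = card (I2 - {prod.swap t})"
    using card_image[of prod.swap "O2 - {t}"] by (metis inj_on_subset inj_swap subset_UNIV)
  have tO: "t \<in> O2 \<longleftrightarrow> (w, par w) \<in> X" using wS pS unfolding t_def O2_def by auto
  have tI: "prod.swap t \<in> I2 \<longleftrightarrow> (par w, w) \<in> X" using wS pS unfolding t_def I2_def by auto
  have fO: "finite O2" "finite I2" using fX unfolding O2_def I2_def by auto
  show False
  proof (cases "(w, par w) \<in> X")
    case True
    then have "t \<in> O2" "prod.swap t \<notin> I2" using tO tI ne by auto
    then have "card (O2 - {t}) < card O2" "I2 - {prod.swap t} = I2" using card_Diff1_less[OF fO(1)] by blast+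
    then show False using c2 c3 by simp
  next
    case False
    then have "t \<notin> O2" "prod.swap t \<in> I2" using tO tI ne by auto
    then have "card (I2 - {prod.swap t}) < card I2" "O2 - {t} = O2" using card_Diff1_less[OF fO(2)] by blast+
    then show False using c2 c3 by simp
  qed
qed

lemma tree_dartE:
  assumes "tree_dart d"
  obtains z where "z \<in> V" "z \<noteq> v" "d = (z, par z) \<or> d = (par z, z)"
proof -
  obtain z where z: "z \<in> V" "z \<noteq> v" "{fst d, snd d} = {z, par z}"
    using assms unfolding tree_dart_def tree_edges_def by blast
  then have "d = (z, par z) \<or> d = (par z, z)" by (cases d) (auto simp: doubleton_eq_iff)
  then show ?thesis using that z by blast
qed

lemma tree_dart_swap [simp]: "tree_dart (prod.swap d) = tree_dart d"
  by (simp add: tree_dart_def insert_commute)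

text \<open>An edge with only one dart in \<open>X\<close> is a tree edge, and some exit or entry
  points below it. So all these edges lie on the tree paths from the root to the ends of exits and
  entries.\<close>

lemma boundary_below:
  assumes X: "cotree_closed X" and d: "d \<in> darts E" "d \<in> X \<longleftrightarrow> prod.swap d \<notin> X"
  shows "\<exists>e\<in>exits X \<union> entries X. fst d \<in> anc (snd e) \<and> snd d \<in> anc (snd e)"
proof -
  have "tree_dart d" using X d unfolding cotree_closed_def by blast
  then obtain z where z: "z \<in> V" "z \<noteq> v" "d = (z, par z) \<or> d = (par z, z)" by (rule tree_dartE)
  then have "(z, par z) \<in> X \<longleftrightarrow> (par z, z) \<notin> X" using d(2) by auto
  then obtain e where "e \<in> exits X \<union> entries X" "z \<in> anc (snd e)"
    using exit_or_entry_below[OF X z(1,2)] by blast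
  then show ?thesis using z(3) anc_par by (intro bexI[of _ e]) auto
qed

text \<open>Without exits there are no entries either, and by \<open>boundary_below\<close> no edge
  is left that could bound \<open>X\<close>.\<close>

lemma no_exits_swap_closed:
  assumes X: "cotree_closed X" and ex: "exits X = {}" and d: "d \<in> darts E"
  shows "d \<in> X \<longleftrightarrow> prod.swap d \<in> X"
proof -
  have XD: "X \<subseteq> darts E" using X unfolding cotree_closed_def by blast
  have "finite (entries X)" using fin unfolding entries_def by simp
  then have "entries X = {}" using card_entries[OF XD] ex by simp
  then show ?thesis using boundary_below[OF X d] ex by blast
qed

text \<open>Connectedness of the map: swapping and \<open>\<phi>\<close> together rotate around a
  vertex, which by \<open>star\<close> reaches all its darts, and the tree leads from vertex to
  vertex.\<close>

lemma swap_phi_closed_all: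
  assumes XD: "X \<subseteq> darts E" and sw: "\<And>d. d \<in> darts E \<Longrightarrow> d \<in> X \<longleftrightarrow> prod.swap d \<in> X"
    and ph: "\<And>d. d \<in> X \<Longrightarrow> \<phi> d \<in> X" and ne: "X \<noteq> {}"
  shows "X = darts E"
proof -
  have all_at: "d' \<in> X" if dX: "d \<in> X" "d' \<in> darts E" "fst d = fst d'" for d d'
  proof -
    obtain k where k: "d' = ((\<lambda>p. \<phi> (prod.swap p)) ^^ k) d" using star dX XD by blast
    have "((\<lambda>p. \<phi> (prod.swap p)) ^^ k) d \<in> X"
    proof (induction k)
      case (Suc k)
      then have "prod.swap (((\<lambda>p. \<phi> (prod.swap p)) ^^ k) d) \<in> X" using sw XD by blast
      then show ?case using ph by simp
    qed (use dX in simp)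
    then show ?thesis using k by simp
  qed
  define P where "P u \<longleftrightarrow> (\<forall>d\<in>darts E. fst d = u \<longrightarrow> d \<in> X)" for u
  have edge: "P b" if "P a" "{a, b} \<in> E" for a b
  proof -
    have "(a, b) \<in> darts E" using that(2) unfolding darts_def by simp
    then have "(a, b) \<in> X" using that(1) unfolding P_def by simp
    then have "(b, a) \<in> X" using sw[of "(a, b)"] XD by auto
    then show ?thesis using all_at[of "(b, a)"] unfolding P_def by auto
  qed
  have up: "P v" if "P u" "u \<in> V" for u
    using that
  proof (induction "dep u" arbitrary: u rule: less_induct)
    case less
    show ?case
    proof (cases "u = v")
      case False
      then show ?thesis using par[OF less(3)] edge[of u "par u"] less(1)[of "par u"] less(2) by simp
    qed (use less in simp)
  qed
  obtain d where d: "d \<in> X" using ne by blast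
  then have "P (fst d)" using all_at unfolding P_def by metis
  then have Pv: "P v" using up darts_ends d XD by blast
  have "P u" if "u \<in> V" for u
    using that
  proof (induction "dep u" arbitrary: u rule: less_induct)
    case less
    show ?case
    proof (cases "u = v")
      case False
      then show ?thesis using par[OF less(2)] edge[of "par u" u] less(1)[of "par u"] by (simp add: insert_commute)
    qed (use Pv in simp)
  qed
  then have "d \<in> X" if "d \<in> darts E" for d using darts_ends[OF that] that unfolding P_def by blast
  then show ?thesis using XD by blast
qed

lemma card_tree_edges: "card tree_edges = card V - 1"
proof -
  have "inj_on (\<lambda>w. {w, par w}) (V - {v})"
  proof (rule inj_onI)
    fix a b assume ab: "a \<in> V - {v}" "b \<in> V - {v}" "{a, par a} = {b, par b}"
    show "a = b"
    proof (rule ccontr)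
      assume "a \<noteq> b"
      then have "a = par b" "b = par a" using ab(3) by (auto simp: doubleton_eq_iff)
      then show False using par[of a] par[of b] ab by auto
    qed
  qed
  then show ?thesis unfolding tree_edges_def using card_image root(1) finV by fastforce
qed

lemma same_ends: "{fst p, snd p} = {fst d, snd d} \<Longrightarrow> p = d \<or> p = prod.swap d"
  by (cases p; cases d) (auto simp: doubleton_eq_iff)

text \<open>The dual graph of the cotree has at most as many edges as a tree, hence each of them is a bridge.\<close>
lemma bridge:
  assumes e: "e \<in> darts E" "\<not> tree_dart e"
  obtains U where "U \<subseteq> darts E" "\<And>d. d \<in> darts E \<Longrightarrow> d \<in> U \<longleftrightarrow> \<phi> d \<in> U"
    "\<And>d. d \<in> darts E \<Longrightarrow> \<not> tree_dart d \<Longrightarrow> d \<noteq> e \<Longrightarrow> d \<noteq> prod.swap e \<Longrightarrow> d \<in> U \<longleftrightarrow> prod.swap d \<in> U"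
    "e \<notin> U" "prod.swap e \<in> U"
proof -
  have finE: "finite E"
  proof -
    have "E \<subseteq> Pow V" using edgeV by blast
    then show ?thesis using finV by (simp add: finite_subset)
  qed
  have TE: "tree_edges \<subseteq> E" using par unfolding tree_edges_def by blast
  define ee where "ee = {fst e, snd e}"
  have eeE: "ee \<in> E - tree_edges" using e unfolding ee_def tree_dart_def darts_def by auto
  define C where "C = E - tree_edges - {ee}"
  have "card C + 1 = card (E - tree_edges)" unfolding C_def using card_Suc_Diff1[of "E - tree_edges" ee] finE eeE by simp
  also have "\<dots> = card E - (card V - 1)" using card_Diff_subset[of tree_edges E] TE finE finite_subset card_tree_edges by metis
  finally have "card C + 1 = card E - (card V - 1)" .
  moreover have "card V \<noteq> 0" using root(1) finV by auto
  moreover have "card E \<noteq> 0" using nonempty finE by simp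
  \<comment> \<open>The cotree has \<open>card E - (card V - 1)\<close> edges; without
    \<open>ee\<close> there are at least two fewer than faces, by \<open>euler\<close>.\<close>
  ultimately have cC: "card C + 1 < card (F ` darts E)" using euler by linarith
  have "finite C" unfolding C_def using finE by simp
  then obtain cs where cs: "set cs = C" "length cs = card C" using finite_distinct_list distinct_card by metis
  define rep where "rep c = (SOME d. d \<in> darts E \<and> {fst d, snd d} = c)" for c
  have rep: "rep c \<in> darts E \<and> {fst (rep c), snd (rep c)} = c" if cE: "c \<in> E" for c
  proof -
    obtain a b where "c = {a, b}" using edgeV[OF cE] by blast
    then have "(a, b) \<in> darts E \<and> {fst (a, b), snd (a, b)} = c" using cE unfolding darts_def by simp
    then show ?thesis unfolding rep_def by (rule someI)
  qed
  define ps where "ps = map (\<lambda>c. (F (rep c), F (prod.swap (rep c)))) cs"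
  have "\<exists>W\<subseteq>F ` darts E. W \<noteq> {} \<and> W \<noteq> F ` darts E \<and> (\<forall>(a, b)\<in>set ps. a \<in> W \<longleftrightarrow> b \<in> W)"
  proof (rule nontrivial_closed_class)
    show "finite (F ` darts E)" using fin by simp
    show "length ps + 1 < card (F ` darts E)" using cC cs unfolding ps_def by simp
    have "rep c \<in> darts E" if "c \<in> C" for c using rep that unfolding C_def by blast
    then show "set ps \<subseteq> F ` darts E \<times> F ` darts E" unfolding ps_def cs[symmetric] using cs(1) by auto
  qed
  then obtain W where W: "W \<subseteq> F ` darts E" "W \<noteq> {}" "W \<noteq> F ` darts E"
      and W4: "\<forall>(a, b)\<in>set ps. a \<in> W \<longleftrightarrow> b \<in> W" by (elim exE conjE)
  define U where "U = {d \<in> darts E. F d \<in> W}"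
  have U1: "U \<subseteq> darts E" unfolding U_def by blast
  have U2: "d \<in> U \<longleftrightarrow> \<phi> d \<in> U" if "d \<in> darts E" for d
    using that F_phi[OF that] phi_in[OF that] unfolding U_def by simp
  have U3: "d \<in> U \<longleftrightarrow> prod.swap d \<in> U" if d: "d \<in> darts E" "\<not> tree_dart d" "d \<noteq> e" "d \<noteq> prod.swap e" for d
  proof -
    define c where "c = {fst d, snd d}"
    have "c \<noteq> ee" using d(3,4) unfolding c_def ee_def by (cases d; cases e) (auto simp: doubleton_eq_iff)
    moreover have "c \<in> E" using d(1) unfolding c_def darts_def by auto
    ultimately have c: "c \<in> C" using d(2) unfolding C_def c_def tree_dart_def by blast
    have "{fst (rep c), snd (rep c)} = {fst d, snd d}" using conjunct2[OF rep[OF \<open>c \<in> E\<close>]] c_def by simp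
    then have "rep c = d \<or> rep c = prod.swap d" by (rule same_ends)
    moreover have "(F (rep c), F (prod.swap (rep c))) \<in> set ps" using c unfolding ps_def cs(1)[symmetric] by simp
    from bspec[OF W4 this] have "F (rep c) \<in> W \<longleftrightarrow> F (prod.swap (rep c)) \<in> W" by simp
    ultimately have "F d \<in> W \<longleftrightarrow> F (prod.swap d) \<in> W" by auto
    then show ?thesis using d(1) unfolding U_def by simp
  qed
  \<comment> \<open>If \<open>e\<close> did not separate \<open>U\<close> from its complement,
    \<open>U\<close> would be closed under all moves and contain every dart, although it omits a
    face.\<close>
  have "\<not> (e \<in> U \<longleftrightarrow> prod.swap e \<in> U)"
  proof
    assume *: "e \<in> U \<longleftrightarrow> prod.swap e \<in> U"
    have cc: "cotree_closed U" unfolding cotree_closed_def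
    proof (intro conjI ballI impI)
      fix d assume "d \<in> darts E" "\<not> tree_dart d"
      then show "d \<in> U \<longleftrightarrow> prod.swap d \<in> U" using U3[of d] * by (cases "d = e \<or> d = prod.swap e") auto
    qed (rule U1)
    have ex: "exits U = {}" using U1 U2 unfolding exits_def by blast
    have "U \<noteq> {}" using W(1,2) unfolding U_def by auto
    then have "U = darts E"
      using swap_phi_closed_all[OF U1 no_exits_swap_closed[OF cc ex]] U1 U2 by blast
    then show False using W(1,3) unfolding U_def by blast
  qed
  then consider "e \<notin> U" "prod.swap e \<in> U" | "e \<in> U" "prod.swap e \<notin> U" by blast
  then show ?thesis
  proof cases
    case 1
    then show ?thesis using that[OF U1 U2 U3] by blast
  next
    case 2
    show ?thesis
    proof (rule that[of "darts E - U"])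
      show "d \<in> darts E - U \<longleftrightarrow> \<phi> d \<in> darts E - U" if "d \<in> darts E" for d
        using U2[OF that] phi_in[OF that] that by blast
      show "d \<in> darts E - U \<longleftrightarrow> prod.swap d \<in> darts E - U" if "d \<in> darts E" "\<not> tree_dart d" "d \<noteq> e" "d \<noteq> prod.swap e" for d
        using U3[OF that] that by simp
    qed (use 2 e in auto)
  qed
qed

text \<open>An admissible set consists of whole faces and at most one interval of one further face, and is bounded by
  tree edges.\<close>
definition admissible :: "('a \<times> 'a) set \<Rightarrow> bool" where
  "admissible X \<longleftrightarrow> cotree_closed X \<and> card (exits X) \<le> 1"

lemma card_le_1I: "finite A \<Longrightarrow> (\<And>a b. a \<in> A \<Longrightarrow> b \<in> A \<Longrightarrow> a = b) \<Longrightarrow> card A \<le> 1"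
  by (simp add: card_le_Suc0_iff_eq)

text \<open>If the exit dart, or in the absence of an exit some dart of \<open>X\<close>, belongs to
  a tree edge, it can be removed: only the dart before it becomes an exit. Otherwise the edge of the
  exit \<open>e\<close> is a bridge of the dual graph, and \<open>X\<close> falls apart into the
  parts on its two sides. Then \<open>e\<close> and its reverse are given up, and in each part only
  the dart before the lost one is an exit.\<close>

lemma admissible_shrink:
  assumes X: "admissible X" and ne: "X \<noteq> {}"
  obtains X1 X2 e e' where "admissible X1" "admissible X2" "X1 \<subset> X" "X2 \<subset> X" "X = X1 \<union> X2 \<union> {e, e'}"
proof -
  have cc: "cotree_closed X" and ex1: "card (exits X) \<le> 1" using X unfolding admissible_def by auto
  have XD: "X \<subseteq> darts E" using cc unfolding cotree_closed_def by blast
  have fX: "finite X" using finite_sub[OF XD] .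
  have fex: "finite (exits Y)" if "Y \<subseteq> X" for Y
    using finite_subset[OF that fX] unfolding exits_def by simp
  have uniq: "a = b" if "a \<in> exits X" "b \<in> exits X" for a b
    using ex1 fex[of X] that by (simp add: card_le_Suc0_iff_eq)
  show ?thesis
  proof (cases "\<exists>d\<in>X. tree_dart d \<and> (exits X = {} \<or> d \<in> exits X)")
    case True
    then obtain d where d: "d \<in> X" "tree_dart d" "exits X = {} \<or> d \<in> exits X" by blast
    have "cotree_closed (X - {d})"
      unfolding cotree_closed_def
    proof (intro conjI ballI impI)
      fix p assume p: "p \<in> darts E" "\<not> tree_dart p"
      then have "p \<noteq> d" "prod.swap p \<noteq> d" using d(2) by (metis, metis tree_dart_swap)
      then show "p \<in> X - {d} \<longleftrightarrow> prod.swap p \<in> X - {d}" using cc p unfolding cotree_closed_def by blast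
    qed (use XD in blast)
    moreover have "card (exits (X - {d})) \<le> 1"
    proof (rule card_le_1I[OF fex])
      have ph: "\<phi> a = d" if a: "a \<in> exits (X - {d})" for a
      proof (rule ccontr)
        assume "\<phi> a \<noteq> d"
        then have "a \<in> exits X" "a \<noteq> d" using a unfolding exits_def by auto
        then show False using d(3) uniq by blast
      qed
      fix a b assume ab: "a \<in> exits (X - {d})" "b \<in> exits (X - {d})"
      then have "a \<in> darts E" "b \<in> darts E" using XD unfolding exits_def by auto
      then show "a = b" using ph[OF ab(1)] ph[OF ab(2)] phi_inj by metis
    qed blast
    ultimately have "admissible (X - {d})" unfolding admissible_def by blast
    then show ?thesis using that[of "X - {d}" "X - {d}" d d] d(1) by blast
  next
    case False
    \<comment> \<open>A nonempty \<open>X\<close> without exits consists of all darts, so it would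
      contain a tree dart and belong to the first case.\<close>
    have exne: "exits X \<noteq> {}"
    proof
      assume ex: "exits X = {}"
      have "\<phi> d \<in> X" if "d \<in> X" for d using ex that unfolding exits_def by blast
      then have "X = darts E"
        using swap_phi_closed_all[OF XD no_exits_swap_closed[OF cc ex] _ ne] by blast
      have "\<exists>w\<in>V. w \<noteq> v"
      proof -
        obtain c where "c \<in> E" using nonempty by blast
        then show ?thesis using edgeV[of c] by metis
      qed
      then obtain w where w: "w \<in> V" "w \<noteq> v" by blast
      then have "(w, par w) \<in> X" using par[OF w] \<open>X = darts E\<close> unfolding darts_def by simp
      moreover have "tree_dart (w, par w)" using w unfolding tree_dart_def tree_edges_def by auto
      ultimately show False using False ex by blast
    qed
    then obtain e where e: "e \<in> exits X" by blast
    then have eX: "e \<in> X" "\<phi> e \<notin> X" "e \<in> darts E" using XD unfolding exits_def by auto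
    have nt: "\<not> tree_dart e" using False e eX by blast
    have seX: "prod.swap e \<in> X" using cc eX nt unfolding cotree_closed_def by blast
    obtain U where U: "U \<subseteq> darts E" "\<And>d. d \<in> darts E \<Longrightarrow> d \<in> U \<longleftrightarrow> \<phi> d \<in> U"
      "\<And>d. d \<in> darts E \<Longrightarrow> \<not> tree_dart d \<Longrightarrow> d \<noteq> e \<Longrightarrow> d \<noteq> prod.swap e \<Longrightarrow> d \<in> U \<longleftrightarrow> prod.swap d \<in> U"
      "e \<notin> U" "prod.swap e \<in> U" using bridge[OF eX(3) nt] by metis
    define X1 X2 where "X1 = X \<inter> U - {prod.swap e}" and "X2 = X - U - {e}"
    have sub: "X1 \<subseteq> X" "X2 \<subseteq> X" unfolding X1_def X2_def by blast+
    have closed: "(d \<in> X1 \<longleftrightarrow> prod.swap d \<in> X1) \<and> (d \<in> X2 \<longleftrightarrow> prod.swap d \<in> X2)" if d: "d \<in> darts E" "\<not> tree_dart d" for d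
    proof (cases "d = e \<or> d = prod.swap e")
      case True
      then show ?thesis using U(4,5) unfolding X1_def X2_def by auto
    next
      case ne: False
      then have "prod.swap d \<noteq> e" "prod.swap d \<noteq> prod.swap e" by (metis swap_swap)+
      moreover have "d \<in> X \<longleftrightarrow> prod.swap d \<in> X" using cc d unfolding cotree_closed_def by blast
      ultimately show ?thesis using U(3)[OF d] ne unfolding X1_def X2_def by blast
    qed
    have "card (exits X1) \<le> 1"
    proof (rule card_le_1I[OF fex[OF sub(1)]])
      have ph: "\<phi> a = prod.swap e" if a: "a \<in> exits X1" for a
      proof (rule ccontr)
        assume n: "\<phi> a \<noteq> prod.swap e"
        have "a \<in> X" "a \<in> U" "\<phi> a \<notin> X1" "a \<in> darts E" using a XD unfolding exits_def X1_def by auto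
        then have "\<phi> a \<in> U" using U(2) by blast
        then have "a \<in> exits X" using n \<open>\<phi> a \<notin> X1\<close> \<open>a \<in> X\<close> unfolding exits_def X1_def by blast
        then show False using uniq[OF _ e] U(4) \<open>a \<in> U\<close> by blast
      qed
      fix a b assume ab: "a \<in> exits X1" "b \<in> exits X1"
      then have "a \<in> darts E" "b \<in> darts E" using XD sub unfolding exits_def by auto
      then show "a = b" using ph[OF ab(1)] ph[OF ab(2)] phi_inj by metis
    qed
    moreover have "card (exits X2) \<le> 1"
    proof (rule card_le_1I[OF fex[OF sub(2)]])
      have ph: "\<phi> a = e" if a: "a \<in> exits X2" for a
      proof (rule ccontr)
        assume n: "\<phi> a \<noteq> e"
        have "a \<in> X" "a \<notin> U" "\<phi> a \<notin> X2" "a \<in> darts E" "a \<noteq> e" using a XD unfolding exits_def X2_def by auto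
        then have "\<phi> a \<notin> U" using U(2) by blast
        then have "a \<in> exits X" using n \<open>\<phi> a \<notin> X2\<close> \<open>a \<in> X\<close> unfolding exits_def X2_def by blast
        then show False using uniq[OF _ e] \<open>a \<noteq> e\<close> by blast
      qed
      fix a b assume ab: "a \<in> exits X2" "b \<in> exits X2"
      then have "a \<in> darts E" "b \<in> darts E" using XD sub unfolding exits_def by auto
      then show "a = b" using ph[OF ab(1)] ph[OF ab(2)] phi_inj by metis
    qed
    moreover have "cotree_closed X1" "cotree_closed X2"
      using closed sub XD unfolding cotree_closed_def by blast+
    ultimately have "admissible X1" "admissible X2" unfolding admissible_def by blast+
    moreover have "X1 \<subset> X" "X2 \<subset> X" using eX(1) U(4) sub unfolding X1_def X2_def by blast+
    moreover have "X = X1 \<union> X2 \<union> {e, prod.swap e}" using eX(1) seX unfolding X1_def X2_def by blast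
    ultimately show ?thesis by (rule that)
  qed
qed

text \<open>A minimal admissible set carrying a third of the vertices: it splits into two smaller ones.\<close>
theorem separator:
  assumes a: "\<And>u. u \<in> V \<Longrightarrow> a u \<in> darts E \<and> fst (a u) = u"
  obtains X x y where "X \<subseteq> darts E" "x \<in> V" "y \<in> V"
    "card V \<le> 3 * card {u \<in> V. a u \<in> X}" "3 * card {u \<in> V. a u \<in> X} \<le> 2 * card V + 6"
    "\<forall>d\<in>darts E. {fst d, snd d} \<inter> - (anc x \<union> anc y) \<noteq> {} \<longrightarrow> (d \<in> X \<longleftrightarrow> prod.swap d \<in> X)"
    "\<forall>d\<in>darts E. \<forall>d'\<in>darts E. fst d = fst d' \<longrightarrow> fst d \<notin> anc x \<union> anc y \<longrightarrow> (d \<in> X \<longleftrightarrow> d' \<in> X)"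
proof -
  define wt where "wt X = card {u \<in> V. a u \<in> X}" for X
  have all: "{u \<in> V. a u \<in> darts E} = V" using a by blast
  have "admissible (darts E)"
  proof -
    have "exits (darts E) = {}" using phi_in unfolding exits_def by blast
    then show ?thesis unfolding admissible_def cotree_closed_def by simp
  qed
  moreover have "card V \<le> 3 * wt (darts E)" unfolding wt_def all by simp
  ultimately obtain X where X: "admissible X" "card V \<le> 3 * wt X"
    and min: "\<And>Y. admissible Y \<Longrightarrow> card V \<le> 3 * wt Y \<Longrightarrow> card X \<le> card Y"
    using ex_has_least_nat[of "\<lambda>X. admissible X \<and> card V \<le> 3 * wt X" "darts E" card] by metis
  have cc: "cotree_closed X" and ex1: "card (exits X) \<le> 1" using X unfolding admissible_def by auto
  have XD: "X \<subseteq> darts E" using cc unfolding cotree_closed_def by blast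
  have fX: "finite X" using finite_sub[OF XD] .
  have Vpos: "card V > 0" using root(1) finV by (auto simp: card_gt_0_iff)
  have "X \<noteq> {}" using X(2) Vpos unfolding wt_def by auto
  then obtain X1 X2 e e' where sh: "admissible X1" "admissible X2" "X1 \<subset> X" "X2 \<subset> X" "X = X1 \<union> X2 \<union> {e, e'}"
    using admissible_shrink[OF X(1)] by metis
  have small: "3 * wt Y < card V" if "admissible Y" "Y \<subset> X" for Y
    using min[OF that(1)] psubset_card_mono[OF fX that(2)] by linarith
  \<comment> \<open>Every vertex is counted at one dart \<open>a u\<close> of its own, so the two
    lost darts cost at most two vertices; this is the origin of the 6 in the upper bound.\<close>
  have "wt X \<le> wt X1 + wt X2 + 2"
  proof -
    have "{u \<in> V. a u \<in> X} \<subseteq> {u \<in> V. a u \<in> X1} \<union> {u \<in> V. a u \<in> X2} \<union> {fst e, fst e'}"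
    proof
      fix u assume u: "u \<in> {u \<in> V. a u \<in> X}"
      then have "a u \<in> X1 \<union> X2 \<union> {e, e'}" "u = fst (a u)" using sh(5) a by auto
      then show "u \<in> {u \<in> V. a u \<in> X1} \<union> {u \<in> V. a u \<in> X2} \<union> {fst e, fst e'}" using u by auto
    qed
    then have "wt X \<le> card ({u \<in> V. a u \<in> X1} \<union> {u \<in> V. a u \<in> X2} \<union> {fst e, fst e'})"
      unfolding wt_def using finV by (intro card_mono) auto
    also have "\<dots> \<le> card ({u \<in> V. a u \<in> X1} \<union> {u \<in> V. a u \<in> X2}) + card {fst e, fst e'}" by (rule card_Un_le)
    also have "\<dots> \<le> wt X1 + wt X2 + 2"
      using card_Un_le[of "{u \<in> V. a u \<in> X1}" "{u \<in> V. a u \<in> X2}"] card_insert_le_m1[of 2 "{fst e'}" "fst e"]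
      unfolding wt_def by simp
    finally show ?thesis .
  qed
  then have up: "3 * wt X \<le> 2 * card V + 6"
    using small[OF sh(1,3)] small[OF sh(2,4)] by linarith
  have fe: "finite (exits X)" "finite (entries X)" using fX fin unfolding exits_def entries_def by auto
  have en1: "card (entries X) \<le> 1" using card_entries[OF XD] ex1 by simp
  \<comment> \<open>Without an exit or entry the default is the root, whose only ancestor is
    itself.\<close>
  define x where "x = (if exits X = {} then v else snd (SOME d. d \<in> exits X))"
  define y where "y = (if entries X = {} then v else snd (SOME d. d \<in> entries X))"
  have x: "snd d = x" if "d \<in> exits X" for d
  proof -
    have "(SOME d. d \<in> exits X) \<in> exits X" using that by (rule someI)
    then have "(SOME d. d \<in> exits X) = d" using ex1 fe(1) that by (simp add: card_le_Suc0_iff_eq)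
    then show ?thesis using that unfolding x_def by auto
  qed
  have y: "snd d = y" if "d \<in> entries X" for d
  proof -
    have "(SOME d. d \<in> entries X) \<in> entries X" using that by (rule someI)
    then have "(SOME d. d \<in> entries X) = d" using en1 fe(2) that by (simp add: card_le_Suc0_iff_eq)
    then show ?thesis using that unfolding y_def by auto
  qed
  have xV: "x \<in> V"
  proof (cases "exits X = {}")
    case False
    then obtain d where "d \<in> exits X" by blast
    then show ?thesis using x darts_ends XD unfolding exits_def by blast
  qed (use x_def root in simp)
  have yV: "y \<in> V"
  proof (cases "entries X = {}")
    case False
    then obtain d where "d \<in> entries X" by blast
    then show ?thesis using y darts_ends unfolding entries_def by blast
  qed (use y_def root in simp)
  have edge: "d \<in> X \<longleftrightarrow> prod.swap d \<in> X" if d: "d \<in> darts E" "{fst d, snd d} \<inter> - (anc x \<union> anc y) \<noteq> {}" for d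
  proof (rule ccontr)
    assume "\<not> (d \<in> X \<longleftrightarrow> prod.swap d \<in> X)"
    then obtain e where "e \<in> exits X \<union> entries X" "fst d \<in> anc (snd e)" "snd d \<in> anc (snd e)"
      using boundary_below[OF cc d(1)] by blast
    then show False using x y d(2) by blast
  qed
  \<comment> \<open>A rotation step first crosses an edge and then goes around a corner. The former
    changes sides only along the two tree paths, the latter only at \<open>x\<close> or
    \<open>y\<close>.\<close>
  have sig: "d \<in> X \<longleftrightarrow> \<phi> (prod.swap d) \<in> X" if d: "d \<in> darts E" "fst d \<notin> anc x \<union> anc y" for d
  proof -
    have "d \<in> X \<longleftrightarrow> prod.swap d \<in> X" by (rule edge) (use d in auto)
    moreover have "prod.swap d \<in> X \<longleftrightarrow> \<phi> (prod.swap d) \<in> X"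
    proof (rule ccontr)
      assume "\<not> ?thesis"
      then have "prod.swap d \<in> exits X \<union> entries X" using d(1) unfolding exits_def entries_def by auto
      then have "fst d = x \<or> fst d = y" using x[of "prod.swap d"] y[of "prod.swap d"] by auto
      then show False using d(2) by auto
    qed
    ultimately show ?thesis by blast
  qed
  have vert: "d \<in> X \<longleftrightarrow> d' \<in> X" if d: "d \<in> darts E" "d' \<in> darts E" "fst d = fst d'" "fst d \<notin> anc x \<union> anc y" for d d'
  proof -
    obtain k where k: "d' = ((\<lambda>p. \<phi> (prod.swap p)) ^^ k) d" using star d by blast
    let ?s = "\<lambda>k. ((\<lambda>p. \<phi> (prod.swap p)) ^^ k) d"
    have "?s k \<in> darts E \<and> fst (?s k) = fst d \<and> (?s k \<in> X \<longleftrightarrow> d \<in> X)"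
    proof (induction k)
      case (Suc k)
      then have "prod.swap (?s k) \<in> darts E" by simp
      then have "fst (?s (Suc k)) = fst (?s k)" "?s (Suc k) \<in> darts E" using fst_phi phi_in by simp_all
      moreover have "?s k \<in> X \<longleftrightarrow> ?s (Suc k) \<in> X" using sig[of "?s k"] Suc d(4) by simp
      ultimately show ?case using Suc by simp
    qed (use d in simp)
    then show ?thesis using k by simp
  qed
  have e': "\<forall>d\<in>darts E. {fst d, snd d} \<inter> - (anc x \<union> anc y) \<noteq> {} \<longrightarrow> (d \<in> X \<longleftrightarrow> prod.swap d \<in> X)"
    by (intro ballI impI edge)
  have v': "\<forall>d\<in>darts E. \<forall>d'\<in>darts E. fst d = fst d' \<longrightarrow> fst d \<notin> anc x \<union> anc y \<longrightarrow> (d \<in> X \<longleftrightarrow> d' \<in> X)"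
    by (intro ballI impI vert)
  show ?thesis
    by (rule that[OF XD xV yV _ _ e' v']) (use X(2) up in \<open>simp_all add: wt_def\<close>)
qed

end

section \<open>Containing the fire\<close>

text \<open>The protected sets omit burning vertices, and what burns depends on what was protected.
  Computing the burning set together with the targets secured so far breaks this circle.\<close>

primrec fire_sim :: "nat set \<Rightarrow> nat set set \<Rightarrow> nat \<Rightarrow> (nat \<Rightarrow> nat set) \<Rightarrow> nat \<Rightarrow> nat set \<times> nat set" where
  "fire_sim V E v P 0 = ({v}, {})"
| "fire_sim V E v P (Suc t) =
     (let B = fst (fire_sim V E v P t); Q = snd (fire_sim V E v P t) \<union> (P (Suc t) - B)
      in (B \<union> {w \<in> V. w \<notin> Q \<and> (\<exists>u\<in>B. {u, w} \<in> E)}, Q))"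

lemma protected_Suc: "protected S (Suc t) = protected S t \<union> S (Suc t)"
proof -
  have "{1..Suc t} = insert (Suc t) {1..t}" by auto
  then show ?thesis unfolding protected_def by auto
qed

text \<open>The targets \<open>P t\<close> may contain burning vertices; those are skipped, which is harmless because they lie in \<open>B\<close>.\<close>
lemma containment_strategy:
  assumes "v \<in> V" "finite V" and P: "\<And>t. P t \<subseteq> V" "\<And>t. card (P t) \<le> k"
    and B: "v \<in> B 0" "\<And>t. B t \<subseteq> B (Suc t)"
    and spread: "\<And>t u w. u \<in> B t \<Longrightarrow> w \<in> V \<Longrightarrow> {u, w} \<in> E \<Longrightarrow> w \<in> B (Suc t) \<or> (\<exists>s\<in>{1..Suc t}. w \<in> P s)"
  shows "\<exists>S. valid_strategy k V E v S \<and> (\<forall>t. burning V E v S t \<subseteq> B t)"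
proof -
  define S where "S t = P t - fst (fire_sim V E v P (t - 1))" for t
  have sim: "burning V E v S t = fst (fire_sim V E v P t) \<and> protected S t = snd (fire_sim V E v P t)" for t
  proof (induction t)
    case 0
    show ?case by (simp add: protected_def)
  next
    case (Suc t)
    then show ?case by (simp add: protected_Suc S_def Let_def)
  qed
  then have S: "S (Suc t) = P (Suc t) - burning V E v S t" for t by (simp add: S_def)
  have "card (S (Suc t)) \<le> k" for t
    using card_mono[of "P (Suc t)" "S (Suc t)"] P finite_subset[OF P(1) assms(2)] unfolding S by (meson Diff_subset le_trans)
  then have "valid_strategy k V E v S"
    unfolding valid_strategy_def using S P(1) by blast
  moreover have "\<forall>s\<le>t. burning V E v S s \<subseteq> B s" for t
  proof (induction t)
    case (Suc t)
    have mono: "B i \<subseteq> B j" if "i \<le> j" for i j using lift_Suc_mono_le[of B, OF B(2) that] .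
    have "w \<in> B (Suc t)" if w: "w \<in> burning V E v S (Suc t)" for w
    proof (cases "w \<in> burning V E v S t")
      case True
      then show ?thesis using Suc B(2) by blast
    next
      case False
      then obtain u where u: "w \<in> V" "w \<notin> protected S (Suc t)" "u \<in> burning V E v S t" "{u, w} \<in> E" using w by auto
      then have "u \<in> B t" using Suc by blast
      from spread[OF this u(1,4)] show ?thesis
      proof
        assume "\<exists>s\<in>{1..Suc t}. w \<in> P s"
        then obtain s where s: "s \<in> {1..Suc t}" "w \<in> P s" by blast
        then obtain r where r: "s = Suc r" "r \<le> t" by (cases s) auto
        \<comment> \<open>A target that was not protected in its turn was already burning by
          then.\<close>
        have "w \<notin> S s" using u(2) s(1) unfolding protected_def by blast
        then have "w \<in> burning V E v S r" using s(2) S[of r] r(1) by blast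
        then have "w \<in> B r" using Suc r(2) by blast
        then show ?thesis using mono[of r "Suc t"] r(2) by auto
      qed
    qed
    then show ?case using Suc by (auto simp: le_Suc_eq)
  qed (use B(1) in simp)
  ultimately show ?thesis by blast
qed

lemma sn_ge:
  assumes "finite V" "valid_strategy k V E v S"
  shows "card (saved V E v S) \<le> sn k V E v"
proof -
  have "{card (saved V E v S) | S. valid_strategy k V E v S} \<subseteq> {..card V}"
    using card_mono[OF assms(1)] unfolding saved_def by auto
  then have "finite {card (saved V E v S) | S. valid_strategy k V E v S}" using finite_subset by blast
  then show ?thesis unfolding sn_def by (rule Max_ge) (use assms(2) in blast)
qed

text \<open>The form in which lower bounds for \<open>sn\<close> are obtained: \<open>P\<close> is a
  schedule of targets, \<open>B t\<close> an upper estimate for the fire at time \<open>t\<close>,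
  and \<open>Z\<close> stays out of its reach.\<close>

lemma sn_containment:
  assumes "v \<in> V" "finite V" "\<And>t. P t \<subseteq> V" "\<And>t. card (P t) \<le> k" "v \<in> B 0" "\<And>t. B t \<subseteq> B (Suc t)"
    "\<And>t u w. u \<in> B t \<Longrightarrow> w \<in> V \<Longrightarrow> {u, w} \<in> E \<Longrightarrow> w \<in> B (Suc t) \<or> (\<exists>s\<in>{1..Suc t}. w \<in> P s)"
    and Z: "Z \<subseteq> V" "\<And>t. Z \<inter> B t = {}"
  shows "card Z \<le> sn k V E v"
proof -
  have "\<exists>S. valid_strategy k V E v S \<and> (\<forall>t. burning V E v S t \<subseteq> B t)"
    by (rule containment_strategy[where P = P]; fact assms)
  then obtain S where S: "valid_strategy k V E v S" "\<forall>t. burning V E v S t \<subseteq> B t" by blast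
  have "Z \<subseteq> saved V E v S" using S(2) Z unfolding saved_def by blast
  moreover have "finite (saved V E v S)" using assms(2) unfolding saved_def by simp
  ultimately show ?thesis using sn_ge[OF assms(2) S(1)] card_mono by (meson le_trans)
qed

text \<open>Turns additive constants into factors: \<open>card V \<le> sn k V E v + c\<close>
  becomes \<open>card V \<le> (c + 1) * sn k V E v\<close>.\<close>

lemma sn_pos:
  assumes "v \<in> V" "finite V" "2 \<le> card V" "1 \<le> k"
  shows "1 \<le> sn k V E v"
proof -
  obtain w where w: "w \<in> V" "w \<noteq> v"
  proof -
    have "V \<noteq> {v}" using assms(3) by auto
    then show ?thesis using that assms(1) by blast
  qed
  have "card {w} \<le> sn k V E v"
  proof (rule sn_containment[where P = "\<lambda>t. {w}" and B = "\<lambda>t. V - {w}"])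
    show "w' \<in> V - {w} \<or> (\<exists>s\<in>{1..Suc t}. w' \<in> {w})" if "w' \<in> V" for t w' using that by force
  qed (use assms w in auto)
  then show ?thesis by simp
qed

definition nbrs :: "'a set set \<Rightarrow> 'a \<Rightarrow> 'a set" where
  "nbrs E v = {w. {v, w} \<in> E}"

lemma (in rooted_map) anc_depth_unique:
  assumes "x \<in> V" "u \<in> anc x" "w \<in> anc x" "dep u = dep w"
  shows "u = w"
  using assms
proof (induction "dep x" arbitrary: x rule: less_induct)
  case less
  show ?case
  proof (cases "x = v")
    case True
    have "(par ^^ k) v = v" for k by (induction k) (use root in auto)
    then have "anc v = {v}" unfolding anc_def by auto
    then show ?thesis using less True by auto
  next
    case False
    note p = par[OF less(2) False]
    have lower: "dep z < dep x" if "z \<in> anc (par x)" for z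
      using anc_dep(2)[OF _ that] p by simp
    show ?thesis
    proof (cases "u = x \<or> w = x")
      case True
      then show ?thesis using lower[of u] lower[of w] anc_cases[OF less(3)] anc_cases[OF less(4)] less(5) by auto
    next
      case False
      then show ?thesis using less(1)[of "par x"] p anc_cases[OF less(3)] anc_cases[OF less(4)] less(5) by auto
    qed
  qed
qed

text \<open>Each tree path has at most one vertex of each depth. Two firefighters can therefore
  protect, at time \<open>t\<close>, all path vertices of depth \<open>t\<close>.\<close>

lemma (in rooted_map) card_level_anc:
  assumes "x \<in> V" "y \<in> V"
  shows "card {w \<in> anc x \<union> anc y. dep w = t} \<le> 2" "finite {w \<in> anc x \<union> anc y. dep w = t}"
proof -
  have one: "\<exists>z. {w \<in> anc x. dep w = t} \<subseteq> {z}" if "x \<in> V" for x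
    using anc_depth_unique[OF that] by (cases "\<exists>z\<in>anc x. dep z = t") blast+
  obtain z where z: "{w \<in> anc x. dep w = t} \<subseteq> {z}" using one[OF assms(1)] by blast
  obtain z' where z': "{w \<in> anc y. dep w = t} \<subseteq> {z'}" using one[OF assms(2)] by blast
  have sub: "{w \<in> anc x \<union> anc y. dep w = t} \<subseteq> {z, z'}" using z z' by blast
  then show "finite {w \<in> anc x \<union> anc y. dep w = t}" using finite_subset by blast
  have "card {w \<in> anc x \<union> anc y. dep w = t} \<le> card {z, z'}" using sub by (intro card_mono) auto
  also have "\<dots> \<le> 2" by (simp add: card_insert_if)
  finally show "card {w \<in> anc x \<union> anc y. dep w = t} \<le> 2" .
qed

text \<open>At time 1 at most two wall vertices and the root neighbours on one side need protection; the degree bound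
  makes this at most \<open>k\<close>.\<close>
lemma (in rooted_map) wall:
  assumes bfs: "\<And>a b. {a, b} \<in> E \<Longrightarrow> dep b \<le> Suc (dep a)" and k: "2 \<le> k" and deg: "card (nbrs E v) \<le> 2 * k - 1"
  obtains Z P where "Z \<subseteq> V - {v}" "card V \<le> 3 * card Z + 9" "\<And>t. P t \<subseteq> V" "\<And>t. card (P t) \<le> k"
    "\<And>u w. u \<in> V - Z \<Longrightarrow> {u, w} \<in> E \<Longrightarrow> w \<in> Z \<Longrightarrow> \<exists>s\<ge>1. s \<le> Suc (dep u) \<and> w \<in> P s"
proof -
  have nbr: "nbrs E u \<subseteq> V" for u unfolding nbrs_def using edgeV by (fastforce simp: doubleton_eq_iff)
  define a where "a u = (SOME d. d \<in> darts E \<and> fst d = u)" for u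
  have a: "a u \<in> darts E \<and> fst (a u) = u" if u: "u \<in> V" for u
  proof -
    have "\<exists>d. d \<in> darts E \<and> fst d = u"
    proof (cases "u = v")
      case False
      then have "(u, par u) \<in> darts E" using par[OF u] unfolding darts_def by simp
      then show ?thesis by force
    next
      case True
      obtain c where "c \<in> E" using nonempty by blast
      then obtain z where "z \<in> V" "z \<noteq> v" using edgeV[of c] by metis
      \<comment> \<open>Climbing from any other vertex ends at a child of the root.\<close>
      then have "\<exists>y. {v, y} \<in> E"
      proof (induction "dep z" arbitrary: z rule: less_induct)
        case less
        show ?case
        proof (cases "par z = v")
          case True
          then show ?thesis using par[OF less(2,3)] by (metis insert_commute)
        qed (use less(1)[of "par z"] par[OF less(2,3)] in auto)
      qed
      then obtain y where "(v, y) \<in> darts E" unfolding darts_def by auto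
      then show ?thesis using True by force
    qed
    then show ?thesis unfolding a_def by (rule someI_ex)
  qed
  obtain X x y where X: "X \<subseteq> darts E" "x \<in> V" "y \<in> V"
    "card V \<le> 3 * card {u \<in> V. a u \<in> X}" "3 * card {u \<in> V. a u \<in> X} \<le> 2 * card V + 6"
    and edge: "\<forall>d\<in>darts E. {fst d, snd d} \<inter> - (anc x \<union> anc y) \<noteq> {} \<longrightarrow> (d \<in> X \<longleftrightarrow> prod.swap d \<in> X)"
    and vert: "\<forall>d\<in>darts E. \<forall>d'\<in>darts E. fst d = fst d' \<longrightarrow> fst d \<notin> anc x \<union> anc y \<longrightarrow> (d \<in> X \<longleftrightarrow> d' \<in> X)"
    by (rule separator[of a, OF a])
  define W where "W = anc x \<union> anc y"
  have WV: "W \<subseteq> V" using anc_dep(1) X(2,3) unfolding W_def by blast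
  have depv: "dep u = 0 \<longleftrightarrow> u = v" if "u \<in> V" for u using par[OF that] root by (cases "u = v") auto
  define L where "L t = {w \<in> W. dep w = t}" for t
  have L: "card (L t) \<le> 2" "finite (L t)" for t using card_level_anc[OF X(2,3)] unfolding L_def W_def by auto
  define side where "side b = {u \<in> V - W - {v}. (a u \<in> X) = b}" for b
  have finN: "finite (nbrs E v)" using nbr finV finite_subset by blast
  have L1: "L 1 \<subseteq> nbrs E v"
  proof
    fix u assume u: "u \<in> L 1"
    then have uV: "u \<in> V" "u \<noteq> v" "dep u = 1" using WV root(3) unfolding L_def by auto
    then have "dep (par u) = 0" "par u \<in> V" using par[OF uV(1,2)] by auto
    then have "par u = v" using depv by blast
    then show "u \<in> nbrs E v" using par[OF uV(1,2)] unfolding nbrs_def by (simp add: insert_commute)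
  qed
  have "card (L 1) + card (nbrs E v \<inter> side True) + card (nbrs E v \<inter> side False) \<le> card (nbrs E v)"
  proof -
    have "card (L 1) + card (nbrs E v \<inter> side True) + card (nbrs E v \<inter> side False)
       = card (L 1 \<union> (nbrs E v \<inter> side True) \<union> (nbrs E v \<inter> side False))"
      using finN L(2) by (subst card_Un_disjoint; (subst card_Un_disjoint)?) (auto simp: side_def L_def)
    also have "\<dots> \<le> card (nbrs E v)" using finN L1 by (intro card_mono) auto
    finally show ?thesis .
  qed
  \<comment> \<open>The two sums add up to at most \<open>2 * k - 1 + card (L 1)\<close>, which is
    at most \<open>2 * k + 1\<close>, so one of them is at most \<open>k\<close>.\<close>
  then have "card (L 1) + card (nbrs E v \<inter> side True) \<le> k \<or> card (L 1) + card (nbrs E v \<inter> side False) \<le> k"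
    using deg L(1)[of 1] k by linarith
  then have "\<exists>b. card (L 1) + card (nbrs E v \<inter> side b) \<le> k" by blast
  then obtain b where b: "card (L 1) + card (nbrs E v \<inter> side b) \<le> k" by blast
  define Z where "Z = (W - {v}) \<union> side b"
  define P where "P t = (if t = 0 then {} else if t = 1 then L 1 \<union> (nbrs E v \<inter> side b) else L t)" for t
  show ?thesis
  proof (rule that[of Z P])
    show "Z \<subseteq> V - {v}" using WV unfolding Z_def side_def by blast
    have finZ: "finite Z" using WV finV unfolding Z_def side_def by (auto intro: finite_subset)
    have sub: "{u \<in> V. (a u \<in> X) = b} \<subseteq> insert v Z" unfolding Z_def side_def by blast
    have "card {u \<in> V. (a u \<in> X) = b} \<le> card Z + 1"
      using card_mono[OF _ sub] finZ card_insert_le_m1[of "card Z + 1" Z v] by simp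
    \<comment> \<open>\<open>X\<close> carries between one and two thirds of the vertices, up to a
      constant, so either side is large enough. The root, which is not in \<open>Z\<close>, raises
      the constant from 6 to 9.\<close>
    moreover have "card V \<le> 3 * card {u \<in> V. (a u \<in> X) = b} + 6"
    proof (cases b)
      case True
      then show ?thesis using X(4) by simp
    next
      case False
      have "{u \<in> V. (a u \<in> X) = b} = V - {u \<in> V. a u \<in> X}" using False by auto
      then have "card {u \<in> V. (a u \<in> X) = b} = card V - card {u \<in> V. a u \<in> X}"
        using finV by (simp add: card_Diff_subset)
      then show ?thesis using X(5) by linarith
    qed
    ultimately show "card V \<le> 3 * card Z + 9" by linarith
    show "P t \<subseteq> V" for t using WV nbr unfolding P_def L_def by auto
    show "card (P t) \<le> k" for t
    proof -
      have "card (L 1 \<union> (nbrs E v \<inter> side b)) \<le> k" using card_Un_le b le_trans by blast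
      then show ?thesis using L(1)[of t] k unfolding P_def by simp
    qed
    fix u w assume u: "u \<in> V - Z" "{u, w} \<in> E" "w \<in> Z"
    have wV: "w \<in> V" "w \<noteq> v" using u(3) WV unfolding Z_def side_def by auto
    \<comment> \<open>The fire cannot be at \<open>u\<close> before time \<open>dep u\<close>, so
      protecting a path vertex \<open>w\<close> at time \<open>dep w\<close> is early
      enough.\<close>
    then have dw: "dep w \<ge> 1" "dep w \<le> Suc (dep u)" using depv bfs[OF u(2)] by (auto simp: Suc_le_eq)
    show "\<exists>s\<ge>1. s \<le> Suc (dep u) \<and> w \<in> P s"
    proof (cases "w \<in> W")
      case True
      then have "w \<in> L (dep w)" unfolding L_def by simp
      then show ?thesis using dw unfolding P_def by (intro exI[of _ "dep w"]) auto
    next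
      case False
      then have ws: "w \<in> side b" using u(3) unfolding Z_def by blast
      show ?thesis
      proof (cases "u = v")
        case True
        then have "w \<in> nbrs E v" using u(2) unfolding nbrs_def by simp
        then show ?thesis using ws unfolding P_def by (intro exI[of _ 1]) auto
      next
        case uv: False
        \<comment> \<open>Neither \<open>u\<close> nor \<open>w\<close> is on the tree paths, so the
          edge between them stays on one side, and \<open>u\<close> would belong to
          \<open>Z\<close>.\<close>
        then have uW: "u \<notin> W" "u \<in> V" using u(1) unfolding Z_def by auto
        have d: "(w, u) \<in> darts E" "(u, w) \<in> darts E" using u(2) unfolding darts_def by (auto simp: insert_commute)
        have "(w, u) \<in> X \<longleftrightarrow> (u, w) \<in> X" using edge[rule_format, OF d(1)] False unfolding W_def by auto
        moreover have "(w, u) \<in> X \<longleftrightarrow> a w \<in> X" using vert[rule_format, OF d(1), of "a w"] a[OF wV(1)] False unfolding W_def by auto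
        moreover have "(u, w) \<in> X \<longleftrightarrow> a u \<in> X" using vert[rule_format, OF d(2), of "a u"] a[OF uW(2)] uW(1) unfolding W_def by auto
        ultimately have "u \<in> side b" using ws uW uv unfolding side_def by auto
        then show ?thesis using u(1) unfolding Z_def by blast
      qed
    qed
  qed
qed

section \<open>Flat parts of the map\<close>

text \<open>Only the component \<open>C\<close> of \<open>v\<close> can burn; there
  \<open>wall\<close> is applied with breadth first distances, and the vertices outside
  \<open>C\<close> are saved anyway. The constant 12 is 3 + 9, by \<open>sn_pos\<close>.\<close>

theorem planar_low_degree:
  assumes g: "simple_graph V E" "planar V E" and v: "v \<in> V" and k: "2 \<le> k"
    and deg: "card (nbrs E v) \<le> 2 * k - 1" and V2: "2 \<le> card V"
  shows "card V \<le> 12 * sn k V E v"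
proof -
  note simple = simple_graphD[OF g(1)]
  have pos: "1 \<le> sn k V E v" using sn_pos[OF v simple(1) V2] k by simp
  define adj where "adj = {(a, b). {a, b} \<in> E}"
  define C where "C = adj\<^sup>* `` {v}"
  define EC where "EC = {e \<in> E. e \<subseteq> C}"
  have vC: "v \<in> C" unfolding C_def by simp
  have step: "b \<in> C" if "a \<in> C" "{a, b} \<in> E" for a b
    using that unfolding C_def adj_def by (auto intro: rtrancl_into_rtrancl)
  have CV: "C \<subseteq> V"
  proof
    fix u assume "u \<in> C"
    then have "(v, u) \<in> adj\<^sup>*" unfolding C_def by simp
    then show "u \<in> V"
    proof (induction rule: rtrancl_induct)
      case (step a b)
      then show ?case using simple(4)[of "{a, b}"] unfolding adj_def by simp
    qed (rule v)
  qed
  have finC: "finite C" using CV simple(1) by (rule finite_subset)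
  have EC: "{a, b} \<in> EC" if "a \<in> C" "{a, b} \<in> E" for a b using step[OF that] that unfolding EC_def by simp
  obtain Z P B where Z: "Z \<subseteq> C - {v}" "card C \<le> 3 * card Z + 9"
    and P: "\<And>t. P t \<subseteq> C" "\<And>t. card (P t) \<le> k"
    and B: "v \<in> B 0" "\<And>t. B t \<subseteq> B (Suc t)" "\<And>t. B t \<subseteq> C - Z"
    and spread: "\<forall>t. \<forall>u\<in>B t. \<forall>w. {u, w} \<in> E \<longrightarrow> w \<in> B (Suc t) \<or> (\<exists>s\<in>{1..Suc t}. w \<in> P s)"
  proof (cases "EC = {}")
    case True
    \<comment> \<open>An isolated origin is treated by itself, since a \<open>rooted_map\<close> has
      at least one edge.\<close>
    have iso: "{v, w} \<notin> E" for w using True EC[OF vC] by blast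
    show ?thesis
    proof (rule that[of "C - {v}" "\<lambda>t. {}" "\<lambda>t. {v}"])
      have "card C \<le> card (C - {v}) + 1" using finC vC by (simp add: card_Suc_Diff1)
      then show "card C \<le> 3 * card (C - {v}) + 9" by linarith
    qed (use iso vC in auto)
  next
    case False
    define dep where "dep u = (LEAST n. (v, u) \<in> adj ^^ n)" for u
    have dep: "(v, u) \<in> adj ^^ dep u" if u: "u \<in> C" for u
    proof -
      have "\<exists>n. (v, u) \<in> adj ^^ n" using u unfolding C_def by (simp add: rtrancl_power)
      then show ?thesis unfolding dep_def by (rule LeastI_ex)
    qed
    have dep_le: "dep u \<le> n" if "(v, u) \<in> adj ^^ n" for u n
      using that unfolding dep_def by (rule Least_le)
    have bfs: "dep b \<le> Suc (dep a)" if "a \<in> C" "{a, b} \<in> E" for a b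
    proof (rule dep_le)
      have "(a, b) \<in> adj" using that(2) unfolding adj_def by simp
      then show "(v, b) \<in> adj ^^ Suc (dep a)" using dep[OF that(1)] by auto
    qed
    have dep0: "dep v = 0" using dep_le[of v 0] by simp
    define par where "par u = (if u = v then v else SOME p. p \<in> C \<and> {u, p} \<in> E \<and> dep u = Suc (dep p))" for u
    have par: "par u \<in> C \<and> {u, par u} \<in> E \<and> dep u = Suc (dep (par u))" if u: "u \<in> C" "u \<noteq> v" for u
    proof -
      have "dep u \<noteq> 0"
      proof
        assume "dep u = 0"
        then show False using dep[OF u(1)] u(2) by simp
      qed
      then obtain m where m: "dep u = Suc m" by (cases "dep u") auto
      have "(v, u) \<in> adj ^^ Suc m" using dep[OF u(1)] unfolding m .
      then obtain p where p: "(v, p) \<in> adj ^^ m" "(p, u) \<in> adj" by auto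
      have pC: "p \<in> C" using p(1) unfolding C_def by (auto dest: relpow_imp_rtrancl)
      have e: "{p, u} \<in> E" using p(2) unfolding adj_def by simp
      have "dep u = Suc (dep p)" using dep_le[OF p(1)] bfs[OF pC e] m by simp
      then have "\<exists>p. p \<in> C \<and> {u, p} \<in> E \<and> dep u = Suc (dep p)" using pC e by (auto simp: insert_commute)
      then have "(SOME p. p \<in> C \<and> {u, p} \<in> E \<and> dep u = Suc (dep p)) \<in> C \<and>
          {u, SOME p. p \<in> C \<and> {u, p} \<in> E \<and> dep u = Suc (dep p)} \<in> E \<and>
          dep u = Suc (dep (SOME p. p \<in> C \<and> {u, p} \<in> E \<and> dep u = Suc (dep p)))" by (rule someI_ex)
      then show ?thesis using u(2) unfolding par_def by simp
    qed
    have sgC: "simple_graph C EC" using finC g(1) unfolding simple_graph_def EC_def by fastforce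
    have "planar C EC" by (rule planar_subgraph[OF g(2) CV]) (auto simp: EC_def)
    then obtain Fs where Fs: "facial EC Fs" "card EC + 2 \<le> card C + size Fs"
      using planar_facial[OF sgC] vC False by blast
    obtain \<phi> F where sm: "sphere_map EC \<phi> F" "card (F ` darts EC) = size Fs"
      using facial_sphere_map[OF Fs(1)] by blast
    interpret rooted_map EC \<phi> F C v par dep
    proof (rule rooted_map.intro[OF sm(1)], unfold_locales)
      show "par v = v" unfolding par_def by simp
      show "par w \<in> C \<and> {w, par w} \<in> EC \<and> dep w = Suc (dep (par w))" if "w \<in> C" "w \<noteq> v" for w
        using par[OF that] EC[OF that(1)] by blast
      show "card EC + 2 \<le> card C + card (F ` darts EC)" using Fs(2) sm(2) by simp
      show "\<exists>a b. e = {a, b} \<and> a \<noteq> b \<and> a \<in> C \<and> b \<in> C" if "e \<in> EC" for e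
        using simple_graphD(2)[OF sgC that] .
    qed (use finC vC dep0 False in auto)
    have "nbrs EC v = nbrs E v" using EC[OF vC] unfolding nbrs_def EC_def by blast
    then have deg': "card (nbrs EC v) \<le> 2 * k - 1" using deg by simp
    have bfs': "dep b \<le> Suc (dep a)" if "{a, b} \<in> EC" for a b using bfs[of a b] that unfolding EC_def by simp
    from wall[OF bfs' k deg']
    obtain Z P where ZP: "Z \<subseteq> C - {v}" "card C \<le> 3 * card Z + 9" "\<And>t. P t \<subseteq> C" "\<And>t. card (P t) \<le> k"
      "\<And>u w. u \<in> C - Z \<Longrightarrow> {u, w} \<in> EC \<Longrightarrow> w \<in> Z \<Longrightarrow> \<exists>s\<ge>1. s \<le> Suc (dep u) \<and> w \<in> P s" by metis
    show ?thesis
    proof (rule that[of Z P "\<lambda>t. {u \<in> C - Z. dep u \<le> t}"])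
      show "\<forall>t. \<forall>u\<in>{u \<in> C - Z. dep u \<le> t}. \<forall>w. {u, w} \<in> E \<longrightarrow> w \<in> {u \<in> C - Z. dep u \<le> Suc t} \<or> (\<exists>s\<in>{1..Suc t}. w \<in> P s)"
      proof (intro allI ballI impI)
        fix t u w assume u: "u \<in> {u \<in> C - Z. dep u \<le> t}" and e: "{u, w} \<in> E"
        then have uC: "u \<in> C" "u \<notin> Z" "dep u \<le> t" by auto
        have wC: "w \<in> C" "dep w \<le> Suc t" using step[OF uC(1) e] bfs[OF uC(1) e] uC(3) by auto
        show "w \<in> {u \<in> C - Z. dep u \<le> Suc t} \<or> (\<exists>s\<in>{1..Suc t}. w \<in> P s)"
        proof (cases "w \<in> Z")
          case True
          obtain s where "s \<ge> 1" "s \<le> Suc (dep u)" "w \<in> P s" using ZP(5)[of u w] uC EC[OF uC(1) e] True by blast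
          then show ?thesis using uC(3) by (intro disjI2 bexI[of _ s]) auto
        qed (use wC in simp)
      qed
    qed (use ZP(1-4) vC dep0 in auto)
  qed
  let ?Z = "Z \<union> (V - C)"
  have "card ?Z \<le> sn k V E v"
  proof (rule sn_containment[where P = P and B = B])
    show "w \<in> B (Suc t) \<or> (\<exists>s\<in>{1..Suc t}. w \<in> P s)" if "u \<in> B t" "w \<in> V" "{u, w} \<in> E" for t u w
      using spread that by blast
    show "?Z \<inter> B t = {}" for t using B(3)[of t] by blast
    show "P t \<subseteq> V" for t using P(1)[of t] CV by blast
    show "?Z \<subseteq> V" using Z(1) CV by blast
  qed (rule v simple(1) P(2) B(1,2))+
  moreover have "card ?Z = card Z + (card V - card C)"
  proof -
    have "Z \<inter> (V - C) = {}" "finite Z" using Z(1) finC by (auto intro: finite_subset)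
    then show ?thesis using simple(1) CV finC by (simp add: card_Un_disjoint card_Diff_subset)
  qed
  moreover have "card C \<le> card V" using CV simple(1) by (rule card_mono[rotated])
  ultimately show ?thesis using Z(2) pos by linarith
qed

section \<open>Degrees, rotations and grid coordinates\<close>

lemma sum_card_nbrs:
  assumes "simple_graph V E"
  shows "(\<Sum>u\<in>V. card (nbrs E u)) = 2 * card E" "card (darts E) = 2 * card E"
    "card {d \<in> darts E. Q (fst d)} = (\<Sum>u\<in>{u\<in>V. Q u}. card (nbrs E u))"
proof -
  note simple = simple_graphD[OF assms]
  show c: "card (darts E) = 2 * card E" using card_darts[of E] simple by blast
  have fin: "finite (darts E)" using card_darts[of E] simple by blast
  have nV: "nbrs E u \<subseteq> V" for u unfolding nbrs_def using simple(4) by blast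
  have q: "card {d \<in> darts E. Q (fst d)} = (\<Sum>u\<in>{u\<in>V. Q u}. card (nbrs E u))" for Q
  proof -
    have "{d \<in> darts E. Q (fst d)} = (SIGMA u:{u\<in>V. Q u}. nbrs E u)"
      using simple(4) unfolding darts_def nbrs_def by auto
    moreover have "finite (nbrs E u)" for u using nV simple(1) by (rule finite_subset)
    ultimately show ?thesis using simple(1) by (simp add: card_SigmaI)
  qed
  then show "card {d \<in> darts E. Q (fst d)} = (\<Sum>u\<in>{u\<in>V. Q u}. card (nbrs E u))" .
  show "(\<Sum>u\<in>V. card (nbrs E u)) = 2 * card E" using q[of "\<lambda>_. True"] c by simp
qed

context sphere_map
begin

text \<open>The rotation: the next dart with the same source.\<close>

definition \<sigma> :: "'a \<times> 'a \<Rightarrow> 'a \<times> 'a" where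
  "\<sigma> d = \<phi> (prod.swap d)"

lemma phi_darts [simp]: "d \<in> darts E \<Longrightarrow> \<phi> d \<in> darts E"
  using bij unfolding bij_betw_def by blast

lemma sigma_darts [simp]: "d \<in> darts E \<Longrightarrow> \<sigma> d \<in> darts E"
  unfolding \<sigma>_def by simp

lemma fst_sigma [simp]: "d \<in> darts E \<Longrightarrow> fst (\<sigma> d) = fst d"
  unfolding \<sigma>_def using fst_phi[of "prod.swap d"] by simp

lemma sigma_swap: "\<sigma> (prod.swap d) = \<phi> d"
  by (simp add: \<sigma>_def)

lemma sigma_inj: "inj_on \<sigma> (darts E)"
proof (rule inj_onI)
  fix x y assume xy: "x \<in> darts E" "y \<in> darts E" "\<sigma> x = \<sigma> y"
  then have "prod.swap x = prod.swap y"
    using bij inj_onD[of \<phi> "darts E" "prod.swap x" "prod.swap y"] unfolding \<sigma>_def bij_betw_def by simp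
  then show "x = y" by (metis swap_swap)
qed

lemma finite_nbrs: "finite (nbrs E u)"
proof -
  have "nbrs E u \<subseteq> snd ` darts E" unfolding nbrs_def darts_def by force
  then show ?thesis using fin finite_subset by blast
qed

lemma sigma_pow_darts: "d \<in> darts E \<Longrightarrow> (\<sigma> ^^ k) d \<in> darts E \<and> fst ((\<sigma> ^^ k) d) = fst d"
  by (induction k) auto

lemma sigma_pow_cancel: "d \<in> darts E \<Longrightarrow> (\<sigma> ^^ i) d = (\<sigma> ^^ (i + r)) d \<Longrightarrow> (\<sigma> ^^ r) d = d"
proof (induction i)
  case (Suc i)
  have "\<sigma> ((\<sigma> ^^ i) d) = \<sigma> ((\<sigma> ^^ (i + r)) d)" using Suc(3) by simp
  then have "(\<sigma> ^^ i) d = (\<sigma> ^^ (i + r)) d" using sigma_inj sigma_pow_darts[OF Suc(2)] unfolding inj_on_def by blast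
  then show ?case using Suc by blast
qed simp

text \<open>By \<open>star\<close> the orbit of \<open>d\<close> under the injective map
  \<open>\<sigma>\<close> consists of all darts with the same source, so its period is the
  degree.\<close>

lemma sigma_order:
  assumes d: "d \<in> darts E"
  shows "(\<sigma> ^^ card (nbrs E (fst d))) d = d" "nbrs E (fst d) = (\<lambda>k. snd ((\<sigma> ^^ k) d)) ` {..<card (nbrs E (fst d))}"
proof -
  define A where "A = {d' \<in> darts E. fst d' = fst d}"
  define n where "n = card (nbrs E (fst d))"
  have Aeq: "A = (\<lambda>w. (fst d, w)) ` nbrs E (fst d)" unfolding A_def darts_def nbrs_def by auto
  then have cA: "card A = n" "finite A" unfolding n_def using finite_nbrs by (auto simp: card_image inj_on_def)
  have pow: "\<exists>k. d' = (\<sigma> ^^ k) d" if "d' \<in> A" for d'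
    using star[OF d, of d'] that unfolding A_def \<sigma>_def by auto
  \<comment> \<open>A shorter period would make the orbit too small to contain all darts at the
    source.\<close>
  have noper: "(\<sigma> ^^ r) d \<noteq> d" if r: "0 < r" "r < n" for r
  proof
    assume per: "(\<sigma> ^^ r) d = d"
    have "A \<subseteq> (\<lambda>k. (\<sigma> ^^ k) d) ` {..<r}"
    proof
      fix d' assume "d' \<in> A"
      then obtain k where "d' = (\<sigma> ^^ k) d" using pow by blast
      then have "d' = (\<sigma> ^^ (k mod r)) d" using funpow_mod_eq[OF per] by simp
      then show "d' \<in> (\<lambda>k. (\<sigma> ^^ k) d) ` {..<r}" using r(1) by simp
    qed
    then have "card A \<le> card ((\<lambda>k. (\<sigma> ^^ k) d) ` {..<r})" by (intro card_mono) auto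
    also have "\<dots> \<le> r" using card_image_le[of "{..<r}"] by simp
    finally show False using cA r by simp
  qed
  have "inj_on (\<lambda>k. (\<sigma> ^^ k) d) {..<n}"
  proof (rule linorder_inj_onI)
    fix i j assume ij: "i < j" "i \<in> {..<n}" "j \<in> {..<n}"
    show "(\<sigma> ^^ i) d \<noteq> (\<sigma> ^^ j) d"
    proof
      assume "(\<sigma> ^^ i) d = (\<sigma> ^^ j) d"
      then have "(\<sigma> ^^ (j - i)) d = d" using sigma_pow_cancel[OF d, of i "j - i"] ij(1) by simp
      moreover have "j - i < n" "0 < j - i" using ij by (auto intro: less_imp_diff_less)
      ultimately show False using noper by blast
    qed
  qed auto
  then have "card ((\<lambda>k. (\<sigma> ^^ k) d) ` {..<n}) = card A" using cA by (simp add: card_image)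
  moreover have "(\<lambda>k. (\<sigma> ^^ k) d) ` {..<n} \<subseteq> A" using sigma_pow_darts[OF d] unfolding A_def by auto
  ultimately have img: "(\<lambda>k. (\<sigma> ^^ k) d) ` {..<n} = A" using cA(2) by (intro card_subset_eq)
  show "nbrs E (fst d) = (\<lambda>k. snd ((\<sigma> ^^ k) d)) ` {..<card (nbrs E (fst d))}"
  proof -
    have "snd ` A = nbrs E (fst d)" unfolding Aeq by (simp add: image_image)
    then show ?thesis unfolding img[symmetric] n_def by (simp add: image_image)
  qed
  have "(\<sigma> ^^ n) d \<in> A" using sigma_pow_darts[OF d] unfolding A_def by simp
  then obtain i where i: "i < n" "(\<sigma> ^^ i) d = (\<sigma> ^^ n) d" unfolding img[symmetric] by auto
  then have "(\<sigma> ^^ (n - i)) d = d" using sigma_pow_cancel[OF d, of i "n - i"] by simp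
  then have "i = 0" using noper[of "n - i"] i by (cases "i = 0") auto
  then show "(\<sigma> ^^ card (nbrs E (fst d))) d = d" using i(2) unfolding n_def by simp
qed

definition flat :: "'a \<times> 'a \<Rightarrow> bool" where
  "flat d \<longleftrightarrow> d \<in> darts E \<and> card (nbrs E (fst d)) = 4 \<and> length (F d) = 4"

text \<open>Think of \<open>d\<close> as pointing east and of \<open>\<sigma>\<close> as a quarter
  turn to the left at a vertex of degree 4. Then \<open>east d\<close> continues straight on from
  the end of \<open>d\<close>, and \<open>north d\<close> points east again from the end of
  \<open>\<sigma> d\<close>.\<close>

definition east :: "'a \<times> 'a \<Rightarrow> 'a \<times> 'a" where
  "east d = \<sigma> (\<sigma> (prod.swap d))"

definition north :: "'a \<times> 'a \<Rightarrow> 'a \<times> 'a" where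
  "north d = \<sigma> (prod.swap (\<sigma> d))"

definition cell :: "'a \<times> 'a \<Rightarrow> nat \<Rightarrow> nat \<Rightarrow> 'a \<times> 'a" where
  "cell d i j = (north ^^ j) ((east ^^ i) d)"

lemma sigma4: "d \<in> darts E \<Longrightarrow> card (nbrs E (fst d)) = 4 \<Longrightarrow> \<sigma> (\<sigma> (\<sigma> (\<sigma> d))) = d"
  using sigma_order(1)[of d] by (simp add: numeral_eq_Suc)

text \<open>Going around a quadrilateral face with vertices of degree 4.\<close>
lemma east_north:
  assumes "flat d" "flat (prod.swap d)" "flat (\<sigma> d)"
  shows "east (north d) = north (east d)"
proof -
  have d: "d \<in> darts E" using assms(1) unfolding flat_def by simp
  \<comment> \<open>\<open>z\<close> points north from the end of \<open>d\<close>. The face north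
    of \<open>d\<close> runs along \<open>prod.swap z\<close>, \<open>prod.swap d\<close>,
    \<open>\<sigma> d\<close> and \<open>north d\<close>, and having length 4 it closes up
    there.\<close>
  define z where "z = \<sigma> (\<sigma> (\<sigma> (prod.swap d)))"
  have zD: "z \<in> darts E" unfolding z_def using d by simp
  have "\<sigma> z = prod.swap d" unfolding z_def using sigma4[of "prod.swap d"] assms(2) unfolding flat_def by simp
  then have "\<phi> (prod.swap z) = prod.swap d" by (simp add: \<sigma>_def)
  then have s: "\<sigma> d = \<phi> (\<phi> (prod.swap z))" by (simp add: \<sigma>_def)
  have "F (\<sigma> d) = F (prod.swap z)" unfolding s using zD by (simp add: F_phi)
  then have l4: "length (F (prod.swap z)) = 4" using assms(3) unfolding flat_def by simp
  then have "\<phi> (\<phi> (\<sigma> d)) = prod.swap z"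
    unfolding s using F_length[of "prod.swap z"] zD unfolding l4 by (simp add: numeral_eq_Suc)
  then have "east (north d) = \<sigma> (prod.swap z)" unfolding east_def north_def sigma_swap by (simp add: \<sigma>_def)
  also have "\<dots> = north (east d)" unfolding north_def east_def z_def sigma_swap by (simp add: \<sigma>_def)
  finally show ?thesis .
qed

lemma east_darts [simp]: "d \<in> darts E \<Longrightarrow> east d \<in> darts E"
  and north_darts [simp]: "d \<in> darts E \<Longrightarrow> north d \<in> darts E"
  unfolding east_def north_def by simp_all

lemma cell_darts: "d \<in> darts E \<Longrightarrow> cell d i j \<in> darts E"
proof -
  assume d: "d \<in> darts E"
  have "(east ^^ i) d \<in> darts E" by (induction i) (use d in auto)
  then show ?thesis unfolding cell_def by (induction j) auto
qed

definition good_corner :: "nat \<Rightarrow> 'a \<times> 'a \<Rightarrow> bool" where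
  "good_corner n d \<longleftrightarrow> (\<forall>i<n. \<forall>j<n. flat (cell d i j) \<and> flat (prod.swap (cell d i j)) \<and> flat (\<sigma> (cell d i j)))"

text \<open>By definition \<open>cell\<close> goes east first and north afterwards; a further step
  to the east has to be commuted past the northward steps.\<close>

lemma cell_east:
  assumes "good_corner n d" "i < n" "j < n"
  shows "east (cell d i j) = cell d (Suc i) j"
  using assms(3)
proof (induction j)
  case (Suc j)
  then have "flat (cell d i j)" "flat (prod.swap (cell d i j))" "flat (\<sigma> (cell d i j))"
    using assms(1,2) unfolding good_corner_def by auto
  then have "east (north (cell d i j)) = north (east (cell d i j))" by (rule east_north)
  then show ?case using Suc by (simp add: cell_def)
qed (simp add: cell_def)

text \<open>East and north are read off directly; west and south are found because the dart of the
  cell is reached from those cells, and at degree 4 further turns lead back to them.\<close>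

lemma cell_nbrs:
  assumes gc: "good_corner n d" and ij: "Suc i < n" "Suc j < n"
  shows "nbrs E (fst (cell d (Suc i) (Suc j))) =
    {fst (cell d (Suc (Suc i)) (Suc j)), fst (cell d i (Suc j)), fst (cell d (Suc i) (Suc (Suc j))), fst (cell d (Suc i) j)}"
proof -
  define D where "D = cell d (Suc i) (Suc j)"
  define D1 where "D1 = cell d i (Suc j)"
  define D2 where "D2 = cell d (Suc i) j"
  have fl: "flat D" "flat D1" "flat D2" using gc ij unfolding good_corner_def D_def D1_def D2_def by auto
  then have dd: "D \<in> darts E" "D1 \<in> darts E" "D2 \<in> darts E" and c4: "card (nbrs E (fst D)) = 4" unfolding flat_def by auto
  have e1: "D = east D1" unfolding D_def D1_def using cell_east[OF gc, of i "Suc j"] ij by simp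
  have n2: "D = north D2" unfolding D_def D2_def by (simp add: cell_def)
  have f1: "fst D = snd D1" unfolding e1 east_def using dd by simp
  have f2: "fst D = snd (\<sigma> D2)" unfolding n2 north_def using dd by simp
  have s2: "\<sigma> (\<sigma> D) = prod.swap D1"
    unfolding e1 east_def using sigma4[of "prod.swap D1"] dd c4 f1 by simp
  have "\<sigma> (\<sigma> (\<sigma> D)) = prod.swap (\<sigma> D2)"
    unfolding n2 north_def using sigma4[of "prod.swap (\<sigma> D2)"] dd c4 f2 by simp
  then have h3: "snd (\<sigma> (\<sigma> (\<sigma> D))) = fst D2" using dd by simp
  have h2: "snd (\<sigma> (\<sigma> D)) = fst D1" unfolding s2 by simp
  have h0: "snd D = fst (east D)" unfolding east_def using dd by simp
  have h1: "snd (\<sigma> D) = fst (north D)" unfolding north_def using dd by simp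
  have "{..<4::nat} = {0, 1, 2, 3}" by auto
  then have "nbrs E (fst D) = {snd D, snd (\<sigma> D), snd (\<sigma> (\<sigma> D)), snd (\<sigma> (\<sigma> (\<sigma> D)))}"
    using sigma_order(2)[OF dd(1)] unfolding c4 by (simp add: numeral_eq_Suc)
  also have "\<dots> = {fst (east D), fst (north D), fst D1, fst D2}" unfolding h0 h1 h2 h3 ..
  also have "east D = cell d (Suc (Suc i)) (Suc j)" unfolding D_def by (rule cell_east[OF gc]) (use ij in auto)
  also have "north D = cell d (Suc i) (Suc (Suc j))" unfolding D_def by (simp add: cell_def)
  finally show ?thesis unfolding D_def D1_def D2_def by blast
qed

end

section \<open>Counting\<close>

context sphere_map
begin

lemma card_darts_by_face:
  "card {d \<in> darts E. Q (F d)} = (\<Sum>D\<in>{D \<in> F ` darts E. Q D}. length D)"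
proof -
  let ?S = "{d \<in> darts E. Q (F d)}"
  have "card ?S = (\<Sum>D\<in>F ` ?S. card {d \<in> ?S. F d = D})"
    using sum.image_gen[of ?S "\<lambda>_. 1::nat" F] fin by simp
  also have "F ` ?S = {D \<in> F ` darts E. Q D}" by blast
  also have "(\<Sum>D\<in>{D \<in> F ` darts E. Q D}. card {d \<in> ?S. F d = D}) = (\<Sum>D\<in>{D \<in> F ` darts E. Q D}. length D)"
  proof (rule sum.cong[OF refl])
    fix D assume "D \<in> {D \<in> F ` darts E. Q D}"
    then obtain d where d: "d \<in> darts E" "D = F d" "Q D" by blast
    then have "{d' \<in> ?S. F d' = D} = {d' \<in> darts E. F d' = F d}" by auto
    then show "card {d \<in> ?S. F d = D} = length D" using F_set[OF d(1)] d(2) by (simp add: distinct_card)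
  qed
  finally show ?thesis .
qed

text \<open>If \<open>\<phi>\<close> returns after two steps, it goes back along the same edge, so
  \<open>\<sigma> d = d\<close> and the source has no other neighbour. These are the short faces
  that the counting has to treat separately.\<close>

lemma face_length:
  assumes noloop: "\<And>u. {u} \<notin> E" and d: "d \<in> darts E"
  shows "2 \<le> length (F d)" "length (F d) = 2 \<Longrightarrow> card (nbrs E (fst d)) \<le> 1"
    "length (F d) = 3 \<Longrightarrow> \<exists>a b c. {a, b} \<in> E \<and> {b, c} \<in> E \<and> {a, c} \<in> E"
proof -
  have "d \<in> set (F d)" using F_set(1)[OF d] d by blast
  then have "length (F d) \<noteq> 0" by auto
  moreover have "length (F d) \<noteq> 1"
  proof
    assume "length (F d) = 1"
    then have "\<phi> d = d" using F_length[OF d] by simp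
    then have "snd d = fst d" using fst_phi[OF d] by simp
    then show False using noloop d unfolding darts_def by auto
  qed
  ultimately show "2 \<le> length (F d)" by linarith
  show "card (nbrs E (fst d)) \<le> 1" if l: "length (F d) = 2"
  proof -
    have pp: "\<phi> (\<phi> d) = d" using F_length[OF d] unfolding l by (simp add: numeral_2_eq_2)
    have "snd (\<phi> d) = fst d" using fst_phi[of "\<phi> d"] d pp by simp
    then have "\<phi> d = prod.swap d" using fst_phi[OF d] by (simp add: prod_eq_iff)
    then have s: "\<sigma> d = d" unfolding \<sigma>_def using pp by simp
    have "(\<sigma> ^^ k) d = d" for k by (induction k) (use s in simp_all)
    then have "nbrs E (fst d) \<subseteq> {snd d}" using sigma_order(2)[OF d] by auto
    then show ?thesis using card_mono[of "{snd d}"] by simp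
  qed
  show "\<exists>a b c. {a, b} \<in> E \<and> {b, c} \<in> E \<and> {a, c} \<in> E" if l: "length (F d) = 3"
  proof -
    have ppp: "\<phi> (\<phi> (\<phi> d)) = d" using F_length[OF d] unfolding l by (simp add: numeral_3_eq_3)
    have "fst (\<phi> d) = snd d" "fst (\<phi> (\<phi> d)) = snd (\<phi> d)" "snd (\<phi> (\<phi> d)) = fst d"
      using fst_phi[of d] fst_phi[of "\<phi> d"] fst_phi[of "\<phi> (\<phi> d)"] d ppp by simp_all
    moreover have "d \<in> darts E" "\<phi> d \<in> darts E" "\<phi> (\<phi> d) \<in> darts E" using d by simp_all
    then have "{fst d, snd d} \<in> E" "{fst (\<phi> d), snd (\<phi> d)} \<in> E" "{fst (\<phi> (\<phi> d)), snd (\<phi> (\<phi> d))} \<in> E"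
      unfolding darts_def by auto
    ultimately have "{fst d, snd d} \<in> E \<and> {snd d, snd (\<phi> d)} \<in> E \<and> {fst d, snd (\<phi> d)} \<in> E"
      by (simp add: insert_commute)
    then show ?thesis by blast
  qed
qed

lemma cell_inj: "inj_on (\<lambda>d. cell d i j) (darts E)"
proof -
  have swp: "x = y" if "prod.swap x = prod.swap y" for x y :: "'a \<times> 'a" using that by (metis swap_swap)
  have si: "x = y" if "x \<in> darts E" "y \<in> darts E" "\<sigma> x = \<sigma> y" for x y using that sigma_inj by (simp add: inj_on_def)
  have e: "x = y" if "x \<in> darts E" "y \<in> darts E" "east x = east y" for x y
    using that si[of "\<sigma> (prod.swap x)" "\<sigma> (prod.swap y)"] si[of "prod.swap x" "prod.swap y"] swp[of x y] unfolding east_def by simp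
  have n: "x = y" if "x \<in> darts E" "y \<in> darts E" "north x = north y" for x y
    using that si[of "prod.swap (\<sigma> x)" "prod.swap (\<sigma> y)"] swp[of "\<sigma> x" "\<sigma> y"] si[of x y] unfolding north_def by simp
  have ed: "(east ^^ i) x \<in> darts E" if "x \<in> darts E" for x i by (induction i) (use that in auto)
  have nd: "(north ^^ i) x \<in> darts E" if "x \<in> darts E" for x i by (induction i) (use that in auto)
  have ei: "x = y" if "x \<in> darts E" "y \<in> darts E" "(east ^^ i) x = (east ^^ i) y" for x y i
    using that
  proof (induction i)
    case (Suc i)
    then show ?case using e[of "(east ^^ i) x" "(east ^^ i) y"] ed by simp
  qed simp
  have ni: "x = y" if "x \<in> darts E" "y \<in> darts E" "(north ^^ i) x = (north ^^ i) y" for x y i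
    using that
  proof (induction i)
    case (Suc i)
    then show ?case using n[of "(north ^^ i) x" "(north ^^ i) y"] nd by simp
  qed simp
  show ?thesis unfolding cell_def
    by (rule inj_onI) (use ni ei ed in blast)
qed

text \<open>Each move is a bijection on darts, so it does not increase the number of bad darts.\<close>
lemma card_bad_corners:
  "card {d \<in> darts E. \<not> good_corner n d} \<le> 3 * n * n * card {d \<in> darts E. \<not> flat d}"
proof -
  let ?Bd = "{d \<in> darts E. \<not> flat d}"
  \<comment> \<open>The third index selects one of the three darts tested in
    \<open>good_corner\<close>; hence the factor 3.\<close>
  define h where "h = (\<lambda>(i, j, c::nat) d. if c = 0 then cell d i j else if c = 1 then prod.swap (cell d i j) else \<sigma> (cell d i j))"
  let ?I = "{..<n} \<times> {..<n} \<times> {..<3::nat}"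
  have hd: "h q d \<in> darts E" if "d \<in> darts E" for q d
    using cell_darts[OF that] unfolding h_def by (auto split: prod.split)
  have hi: "inj_on (h q) (darts E)" for q
  proof (rule inj_onI)
    fix x y assume xy: "x \<in> darts E" "y \<in> darts E" "h q x = h q y"
    obtain i j c where q: "q = (i, j, c)" by (cases q) auto
    have "cell x i j = cell y i j"
    proof (cases "c = 0 \<or> c = 1")
      case True
      then show ?thesis using xy(3) unfolding h_def q by (auto split: if_splits) (metis swap_swap)
    next
      case False
      then have "\<sigma> (cell x i j) = \<sigma> (cell y i j)" using xy(3) unfolding h_def q by simp
      then show ?thesis using sigma_inj cell_darts xy(1,2) unfolding inj_on_def by blast
    qed
    then show "x = y" using cell_inj xy(1,2) unfolding inj_on_def by blast
  qed
  have "{d \<in> darts E. \<not> good_corner n d} \<subseteq> (\<Union>q\<in>?I. {d \<in> darts E. h q d \<in> ?Bd})"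
  proof
    fix d assume "d \<in> {d \<in> darts E. \<not> good_corner n d}"
    then have d: "d \<in> darts E" "\<not> good_corner n d" by auto
    then obtain i j where ij: "i < n" "j < n" "\<not> flat (cell d i j) \<or> \<not> flat (prod.swap (cell d i j)) \<or> \<not> flat (\<sigma> (cell d i j))"
      unfolding good_corner_def by blast
    then have "\<exists>c<3. \<not> flat (h (i, j, c) d)"
    proof (elim disjE)
      assume "\<not> flat (cell d i j)" then show ?thesis unfolding h_def by (intro exI[of _ 0]) simp
    next
      assume "\<not> flat (prod.swap (cell d i j))" then show ?thesis unfolding h_def by (intro exI[of _ 1]) simp
    next
      assume "\<not> flat (\<sigma> (cell d i j))" then show ?thesis unfolding h_def by (intro exI[of _ 2]) simp
    qed
    then obtain c where "c < 3" "\<not> flat (h (i, j, c) d)" by blast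
    then have "(i, j, c) \<in> ?I" "h (i, j, c) d \<in> ?Bd" using ij hd[OF d(1)] by auto
    then show "d \<in> (\<Union>q\<in>?I. {d \<in> darts E. h q d \<in> ?Bd})" using d(1) by blast
  qed
  then have "card {d \<in> darts E. \<not> good_corner n d} \<le> card (\<Union>q\<in>?I. {d \<in> darts E. h q d \<in> ?Bd})"
    using fin by (intro card_mono) auto
  also have "\<dots> \<le> (\<Sum>q\<in>?I. card {d \<in> darts E. h q d \<in> ?Bd})" by (rule card_UN_le) simp
  also have "\<dots> \<le> (\<Sum>q\<in>?I. card ?Bd)"
  proof (rule sum_mono)
    fix q
    have "inj_on (h q) {d \<in> darts E. h q d \<in> ?Bd}" by (rule inj_on_subset[OF hi]) blast
    then show "card {d \<in> darts E. h q d \<in> ?Bd} \<le> card ?Bd"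
      by (rule card_inj_on_le) (use fin in auto)
  qed
  also have "\<dots> = 3 * n * n * card ?Bd" by simp
  finally show ?thesis .
qed

text \<open>For fixed \<open>i\<close> and \<open>j\<close> the map from \<open>d\<close> to
  \<open>cell d i j\<close> permutes the darts. Every vertex outside \<open>L\<close> is thus the
  cell \<open>(i, j)\<close> of some dart, and the cases in which that dart is bad are counted by
  \<open>card_bad_corners\<close>.\<close>

lemma card_bad_cells:
  assumes V: "finite V" "\<And>u. u \<in> V \<Longrightarrow> nbrs E u \<noteq> {} \<or> u \<in> L"  and L: "finite L"
    and sub: "\<And>d. d \<in> darts E \<Longrightarrow> fst d \<in> V"
  shows "card V \<le> card {u \<in> V. \<exists>d\<in>darts E. good_corner n d \<and> fst (cell d i j) = u} + card L +
    3 * n * n * card {d \<in> darts E. \<not> flat d}"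
proof -
  let ?G = "{u \<in> V. \<exists>d\<in>darts E. good_corner n d \<and> fst (cell d i j) = u}" and ?B = "{d \<in> darts E. \<not> good_corner n d}"
  have surj: "(\<lambda>d. cell d i j) ` darts E = darts E"
    using cell_darts by (intro endo_inj_surj[OF fin _ cell_inj]) blast
  have "V \<subseteq> ?G \<union> L \<union> (\<lambda>d. fst (cell d i j)) ` ?B"
  proof
    fix u assume u: "u \<in> V"
    show "u \<in> ?G \<union> L \<union> (\<lambda>d. fst (cell d i j)) ` ?B"
    proof (cases "u \<in> L")
      case False
      then obtain w where "(u, w) \<in> darts E" using V(2)[OF u] unfolding nbrs_def darts_def by auto
      then obtain d where d: "d \<in> darts E" "cell d i j = (u, w)" using surj by (metis (no_types, lifting) imageE)
      then have "fst (cell d i j) = u" by simp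
      then show ?thesis using d(1) u by (cases "good_corner n d") auto
    qed simp
  qed
  then have "card V \<le> card (?G \<union> L \<union> (\<lambda>d. fst (cell d i j)) ` ?B)"
    using V(1) L fin by (intro card_mono) auto
  also have "\<dots> \<le> card (?G \<union> L) + card ((\<lambda>d. fst (cell d i j)) ` ?B)" by (rule card_Un_le)
  also have "\<dots> \<le> (card ?G + card L) + card ?B"
    using card_Un_le[of ?G L] card_image_le[of ?B "\<lambda>d. fst (cell d i j)"] fin by (intro add_mono) auto
  finally show ?thesis using card_bad_corners[of n] by linarith
qed

end

text \<open>Euler's formula by weights. For the second bound, degree 4 and face length 4 have excess
  0, and negative excess occurs only at vertices of degree at most 3 and at faces of length 2, whose
  darts start at vertices of degree 1.\<close>

lemma low_degree_count:
  assumes g: "simple_graph V E" and sm: "sphere_map E \<phi> F" and euler: "card E + 1 \<le> card V + card (F ` darts E)"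
  shows "card V \<le> 5 * card {u \<in> V. card (nbrs E u) \<le> 7}"
    and "triangle_free V E \<Longrightarrow> card {d \<in> darts E. \<not> sphere_map.flat E F d} \<le> 26 * card {u \<in> V. card (nbrs E u) \<le> 3}"
proof -
  interpret sphere_map E \<phi> F by (rule sm)
  note simple = simple_graphD[OF g]
  have noloop: "{u} \<notin> E" for u using simple(2)[of "{u}"] by (auto simp: doubleton_eq_iff)
  let ?FF = "F ` darts E"
  let ?f2 = "card {D \<in> ?FF. length D = 2}"
  have finF: "finite ?FF" using fin by simp
  have len: "(\<Sum>D\<in>?FF. length D) = 2 * card E"
    using card_darts_by_face[of "\<lambda>_. True"] sum_card_nbrs(2)[OF g] by simp
  \<comment> \<open>The two darts of such a face start at vertices of degree 1, and a vertex of
    degree 1 is the source of one dart only.\<close>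
  have f2: "2 * ?f2 \<le> card {u \<in> V. card (nbrs E u) \<le> 1}"
  proof -
    have "2 * ?f2 = (\<Sum>D\<in>{D \<in> ?FF. length D = 2}. length D)" by simp
    also have "\<dots> = card {d \<in> darts E. length (F d) = 2}" using card_darts_by_face[of "\<lambda>D. length D = 2"] by simp
    also have "\<dots> \<le> card {d \<in> darts E. card (nbrs E (fst d)) \<le> 1}"
      using face_length(2)[OF noloop] fin by (intro card_mono) auto
    also have "\<dots> = (\<Sum>u\<in>{u\<in>V. card (nbrs E u) \<le> 1}. card (nbrs E u))" by (rule sum_card_nbrs(3)[OF g])
    also have "\<dots> \<le> (\<Sum>u\<in>{u\<in>V. card (nbrs E u) \<le> 1}. 1)" by (rule sum_mono) simp
    finally show ?thesis by simp
  qed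
  have L1: "card {u \<in> V. card (nbrs E u) \<le> 1} \<le> card {u \<in> V. card (nbrs E u) \<le> q}" if "1 \<le> q" for q
    using simple(1) that by (intro card_mono) auto
  have deg: "(\<Sum>u\<in>V. card (nbrs E u)) = 2 * card E" by (rule sum_card_nbrs(1)[OF g])
  show "card V \<le> 5 * card {u \<in> V. card (nbrs E u) \<le> 7}"
  proof -
    let ?L = "{u \<in> V. card (nbrs E u) \<le> 7}"
    have "3 * card ?FF \<le> 2 * card E + ?f2"
    proof -
      have "3 * card ?FF = (\<Sum>D\<in>?FF. 3)" by simp
      also have "\<dots> \<le> (\<Sum>D\<in>?FF. length D + (if length D = 2 then 1 else 0))"
        using face_length(1)[OF noloop] by (intro sum_mono) force
      also have "\<dots> = 2 * card E + ?f2"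
        using finF by (simp add: sum.distrib len sum.If_cases Int_def)
      finally show ?thesis .
    qed
    \<comment> \<open>Eliminating \<open>card E\<close> and the number of faces by Euler's formula
      leaves \<open>2 * card V \<le> 2 * ?f2 + 8 * card ?L\<close>, which is at most
      \<open>9 * card ?L\<close>.\<close>
    moreover have "8 * card V \<le> 2 * card E + 8 * card ?L"
    proof -
      have "8 * card V = (\<Sum>u\<in>V. 8)" by simp
      also have "\<dots> \<le> (\<Sum>u\<in>V. card (nbrs E u) + (if card (nbrs E u) \<le> 7 then 8 else 0))"
        by (rule sum_mono) auto
      also have "\<dots> = 2 * card E + 8 * card ?L"
        using simple(1) by (simp add: sum.distrib deg sum.If_cases Int_def)
      finally show ?thesis .
    qed
    ultimately show ?thesis using euler f2 L1[of 7] by linarith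
  qed
  show "card {d \<in> darts E. \<not> flat d} \<le> 26 * card {u \<in> V. card (nbrs E u) \<le> 3}" if tf: "triangle_free V E"
  proof -
    let ?L = "{u \<in> V. card (nbrs E u) \<le> 3}"
    have no3: "length D \<noteq> 3" if "D \<in> ?FF" for D
    proof
      assume l: "length D = 3"
      obtain d where d: "d \<in> darts E" "D = F d" using \<open>D \<in> ?FF\<close> by blast
      then obtain a b c where "{a, b} \<in> E" "{b, c} \<in> E" "{a, c} \<in> E" using face_length(3)[OF noloop d(1)] l by blast
      moreover have "a \<in> V" "b \<in> V" "c \<in> V" using simple(4) calculation by auto
      ultimately show False using tf unfolding triangle_free_def by blast
    qed
    \<comment> \<open>The factor 5 is chosen because \<open>5 * (l - 4) \<ge> l\<close> for
      \<open>l \<ge> 5\<close>, so the excess of a long face pays for all its darts; a face of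
      length 2 lacks \<open>2 + 20 - 10 = 12\<close>. Together with the vertices the total is at
      most \<open>12 * ?f2 + 20 * card ?L\<close>, hence at most
      \<open>26 * card ?L\<close>.\<close>
    have "card {d \<in> darts E. length (F d) \<noteq> 4} + 20 * card ?FF \<le> 10 * card E + 12 * ?f2"
    proof -
      have "card {d \<in> darts E. length (F d) \<noteq> 4} + 20 * card ?FF = (\<Sum>D\<in>{D\<in>?FF. length D \<noteq> 4}. length D) + (\<Sum>D\<in>?FF. 20)"
        using card_darts_by_face[of "\<lambda>D. length D \<noteq> 4"] by simp
      also have "(\<Sum>D\<in>{D\<in>?FF. length D \<noteq> 4}. length D) = (\<Sum>D\<in>?FF. if length D \<noteq> 4 then length D else 0)"
        using finF by (intro sum.inter_filter)
      also have "(\<Sum>D\<in>?FF. if length D \<noteq> 4 then length D else 0) + (\<Sum>D\<in>?FF. 20) =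
          (\<Sum>D\<in>?FF. (if length D \<noteq> 4 then length D else 0) + 20)" by (rule sum.distrib[symmetric])
      also have "\<dots> \<le> (\<Sum>D\<in>?FF. 5 * length D + (if length D = 2 then 12 else 0))"
      proof (rule sum_mono)
        fix D assume D: "D \<in> ?FF"
        then have "2 \<le> length D" using face_length(1)[OF noloop] by blast
        then show "(if length D \<noteq> 4 then length D else 0) + 20 \<le> 5 * length D + (if length D = 2 then 12 else 0)"
          using no3[OF D] by auto
      qed
      also have "\<dots> = 10 * card E + 12 * ?f2"
        using finF by (simp add: sum.distrib len sum.If_cases Int_def sum_distrib_left[symmetric])
      finally show ?thesis .
    qed
    moreover have "card {d \<in> darts E. card (nbrs E (fst d)) \<noteq> 4} + 20 * card V \<le> 10 * card E + 20 * card ?L"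
    proof -
      have "card {d \<in> darts E. card (nbrs E (fst d)) \<noteq> 4} + 20 * card V =
          (\<Sum>u\<in>{u\<in>V. card (nbrs E u) \<noteq> 4}. card (nbrs E u)) + (\<Sum>u\<in>V. 20)"
        using sum_card_nbrs(3)[OF g, of "\<lambda>u. card (nbrs E u) \<noteq> 4"] by simp
      also have "(\<Sum>u\<in>{u\<in>V. card (nbrs E u) \<noteq> 4}. card (nbrs E u)) = (\<Sum>u\<in>V. if card (nbrs E u) \<noteq> 4 then card (nbrs E u) else 0)"
        using simple(1) by (intro sum.inter_filter)
      also have "(\<Sum>u\<in>V. if card (nbrs E u) \<noteq> 4 then card (nbrs E u) else 0) + (\<Sum>u\<in>V. 20) =
          (\<Sum>u\<in>V. (if card (nbrs E u) \<noteq> 4 then card (nbrs E u) else 0) + 20)" by (rule sum.distrib[symmetric])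
      also have "\<dots> \<le> (\<Sum>u\<in>V. 5 * card (nbrs E u) + (if card (nbrs E u) \<le> 3 then 20 else 0))"
        by (rule sum_mono) auto
      also have "\<dots> = 10 * card E + 20 * card ?L"
        using simple(1) by (simp add: sum.distrib deg sum.If_cases Int_def sum_distrib_left[symmetric])
      finally show ?thesis .
    qed
    moreover have "card {d \<in> darts E. \<not> flat d} \<le> card {d \<in> darts E. length (F d) \<noteq> 4} + card {d \<in> darts E. card (nbrs E (fst d)) \<noteq> 4}"
    proof -
      have "{d \<in> darts E. \<not> flat d} \<subseteq> {d \<in> darts E. length (F d) \<noteq> 4} \<union> {d \<in> darts E. card (nbrs E (fst d)) \<noteq> 4}"
        unfolding flat_def by blast
      then have "card {d \<in> darts E. \<not> flat d} \<le> card ({d \<in> darts E. length (F d) \<noteq> 4} \<union> {d \<in> darts E. card (nbrs E (fst d)) \<noteq> 4})"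
        using fin by (intro card_mono) auto
      then show ?thesis using card_Un_le le_trans by blast
    qed
    ultimately show ?thesis using euler f2 L1[of 3] by linarith
  qed
qed

section \<open>Containing the fire in the square grid\<close>

text \<open>
  A strategy found by computer search: the pairs list the cells of the square grid that burn and the
  cells that are protected, each with its time.
\<close>
definition grid_fire :: "((nat \<times> nat) \<times> nat) list" where
  "grid_fire = [((4, 1), 0), ((3, 1), 1), ((4, 2), 1), ((3, 2), 2), ((5, 2), 2), ((4, 3), 2), ((2, 2), 3), ((3, 3), 3),
    ((4, 4), 3), ((2, 3), 4), ((3, 4), 4), ((5, 4), 4), ((1, 3), 5), ((2, 4), 5), ((3, 5), 5), ((1, 4), 6), ((2, 5), 6), ((2, 6), 7)]"

definition grid_walls :: "((nat \<times> nat) \<times> nat) list" where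
  "grid_walls = [((5, 1), 1), ((4, 0), 1), ((3, 0), 2), ((2, 1), 2), ((5, 3), 3), ((6, 2), 3), ((4, 5), 4), ((1, 2), 4),
    ((5, 5), 5), ((6, 4), 5), ((3, 6), 6), ((0, 3), 6), ((1, 5), 7), ((0, 4), 7), ((2, 7), 8), ((1, 6), 8)]"

lemma grid_walls_at_most_two: "length (filter (\<lambda>x. snd x = t) grid_walls) \<le> 2"
proof (cases "t \<le> 8")
  case True
  \<comment> \<open>The last walls are built at time 8.\<close>
  have "list_all (\<lambda>t. length (filter (\<lambda>x. snd x = t) grid_walls) \<le> 2) [0..<9]" by code_simp
  then show ?thesis using True by (simp add: list_all_iff)
next
  case False
  have "list_all (\<lambda>x. snd x \<le> 8) grid_walls" by code_simp
  then have "filter (\<lambda>x. snd x = t) grid_walls = []" using False by (auto simp: list_all_iff filter_empty_conv)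
  then show ?thesis by simp
qed

text \<open>A finite check by evaluation that the fire never gets past the walls. The bounds keep
  every burning cell inside a block of side 8, where \<open>cell_nbrs\<close> describes its
  neighbours.\<close>

lemma grid_fire_contained:
  assumes "((i, j), s) \<in> set grid_fire"
  shows "0 < i \<and> i < 7 \<and> 0 < j \<and> j < 7"
    "c \<in> {(Suc i, j), (i - 1, j), (i, Suc j), (i, j - 1)} \<Longrightarrow>
      (\<exists>s'\<le>Suc s. (c, s') \<in> set grid_fire) \<or> (\<exists>s'\<in>{1..Suc s}. (c, s') \<in> set grid_walls)"
proof -
  have "list_all (\<lambda>((i, j), s). 0 < i \<and> i < 7 \<and> 0 < j \<and> j < 7 \<and>
      list_all (\<lambda>c. list_ex (\<lambda>x. fst x = c \<and> snd x \<le> Suc s) grid_fire \<or>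
         list_ex (\<lambda>x. fst x = c \<and> 1 \<le> snd x \<and> snd x \<le> Suc s) grid_walls)
        [(Suc i, j), (i - 1, j), (i, Suc j), (i, j - 1)]) grid_fire"
    by code_simp
  then have *: "0 < i \<and> i < 7 \<and> 0 < j \<and> j < 7 \<and>
      list_all (\<lambda>c. list_ex (\<lambda>x. fst x = c \<and> snd x \<le> Suc s) grid_fire \<or>
         list_ex (\<lambda>x. fst x = c \<and> 1 \<le> snd x \<and> snd x \<le> Suc s) grid_walls)
        [(Suc i, j), (i - 1, j), (i, Suc j), (i, j - 1)]"
    using assms unfolding list_all_iff[of _ grid_fire] by blast
  then show "0 < i \<and> i < 7 \<and> 0 < j \<and> j < 7" by blast
  assume "c \<in> {(Suc i, j), (i - 1, j), (i, Suc j), (i, j - 1)}"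
  then have "list_ex (\<lambda>x. fst x = c \<and> snd x \<le> Suc s) grid_fire \<or>
      list_ex (\<lambda>x. fst x = c \<and> 1 \<le> snd x \<and> snd x \<le> Suc s) grid_walls"
    using * unfolding list_all_iff by auto
  then show "(\<exists>s'\<le>Suc s. (c, s') \<in> set grid_fire) \<or> (\<exists>s'\<in>{1..Suc s}. (c, s') \<in> set grid_walls)"
    unfolding list_ex_iff by (metis atLeastAtMost_iff prod.collapse)
qed

text \<open>The schedule is transported along \<open>p\<close>. Identified cells only make the
  images smaller, so at most as many vertices burn as there are cells in \<open>grid_fire\<close>,
  namely 18, and 19 is 18 + 1 by \<open>sn_pos\<close>.\<close>

lemma good_corner_contains_fire:
  assumes g: "simple_graph V E" and sm: "sphere_map E \<phi> F" and V2: "2 \<le> card V"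
    and d: "d \<in> darts E" "sphere_map.good_corner E \<phi> F 8 d"
  shows "card V \<le> 19 * sn 2 V E (fst (sphere_map.cell \<phi> d 4 1))"
proof -
  interpret sphere_map E \<phi> F by (rule sm)
  note simple = simple_graphD[OF g]
  define p where "p c = fst (cell d (fst c) (snd c))" for c
  have pV: "p c \<in> V" for c
  proof -
    have "cell d (fst c) (snd c) \<in> darts E" by (rule cell_darts[OF d(1)])
    then have "{p c, snd (cell d (fst c) (snd c))} \<in> E" unfolding p_def darts_def by auto
    then show ?thesis using simple(4) by blast
  qed
  define B where "B t = p ` {c. \<exists>s\<le>t. (c, s) \<in> set grid_fire}" for t
  define P where "P t = p ` set (map fst (filter (\<lambda>x. snd x = t) grid_walls))" for t
  let ?Z = "V - p ` set (map fst grid_fire)" and ?v = "p (4, 1)"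
  have vB: "?v \<in> B 0"
  proof -
    have "((4, 1), 0) \<in> set grid_fire" by (simp add: grid_fire_def)
    then show ?thesis unfolding B_def by blast
  qed
  have "card ?Z \<le> sn 2 V E ?v"
  proof (rule sn_containment[where P = P and B = B])
    show "card (P t) \<le> 2" for t
    proof -
      have "card (P t) \<le> card (set (map fst (filter (\<lambda>x. snd x = t) grid_walls)))" unfolding P_def by (rule card_image_le) simp
      also have "\<dots> \<le> length (filter (\<lambda>x. snd x = t) grid_walls)" by (metis card_length length_map)
      finally show ?thesis using grid_walls_at_most_two le_trans by blast
    qed
    show "B t \<subseteq> B (Suc t)" for t unfolding B_def using le_SucI by blast
    show "?Z \<inter> B t = {}" for t unfolding B_def by force
    show "w \<in> B (Suc t) \<or> (\<exists>s\<in>{1..Suc t}. w \<in> P s)" if u: "u \<in> B t" and uw: "{u, w} \<in> E" for t u w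
    proof -
      obtain c s where cs: "u = p c" "s \<le> t" "(c, s) \<in> set grid_fire" using u unfolding B_def by blast
      obtain i j where ij: "c = (i, j)" by (cases c)
      note fire = cs(3)[unfolded ij]
      have b: "0 < i" "i < 7" "0 < j" "j < 7" using grid_fire_contained(1)[OF fire] by auto
      have "w \<in> nbrs E (fst (cell d i j))" using uw unfolding nbrs_def cs(1) ij p_def by simp
      \<comment> \<open>Every neighbour of a burning vertex is the image of a neighbouring cell, so
        the spread in the grid controls the spread in the graph.\<close>
      also have "nbrs E (fst (cell d i j)) = {p (Suc i, j), p (i - 1, j), p (i, Suc j), p (i, j - 1)}"
        using cell_nbrs[OF d(2), of "i - 1" "j - 1"] b unfolding p_def by simp
      finally obtain c' where c': "w = p c'" "c' \<in> {(Suc i, j), (i - 1, j), (i, Suc j), (i, j - 1)}" by blast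
      from grid_fire_contained(2)[OF fire c'(2)] show ?thesis
      proof
        assume "\<exists>s'\<le>Suc s. (c', s') \<in> set grid_fire"
        then obtain s' where s': "s' \<le> Suc s" "(c', s') \<in> set grid_fire" by blast
        have "s' \<le> Suc t" using s'(1) cs(2) by simp
        then have "c' \<in> {c. \<exists>s\<le>Suc t. (c, s) \<in> set grid_fire}" using s'(2) by blast
        then show ?thesis unfolding c'(1) B_def by blast
      next
        assume "\<exists>s'\<in>{1..Suc s}. (c', s') \<in> set grid_walls"
        then obtain s' where s': "s' \<in> {1..Suc s}" "(c', s') \<in> set grid_walls" by blast
        then have "(c', s') \<in> set (filter (\<lambda>x. snd x = s') grid_walls)" by simp
        then have "fst (c', s') \<in> set (map fst (filter (\<lambda>x. snd x = s') grid_walls))" unfolding set_map by (rule imageI)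
        then have "w \<in> P s'" unfolding c'(1) P_def by simp
        then show ?thesis using s'(1) cs(2) by (intro disjI2 bexI[of _ s']) auto
      qed
    qed
    show "P t \<subseteq> V" for t using pV unfolding P_def by blast
  qed (use pV simple(1) vB in auto)
  moreover have "card V \<le> card ?Z + 18"
  proof -
    have "card (p ` set (map fst grid_fire)) \<le> length grid_fire"
      using card_image_le[of "set (map fst grid_fire)" p] card_length[of "map fst grid_fire"] by simp
    then have "card (p ` set (map fst grid_fire)) \<le> 18" by (simp add: grid_fire_def)
    then show ?thesis using diff_card_le_card_Diff[of "p ` set (map fst grid_fire)" V] by simp
  qed
  moreover have "1 \<le> sn 2 V E ?v" using sn_pos[OF pV simple(1) V2] by simp
  ultimately show ?thesis unfolding p_def by simp
qed

section \<open>From single origins to surviving rates\<close>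

lemma surviving_rate_ge:
  assumes "finite V" "2 \<le> card V" "A \<subseteq> V" and K: "\<And>u. u \<in> A \<Longrightarrow> card V \<le> K * sn k V E u" and M: "card V \<le> M * card A"
  shows "1 / (real K * real M) \<le> surviving_rate k V E"
proof -
  have "card V * card A = (\<Sum>u\<in>A. card V)" by simp
  also have "\<dots> \<le> (\<Sum>u\<in>A. K * sn k V E u)" using K by (rule sum_mono)
  also have "\<dots> \<le> (\<Sum>u\<in>V. K * sn k V E u)" using assms(1,3) by (intro sum_mono2) auto
  also have "\<dots> = K * (\<Sum>u\<in>V. sn k V E u)" by (rule sum_distrib_left[symmetric])
  finally have 1: "card V * card A \<le> K * (\<Sum>u\<in>V. sn k V E u)" .
  have "card V * card V \<le> card V * (M * card A)" using M by (rule mult_le_mono2)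
  also have "\<dots> = M * (card V * card A)" by (simp add: mult.left_commute)
  also have "\<dots> \<le> M * (K * (\<Sum>u\<in>V. sn k V E u))" using 1 by (rule mult_le_mono2)
  finally have 2: "card V * card V \<le> K * M * (\<Sum>u\<in>V. sn k V E u)" by (simp add: mult.assoc mult.left_commute)
  have n: "0 < card V" using assms(2) by simp
  then have KM: "0 < K * M" using 2 by (metis bot_nat_0.not_eq_extremum mult_is_0 nat_0_less_mult_iff not_le)
  have "real (card V * card V) \<le> real (K * M * (\<Sum>u\<in>V. sn k V E u))" using 2 by (simp only: of_nat_le_iff)
  then have "(real (card V))\<^sup>2 \<le> real K * real M * (\<Sum>u\<in>V. real (sn k V E u))"
    by (simp add: power2_eq_square)
  moreover have "0 < real K * real M" using KM by (metis of_nat_0_less_iff of_nat_mult)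
  moreover have "0 < (real (card V))\<^sup>2" using n by simp
  ultimately show ?thesis unfolding surviving_rate_def by (simp add: divide_simps mult.commute)
qed

lemma planar_sphere_map:
  assumes "simple_graph V E" "planar V E" "V \<noteq> {}"
  shows "\<exists>\<phi> F. sphere_map E \<phi> F \<and> card E + 1 \<le> card V + card (F ` darts E)"
proof -
  obtain Fs where "facial E Fs" "card E + 1 \<le> card V + size Fs" using planar_facial[OF assms] by blast
  then show ?thesis using facial_sphere_map by metis
qed

text \<open>The degree bound is \<open>2 * 4 - 1 = 7\<close>, and 60 is the product of the constants
  12 and 5.\<close>

lemma planar_rate:
  assumes g: "simple_graph V E" "planar V E" and V2: "2 \<le> card V"
  shows "1 / 60 \<le> surviving_rate 4 V E"
proof -
  note simple = simple_graphD[OF g(1)]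
  have "V \<noteq> {}" using V2 by auto
  then obtain \<phi> F where sm: "sphere_map E \<phi> F" "card E + 1 \<le> card V + card (F ` darts E)"
    using planar_sphere_map[OF g] by blast
  have "1 / (real 12 * real 5) \<le> surviving_rate 4 V E"
  proof (rule surviving_rate_ge[OF simple(1) V2])
    show "card V \<le> 5 * card {u \<in> V. card (nbrs E u) \<le> 7}" by (rule low_degree_count(1)[OF g(1) sm])
    show "card V \<le> 12 * sn 4 V E u" if "u \<in> {u \<in> V. card (nbrs E u) \<le> 7}" for u
      by (rule planar_low_degree[OF g]) (use that V2 in auto)
  qed blast
  then show ?thesis by simp
qed

text \<open>Suitable origins are the vertices of degree at most \<open>2 * 2 - 1 = 3\<close> and the
  starting cells \<open>(4, 1)\<close> of good corners. Here 4993 is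
  \<open>1 + 3 * 8 * 8 * 26\<close>, and \<open>card G\<close> adds one more.\<close>

lemma triangle_free_rate:
  assumes g: "simple_graph V E" "planar V E" and tf: "triangle_free V E" and V2: "2 \<le> card V"
  shows "1 / (real 19 * real 4994) \<le> surviving_rate 2 V E"
proof -
  note simple = simple_graphD[OF g(1)]
  have "V \<noteq> {}" using V2 by auto
  then obtain \<phi> F where sm: "sphere_map E \<phi> F" "card E + 1 \<le> card V + card (F ` darts E)"
    using planar_sphere_map[OF g] by blast
  interpret sphere_map E \<phi> F by (rule sm(1))
  define L where "L = {u \<in> V. card (nbrs E u) \<le> 3}"
  define G where "G = {u \<in> V. \<exists>d\<in>darts E. good_corner 8 d \<and> fst (cell d 4 1) = u}"
  have flat: "card {d \<in> darts E. \<not> flat d} \<le> 26 * card L" unfolding L_def by (rule low_degree_count(2)[OF g(1) sm tf])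
  have "card V \<le> card G + card L + 3 * 8 * 8 * card {d \<in> darts E. \<not> flat d}"
    unfolding G_def
  proof (rule card_bad_cells[OF simple(1)])
    show "nbrs E u \<noteq> {} \<or> u \<in> L" if "u \<in> V" for u using that unfolding L_def by auto
    show "finite L" unfolding L_def using simple(1) by simp
    show "fst d \<in> V" if "d \<in> darts E" for d
    proof -
      have "{fst d, snd d} \<in> E" using that unfolding darts_def by auto
      then show ?thesis using simple(4) by blast
    qed
  qed
  also have "\<dots> \<le> card G + 4993 * card L" using flat by linarith
  also have "\<dots> \<le> 4994 * card (G \<union> L)"
  proof -
    have "finite (G \<union> L)" unfolding G_def L_def using simple(1) by simp
    then have "card G \<le> card (G \<union> L)" "card L \<le> card (G \<union> L)" by (auto intro: card_mono)
    then show ?thesis by linarith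
  qed
  finally have M: "card V \<le> 4994 * card (G \<union> L)" .
  show ?thesis
  proof (rule surviving_rate_ge[OF simple(1) V2 _ _ M])
    show "G \<union> L \<subseteq> V" unfolding G_def L_def by blast
    fix u assume "u \<in> G \<union> L"
    then consider d where "d \<in> darts E" "good_corner 8 d" "u = fst (cell d 4 1)" | "u \<in> V" "card (nbrs E u) \<le> 3"
      unfolding G_def L_def by blast
    then show "card V \<le> 19 * sn 2 V E u"
    proof cases
      case 1
      then show ?thesis using good_corner_contains_fire[OF g(1) sm(1) V2] by blast
    next
      case 2
      have "card V \<le> 12 * sn 2 V E u" by (rule planar_low_degree[OF g 2(1)]) (use 2 V2 in auto)
      then show ?thesis by linarith
    qed
  qed
qed

text \<open>The graph \<open>(V, E)\<close> witnesses that the infimum is taken over a nonempty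
  set.\<close>

lemma class_surviving_rate_pos:
  assumes "0 < \<epsilon>" "\<And>V E. (V, E) \<in> C \<Longrightarrow> 2 \<le> card V \<Longrightarrow> \<epsilon> \<le> surviving_rate k V E"
    and "(V, E) \<in> C" "2 \<le> card V"
  shows "0 < class_surviving_rate k C"
proof -
  have "\<epsilon> \<le> class_surviving_rate k C"
    unfolding class_surviving_rate_def
  proof (rule cInf_greatest)
    show "{surviving_rate k V E | V E. (V, E) \<in> C \<and> card V \<ge> 2} \<noteq> {}" using assms(3,4) by blast
  qed (use assms(2) in blast)
  then show ?thesis using assms(1) by linarith
qed

lemma firefighter_number_bounds:
  assumes low: "\<And>k. k \<le> 1 \<Longrightarrow> class_surviving_rate k C \<le> 0" and up: "0 < class_surviving_rate m C"
  shows "2 \<le> firefighter_number C" "firefighter_number C \<le> enat m"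
proof -
  let ?l = "LEAST k. class_surviving_rate k C > 0"
  have eq: "firefighter_number C = enat ?l" unfolding firefighter_number_def using up by auto
  have "0 < class_surviving_rate ?l C" using up by (rule LeastI)
  then have "2 \<le> ?l" using low[of ?l] by (cases "?l \<le> 1") auto
  then show "2 \<le> firefighter_number C" unfolding eq by (metis enat_ord_simps(1) numeral_eq_enat)
  show "firefighter_number C \<le> enat m" unfolding eq using Least_le[of "\<lambda>k. class_surviving_rate k C > 0", OF up] by simp
qed

section \<open>The graphs K(2,N)\<close>

definition K2_edges :: "nat \<Rightarrow> nat set set" where
  "K2_edges N = {{h, l} | h l. h < 2 \<and> 2 \<le> l \<and> l < N + 2}"

text \<open>The two hubs lie above and below the axis that carries the other vertices, so straight
  segments give a drawing.\<close>

definition K2_point :: "nat \<Rightarrow> real^2" where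
  "K2_point x = (if x = 0 then vector [0, 1] else if x = 1 then vector [0, -1] else vector [real x, 0])"

lemma K2_segment:
  fixes z :: "real^2"
  assumes "h < 2" "2 \<le> l" "z \<in> closed_segment (K2_point h) (K2_point l)"
  obtains t where "0 \<le> t" "t \<le> 1" "z $ 1 = t * real l" "z $ 2 = (1 - t) * (if h = 0 then 1 else -1)"
proof -
  obtain t where "0 \<le> t" "t \<le> 1" "z = (1 - t) *\<^sub>R K2_point h + t *\<^sub>R K2_point l"
    using assms(3) unfolding closed_segment_def by blast
  moreover have "h = 0 \<or> h = 1" using assms(1) by auto
  ultimately show ?thesis using assms(2) that[of t] by (auto simp: K2_point_def)
qed

lemma planar_K2: "planar {..<N + 2} (K2_edges N)"
proof -
  define \<gamma> where "\<gamma> e = linepath (K2_point (Min e)) (K2_point (Max e))" for e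
  have mm: "Min {h, l} = h" "Max {h, l} = l" if "h < 2" "2 \<le> l" for h l :: nat
    using that by auto
  have pi: "path_image (\<gamma> {h, l}) = closed_segment (K2_point h) (K2_point l)" if "h < 2" "2 \<le> l" for h l
    unfolding \<gamma>_def mm[OF that] by simp
  have hub: "h = 0 \<or> h = 1" if "h < 2" for h :: nat using that by auto
  have pt: "K2_point h $ 1 = 0" "K2_point h $ 2 = (if h = 0 then 1 else -1)" if "h < 2" for h
    using hub[OF that] by (auto simp: K2_point_def)
  have pl: "K2_point l $ 1 = real l" "K2_point l $ 2 = 0" if "2 \<le> l" for l
    using that by (auto simp: K2_point_def)
  have inj: "inj K2_point"
  proof (rule injI)
    fix x y assume e: "K2_point x = K2_point y"
    then have "K2_point x $ 1 = K2_point y $ 1" "K2_point x $ 2 = K2_point y $ 2" by auto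
    then show "x = y" by (auto simp: K2_point_def split: if_splits)
  qed
  have eq: "z = w" if "z $ 1 = w $ 1" "z $ 2 = w $ 2" for z w :: "real^2"
    using that by (simp add: vec_eq_iff forall_2)
  show ?thesis
    unfolding planar_def
  proof (intro exI[of _ K2_point] exI[of _ \<gamma>] conjI ballI impI)
    show "inj_on K2_point {..<N + 2}" using inj by (rule inj_on_subset) simp
  next
    fix e assume "e \<in> K2_edges N"
    then obtain h l where e: "e = {h, l}" "h < 2" "2 \<le> l" unfolding K2_edges_def by blast
    have "K2_point h \<noteq> K2_point l" using injD[OF inj, of h l] e by auto
    then show "arc (\<gamma> e)" unfolding e \<gamma>_def mm[OF e(2,3)] by (rule arc_linepath)
    show "{pathstart (\<gamma> e), pathfinish (\<gamma> e)} = K2_point ` e" unfolding e \<gamma>_def mm[OF e(2,3)] by simp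
    fix x assume "K2_point x \<in> path_image (\<gamma> e)"
    then have "K2_point x \<in> closed_segment (K2_point h) (K2_point l)" unfolding e pi[OF e(2,3)] .
    from K2_segment[OF e(2,3) this] obtain t where t: "0 \<le> t" "t \<le> 1" "K2_point x $ 1 = t * real l"
      "K2_point x $ 2 = (1 - t) * (if h = 0 then 1 else -1)" .
    show "x \<in> e"
    proof (cases "x < 2")
      case True
      then have "t = 0" using t(3) pt(1)[OF True] e(3) by simp
      then have "(if x = 0 then 1 else - 1 :: real) = (if h = 0 then 1 else -1)" using t(4) pt(2)[OF True] by simp
      then have "x = h" using hub[OF True] hub[OF e(2)] by (auto split: if_splits)
      then show ?thesis unfolding e by simp
    next
      case False
      then have "t = 1" using t(4) pl(2)[of x] by (auto split: if_splits)
      then have "x = l" using t(3) pl(1)[of x] False by simp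
      then show ?thesis unfolding e by simp
    qed
  next
    fix e e' assume "e \<in> K2_edges N" "e' \<in> K2_edges N" and ne: "e \<noteq> e'"
    then obtain h l h' l' where e: "e = {h, l}" "h < 2" "2 \<le> l" and e': "e' = {h', l'}" "h' < 2" "2 \<le> l'"
      unfolding K2_edges_def by blast
    show "path_image (\<gamma> e) \<inter> path_image (\<gamma> e') \<subseteq> K2_point ` (e \<inter> e')"
    proof
      fix z assume "z \<in> path_image (\<gamma> e) \<inter> path_image (\<gamma> e')"
      then have z: "z \<in> closed_segment (K2_point h) (K2_point l)" "z \<in> closed_segment (K2_point h') (K2_point l')"
        unfolding e e' pi[OF e(2,3)] pi[OF e'(2,3)] by auto
      obtain t where t: "0 \<le> t" "t \<le> 1" "z $ 1 = t * real l" "z $ 2 = (1 - t) * (if h = 0 then 1 else -1)"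
        using K2_segment[OF e(2,3) z(1)] .
      obtain t' where t': "0 \<le> t'" "t' \<le> 1" "z $ 1 = t' * real l'" "z $ 2 = (1 - t') * (if h' = 0 then 1 else -1)"
        using K2_segment[OF e'(2,3) z(2)] .
      show "z \<in> K2_point ` (e \<inter> e')"
      proof (cases "h = h'")
        case True
        \<comment> \<open>For a common hub the height of the point determines the parameter; for
          different hubs the signs of the heights leave only the axis.\<close>
        then have "t = t'" using t(4) t'(4) by (auto split: if_splits)
        moreover have "l \<noteq> l'" using ne True e e' by auto
        ultimately have "t = 0" using t(3) t'(3) by auto
        then have "z = K2_point h" by (intro eq) (use t pt[OF e(2)] in auto)
        then show ?thesis using True e e' by auto
      next
        case False
        then have "1 - t = - (1 - t')" using t(4) t'(4) hub[OF e(2)] hub[OF e'(2)] by (auto split: if_splits)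
        then have "t = 1" "t' = 1" using t(2) t'(2) by auto
        then have "l = l'" using t(3) t'(3) by simp
        moreover have "z = K2_point l" by (intro eq) (use t pl[OF e(3)] \<open>t = 1\<close> in auto)
        ultimately show ?thesis using e e' by auto
      qed
    qed
  qed
qed

lemma simple_K2: "simple_graph {..<N + 2} (K2_edges N)"
proof -
  have "\<exists>u v. e = {u, v} \<and> u \<noteq> v \<and> u \<in> {..<N + 2} \<and> v \<in> {..<N + 2}" if "e \<in> K2_edges N" for e
  proof -
    obtain h l where "e = {h, l}" "h < 2" "2 \<le> l" "l < N + 2" using \<open>e \<in> K2_edges N\<close> unfolding K2_edges_def by blast
    then show ?thesis by (intro exI[of _ h] exI[of _ l]) auto
  qed
  then show ?thesis unfolding simple_graph_def by blast
qed

lemma K2_edge_iff: "{a, b} \<in> K2_edges N \<longleftrightarrow> a < 2 \<and> 2 \<le> b \<and> b < N + 2 \<or> b < 2 \<and> 2 \<le> a \<and> a < N + 2"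
  unfolding K2_edges_def by (auto simp: doubleton_eq_iff)

lemma triangle_free_K2: "triangle_free V (K2_edges N)"
  unfolding triangle_free_def K2_edge_iff by auto

text \<open>A fire starting at a hub reaches all unprotected vertices of the other class at time 1.
  One starting elsewhere reaches a hub at time 1, as at most one hub is protected, and spreads from
  there at time 2. Only the two hubs and the vertices protected at times 1 and 2 can be
  saved.\<close>

lemma sn_K2_le:
  assumes k: "k \<le> 1" and v: "v < N + 2"
  shows "sn k {..<N + 2} (K2_edges N) v \<le> 4"
proof -
  let ?V = "{..<N + 2}" and ?E = "K2_edges N"
  have le: "card (saved ?V ?E v S) \<le> 4" if S: "valid_strategy k ?V ?E v S" for S
  proof -
    have c: "card (S (Suc t)) \<le> 1" "finite (S (Suc t))" for t
      using S k finite_subset[of "S (Suc t)" ?V] unfolding valid_strategy_def by (auto intro: le_trans)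
    have p1: "protected S 1 = S 1" unfolding protected_def by simp
    have "{1..2::nat} = {1, 2}" by auto
    then have p2: "protected S 2 = S 1 \<union> S 2" unfolding protected_def by simp
    have b1: "w \<in> burning ?V ?E v S 1" if "w \<in> ?V" "w \<notin> S 1" "{v, w} \<in> ?E" for w
      using that p1 by simp
    have b2: "w \<in> burning ?V ?E v S 2" if "w \<in> ?V" "w \<notin> S 1" "w \<notin> S 2" "u \<in> burning ?V ?E v S 1" "{u, w} \<in> ?E" for w u
      using that p2 by (auto simp: numeral_2_eq_2)
    have "saved ?V ?E v S \<subseteq> S 1 \<union> S 2 \<union> {0, 1}"
    proof
      fix w assume w: "w \<in> saved ?V ?E v S"
      show "w \<in> S 1 \<union> S 2 \<union> {0, 1}"
      proof (rule ccontr)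
        assume "w \<notin> S 1 \<union> S 2 \<union> {0, 1}"
        then have wn: "w \<notin> S 1" "w \<notin> S 2" "2 \<le> w" by auto
        have "w \<in> ?V" "\<And>t. w \<notin> burning ?V ?E v S t" using w unfolding saved_def by blast+
        then have wV: "w \<in> ?V" "w \<notin> burning ?V ?E v S 1" "w \<notin> burning ?V ?E v S 2" by blast+
        show False
        proof (cases "v < 2")
          case True
          then show False using b1[OF wV(1) wn(1)] wV(1,2) wn(3) K2_edge_iff[of v w N] by auto
        next
          case False
          have "\<exists>h<2. h \<notin> S 1"
          proof (rule ccontr)
            assume "\<not> ?thesis"
            then have "{0, 1} \<subseteq> S 1" by auto
            then have "card {0, 1::nat} \<le> card (S 1)" using c(2)[of 0] by (intro card_mono) auto
            then show False using c(1)[of 0] by simp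
          qed
          then obtain h where h: "h < 2" "h \<notin> S 1" by blast
          then have "h \<in> burning ?V ?E v S 1" using b1[of h] False v K2_edge_iff[of v h N] by auto
          moreover have "{h, w} \<in> ?E" using h(1) wn(3) wV(1) K2_edge_iff[of h w N] by auto
          ultimately have "w \<in> burning ?V ?E v S 2" by (rule b2[OF wV(1) wn(1,2)])
          then show False using wV(3) by blast
        qed
      qed
    qed
    then have "card (saved ?V ?E v S) \<le> card (S 1 \<union> S 2 \<union> {0, 1})"
      using c(2)[of 0] c(2)[of 1] by (intro card_mono) (auto simp: numeral_2_eq_2)
    also have "\<dots> \<le> card (S 1 \<union> S 2) + card {0, 1::nat}" by (rule card_Un_le)
    also have "\<dots> \<le> (card (S 1) + card (S 2)) + 2" using card_Un_le[of "S 1" "S 2"] by simp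
    also have "\<dots> \<le> 4" using c(1)[of 0] c(1)[of 1] by (simp add: numeral_2_eq_2)
    finally show ?thesis .
  qed
  have "valid_strategy k ?V ?E v (\<lambda>_. {})" unfolding valid_strategy_def by simp
  then have "{card (saved ?V ?E v S) | S. valid_strategy k ?V ?E v S} \<noteq> {}" by blast
  moreover have "{card (saved ?V ?E v S) | S. valid_strategy k ?V ?E v S} \<subseteq> {..4}" using le by auto
  ultimately show ?thesis
    unfolding sn_def using finite_subset[of _ "{..4::nat}"] by (subst Max_le_iff) auto
qed

lemma surviving_rate_nonneg: "0 \<le> surviving_rate k V E"
  unfolding surviving_rate_def by (simp add: sum_nonneg)

text \<open>The rate of \<open>K2_edges N\<close> is at most \<open>4 / (N + 2)\<close>, which tends
  to 0. Rates are nonnegative, so the infimum is a true lower bound for each of them.\<close>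

lemma class_surviving_rate_le_0:
  assumes k: "k \<le> 1" and C: "\<And>N. ({..<N + 2}, K2_edges N) \<in> C"
  shows "class_surviving_rate k C \<le> 0"
proof (rule field_le_epsilon)
  fix \<epsilon> :: real assume "0 < \<epsilon>"
  obtain N :: nat where N: "4 / \<epsilon> < real N" using reals_Archimedean2 by blast
  let ?R = "{surviving_rate k V E | V E. (V, E) \<in> C \<and> card V \<ge> 2}"
  have q: "4 * x / x\<^sup>2 = 4 / x" for x :: real by (simp add: power2_eq_square)
  have "bdd_below ?R" using surviving_rate_nonneg by (intro bdd_belowI[of _ 0]) auto
  moreover have "surviving_rate k {..<N + 2} (K2_edges N) \<in> ?R"
    by (rule CollectI, rule exI[of _ "{..<N + 2}"], rule exI[of _ "K2_edges N"]) (use C[of N] in simp)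
  ultimately have "class_surviving_rate k C \<le> surviving_rate k {..<N + 2} (K2_edges N)"
    unfolding class_surviving_rate_def by (rule cInf_lower[rotated])
  also have "\<dots> \<le> (\<Sum>v\<in>{..<N + 2}. 4) / (real (card {..<N + 2}))\<^sup>2"
    unfolding surviving_rate_def using sn_K2_le[OF k] by (intro divide_right_mono sum_mono) (auto simp: of_nat_le_iff[of _ 4, simplified])
  also have "\<dots> = 4 * (real N + 2) / (real N + 2)\<^sup>2" by (simp add: algebra_simps)
  also have "\<dots> = 4 / (real N + 2)" by (rule q)
  also have "\<dots> \<le> \<epsilon>" using N \<open>0 < \<epsilon>\<close> by (simp add: field_simps)
  finally show "class_surviving_rate k C \<le> 0 + \<epsilon>" by simp
qed

section \<open>The firefighter number\<close>

theorem theorem1: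
  shows "2 \<le> firefighter_number planar_graphs \<and> firefighter_number planar_graphs \<le> 4
         \<and> firefighter_number triangle_free_planar_graphs = 2"
proof -
  have K2: "({..<N + 2}, K2_edges N) \<in> planar_graphs" "({..<N + 2}, K2_edges N) \<in> triangle_free_planar_graphs" for N
    using simple_K2 planar_K2 triangle_free_K2 unfolding planar_graphs_def triangle_free_planar_graphs_def by auto
  \<comment> \<open>\<open>K2(1)[of 0]\<close> supplies the required member of the class: two
    vertices and no edge.\<close>
  have "0 < class_surviving_rate 4 planar_graphs"
    by (rule class_surviving_rate_pos[of "1 / 60", OF _ _ K2(1)[of 0]]) (auto simp: planar_graphs_def intro: planar_rate[simplified])
  moreover have "0 < class_surviving_rate 2 triangle_free_planar_graphs"
    by (rule class_surviving_rate_pos[of "1 / (real 19 * real 4994)", OF _ _ K2(2)[of 0]])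
      (auto simp: triangle_free_planar_graphs_def intro: triangle_free_rate[simplified])
  ultimately show ?thesis
    using firefighter_number_bounds[OF class_surviving_rate_le_0[OF _ K2(1)]]
      firefighter_number_bounds[OF class_surviving_rate_le_0[OF _ K2(2)]]
    by (metis antisym numeral_eq_enat)
qed

end
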